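(* Let $x^A=x_1^{\alpha_1}\cdots x_N^{\alpha_N}$ with $\alpha_i\ge0$, $D=N+\sum_i\alpha_i$, $\mathbb{R}^N_*=\{x\in\mathbb{R}^N:x_i>0\text{ whenever }\alpha_i>0\}$. For $u\in S_A$ define $$\delta_A(u)=\left(\int_{\mathbb{R}^N_*}|\nabla u|^2x^A dx\right)^{1/2}\left(\int_{\mathbb{R}^N_*}|u|^2|x|^2x^Adx\right)^{1/2}-\frac D2\int_{\mathbb{R}^N_*}|u|^2x^Adx,$$ $$d_A(u,E_{HUPA})=\inf_{c\in\mathbb{R},\,\lambda\ne0}\left(\int_{\mathbb{R}^N_*}\left|u-ce^{-\frac{|x|^2}{2\lambda^2}}\right|^2x^Adx\right)^{1/2},$$ $$\widetilde d_A(u,F)=\inf_{c\in\mathbb{R},\,\vec d\in\mathbb{R}^N,\,\lambda\ne0}\left(\int_{\mathbb{R}^N_*}\left|u-(c+\vec d\cdot x)e^{-\frac{|x|^2}{2\lambda^2}}\right|^2x^Adx\right)^{1/2}.$$ Then for all $u\in S_A$, $$\delta_A(u)-d_A^2(u,E_{HUPA})\ge\frac12\widetilde d_A^{\,2}(u,F).$$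
   Context: $N_*$ is the set of $u\in C_0^\infty(\overline{\mathbb{R}^N_*})$ with $\nabla u\cdot\vec\eta=0$ on $\partial\mathbb{R}^N_*$ ($\vec\eta$ the outer normal). $S_A$ is the completion of $N_*$ under the norm $\left(\int_{\mathbb{R}^N_*}|\nabla u|^2x^Adx\right)^{1/2}+\left(\int_{\mathbb{R}^N_*}|u|^2|x|^2x^Adx\right)^{1/2}$. $E_{HUPA}=\{\alpha e^{-\beta|x|^2}\}$ and $F=\{(\alpha+\vec\gamma\cdot x)e^{-\beta|x|^2}:\alpha\in\mathbb{R},\vec\gamma\in\mathbb{R}^N,\beta>0\}$. *)

theory Defs
  imports "HOL-Analysis.Analysis"
begin

definition partial :: "'n::finite \<Rightarrow> (real^'n \<Rightarrow> real) \<Rightarrow> real^'n \<Rightarrow> real" where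
  "partial i f x = frechet_derivative f (at x) (axis i 1)"

definition grad :: "(real^'n::finite \<Rightarrow> real) \<Rightarrow> real^'n \<Rightarrow> real^'n" where
  "grad f x = (\<chi> i. partial i f x)"

fun Ck :: "nat \<Rightarrow> (real^'n::finite \<Rightarrow> real) \<Rightarrow> bool" where
  "Ck 0 f = continuous_on UNIV f"
| "Ck (Suc k) f = (continuous_on UNIV f \<and> (\<forall>x. f differentiable (at x))
                    \<and> (\<forall>i. Ck k (partial i f)))"

definition smooth :: "(real^'n::finite \<Rightarrow> real) \<Rightarrow> bool" where
  "smooth f \<longleftrightarrow> (\<forall>k. Ck k f)"

definition xA :: "real^'n::finite \<Rightarrow> real^'n \<Rightarrow> real" where
  "xA \<alpha> x = (\<Prod>i\<in>UNIV. if \<alpha> $ i = 0 then 1 else (x $ i) powr (\<alpha> $ i))"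

definition RNs :: "real^'n::finite \<Rightarrow> (real^'n) set" where
  "RNs \<alpha> = {x. \<forall>i. \<alpha> $ i > 0 \<longrightarrow> x $ i > 0}"

definition RNs_closure :: "real^'n::finite \<Rightarrow> (real^'n) set" where
  "RNs_closure \<alpha> = {x. \<forall>i. \<alpha> $ i > 0 \<longrightarrow> x $ i \<ge> 0}"

text \<open>N_*: restrictions to the closure of R^N_* of smooth compactly supported functions
  with vanishing normal derivative on the boundary (on the face x_i = 0, alpha_i > 0, the outer
  normal is -e_i, so the condition is that the i-th partial derivative vanishes there).\<close>
definition Nstar :: "real^'n::finite \<Rightarrow> (real^'n \<Rightarrow> real) set" where
  "Nstar \<alpha> = {\<phi>. smooth \<phi> \<and> compact (closure {x. \<phi> x \<noteq> 0})
      \<and> (\<forall>i x. \<alpha> $ i > 0 \<and> x \<in> RNs_closure \<alpha> \<and> x $ i = 0 \<longrightarrow> partial i \<phi> x = 0)}"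

definition wint :: "real^'n::finite \<Rightarrow> (real^'n \<Rightarrow> real) \<Rightarrow> real" where
  "wint \<alpha> f = (LINT x : RNs \<alpha> | lborel. f x * xA \<alpha> x)"

definition wnn :: "real^'n::finite \<Rightarrow> (real^'n \<Rightarrow> real) \<Rightarrow> ennreal" where
  "wnn \<alpha> f = (\<integral>\<^sup>+ x. ennreal (f x * xA \<alpha> x) * indicator (RNs \<alpha>) x \<partial>lborel)"

text \<open>S_A, the completion of N_* under
  ||u|| = (int |grad u|^2 x^A)^(1/2) + (int |u|^2 |x|^2 x^A)^(1/2),
  realised concretely: an element is a pair (u, g) (g playing the role of grad u) which is the
  limit in this norm of a sequence of elements of N_*.\<close>
definition SA :: "real^'n::finite \<Rightarrow> ((real^'n \<Rightarrow> real) \<times> (real^'n \<Rightarrow> real^'n)) set" where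
  "SA \<alpha> = {(u, g). u \<in> borel_measurable lborel \<and> g \<in> borel_measurable lborel \<and>
      (\<exists>\<phi>::nat \<Rightarrow> real^'n \<Rightarrow> real. (\<forall>k. \<phi> k \<in> Nstar \<alpha>) \<and>
         ((\<lambda>k. wnn \<alpha> (\<lambda>x. (norm (grad (\<phi> k) x - g x))\<^sup>2)) \<longlonglongrightarrow> 0) \<and>
         ((\<lambda>k. wnn \<alpha> (\<lambda>x. (\<phi> k x - u x)\<^sup>2 * (norm x)\<^sup>2)) \<longlonglongrightarrow> 0))}"

definition homdim :: "real^'n::finite \<Rightarrow> real" where
  "homdim \<alpha> = real CARD('n) + (\<Sum>i\<in>UNIV. \<alpha> $ i)"

definition deltaA :: "real^'n::finite \<Rightarrow> (real^'n \<Rightarrow> real) \<Rightarrow> (real^'n \<Rightarrow> real^'n) \<Rightarrow> real" where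
  "deltaA \<alpha> u g = sqrt (wint \<alpha> (\<lambda>x. (norm (g x))\<^sup>2)) * sqrt (wint \<alpha> (\<lambda>x. (u x)\<^sup>2 * (norm x)\<^sup>2))
      - homdim \<alpha> / 2 * wint \<alpha> (\<lambda>x. (u x)\<^sup>2)"

definition dA :: "real^'n::finite \<Rightarrow> (real^'n \<Rightarrow> real) \<Rightarrow> real" where
  "dA \<alpha> u = Inf {sqrt (wint \<alpha> (\<lambda>x. (u x - c * exp (- (norm x)\<^sup>2 / (2 * lam\<^sup>2)))\<^sup>2)) | c lam. lam \<noteq> 0}"

definition dtA :: "real^'n::finite \<Rightarrow> (real^'n \<Rightarrow> real) \<Rightarrow> real" where
  "dtA \<alpha> u = Inf {sqrt (wint \<alpha> (\<lambda>x. (u x - (c + d \<bullet> x) * exp (- (norm x)\<^sup>2 / (2 * lam\<^sup>2)))\<^sup>2))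
                   | c d lam. lam \<noteq> 0}"

end

theory Submission
  imports Defs "HOL-Probability.Probability" "HOL-Real_Asymp.Real_Asymp"
begin

text \<open>Twice the deficit is the infimum over \<open>a > 0\<close> of the quadratic functionals
  \<open>X / a + a * Y - D * W\<close>, where \<open>X\<close>, \<open>Y\<close>, \<open>W\<close> are the weighted integrals of \<open>|\<nabla>u|\<^sup>2\<close>,
  \<open>u\<^sup>2 |x|\<^sup>2\<close>, \<open>u\<^sup>2\<close>. Dividing \<open>u\<close> by the Gaussian \<open>exp (- a |x|\<^sup>2 / 2)\<close> turns such a functional into a
  Dirichlet form for the product of the probability measures proportional to \<open>t\<^sup>b exp (- a t\<^sup>2)\<close>,
  on the line if \<open>b = 0\<close> and on the half-line if \<open>b > 0\<close>. In one variable the spectrum is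
  \<open>0, 2 a, 4 a, \<dots>\<close>, respectively \<open>0, 4 a, \<dots>\<close>, and the value \<open>2 a\<close> belongs to linear functions. Hence,
  after normalisation, the energy of \<open>v\<close> is at least twice the variance of \<open>v\<close> plus twice the squared
  distance of \<open>v\<close> from the affine functions. This form of the gap tensorizes by Bessel's inequality.
  Elements of \<open>S\<^sub>A\<close> are reached by approximation, and the optimal \<open>a\<close> gives the product of norms.\<close>

section \<open>Orthonormal families in spaces of square-integrable functions\<close>

text \<open>Variance alone is exhausted by the linear modes, so the plain gap cannot see that
  everything orthogonal to the affine functions sits at level 4 or higher; the second distance
  records this. It survives products because a product of two linear modes in different variables
  already has level 2 + 2 = 4. No eigenfunction expansion is used. The level \<open>4 a\<close> in
  one variable comes from Jacobi's substitution with the eigenfunction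
  \<open>t^2 - (b + 1) / (2 a)\<close>. This function has zeros, so the given function is first
  corrected there, by a constant on the half-line (one zero) and by an affine function on the line
  (two zeros). The correction has exactly the dimension of the spectral space below
  \<open>4 a\<close>. For fixed \<open>a\<close> both approximants carry the same Gaussian, that is
  \<open>lam = 1 / sqrt a\<close>. They bound both infima from above whatever \<open>a\<close> is,
  so only the right-hand side depends on \<open>a\<close> when it is optimised. The norm of the
  completion contains no plain square norm. Before the middle term of the deficit can pass to the
  limit, the uncertainty principle itself must supply that convergence.\<close>

definition square_integrable :: "'a measure \<Rightarrow> ('a \<Rightarrow> real) \<Rightarrow> bool" where
  "square_integrable M f \<longleftrightarrow> f \<in> borel_measurable M \<and> integrable M (\<lambda>x. (f x)\<^sup>2)"

lemma square_integrable_mult: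
  assumes "square_integrable M f" "square_integrable M g"
  shows "integrable M (\<lambda>x. f x * g x)"
proof (rule Bochner_Integration.integrable_bound[of _ "\<lambda>x. (f x)\<^sup>2 + (g x)\<^sup>2"])
  show "AE x in M. norm (f x * g x) \<le> norm ((f x)\<^sup>2 + (g x)\<^sup>2)"
  proof (rule AE_I2)
    fix x
    have "2 * (\<bar>f x\<bar> * \<bar>g x\<bar>) \<le> (f x)\<^sup>2 + (g x)\<^sup>2"
      using sum_squares_bound[of "\<bar>f x\<bar>" "\<bar>g x\<bar>"] by (simp add: mult.assoc)
    moreover have "0 \<le> \<bar>f x\<bar> * \<bar>g x\<bar>" by simp
    ultimately have "\<bar>f x\<bar> * \<bar>g x\<bar> \<le> (f x)\<^sup>2 + (g x)\<^sup>2" by linarith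
    then show "norm (f x * g x) \<le> norm ((f x)\<^sup>2 + (g x)\<^sup>2)"
      by (simp add: abs_mult)
  qed
qed (use assms in \<open>auto simp: square_integrable_def\<close>)

lemma square_integrable_add:
  assumes "square_integrable M f" "square_integrable M g"
  shows "square_integrable M (\<lambda>x. f x + g x)"
  using assms square_integrable_mult[OF assms]
  by (auto simp: square_integrable_def power2_sum mult.assoc)

lemma square_integrable_cmult:
  assumes "square_integrable M f"
  shows "square_integrable M (\<lambda>x. c * f x)"
  using assms by (auto simp: square_integrable_def power_mult_distrib)

lemma square_integrable_sum:
  assumes "finite J" "\<And>j. j \<in> J \<Longrightarrow> square_integrable M (f j)"
  shows "square_integrable M (\<lambda>x. \<Sum>j\<in>J. f j x)"
  using assms
proof (induction J rule: finite_induct)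
  case empty
  then show ?case by (simp add: square_integrable_def)
next
  case (insert a J)
  then show ?case using square_integrable_add[of M "f a" "\<lambda>x. \<Sum>j\<in>J. f j x"] by simp
qed

lemma square_integrable_diff:
  assumes "square_integrable M f" "square_integrable M g"
  shows "square_integrable M (\<lambda>x. f x - g x)"
  using square_integrable_add[OF assms(1) square_integrable_cmult[OF assms(2), of "-1"]] by simp

lemma (in finite_measure) integrable_bounded:
  fixes f :: "'a \<Rightarrow> real"
  assumes "f \<in> borel_measurable M" "\<And>x. x \<in> space M \<Longrightarrow> \<bar>f x\<bar> \<le> B"
  shows "integrable M f"
  by (rule integrable_const_bound[of _ B]) (use assms in auto)

lemma (in finite_measure) square_integrable_bounded:
  fixes f :: "'a \<Rightarrow> real"
  assumes "f \<in> borel_measurable M" "\<And>x. x \<in> space M \<Longrightarrow> \<bar>f x\<bar> \<le> B"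
  shows "square_integrable M f"
  unfolding square_integrable_def
proof (intro conjI integrable_bounded[where B = "B\<^sup>2"])
  fix x assume "x \<in> space M"
  with assms(2)[OF this] show "\<bar>(f x)\<^sup>2\<bar> \<le> B\<^sup>2"
    by (metis abs_ge_zero abs_power2 power2_abs power_mono)
qed (use assms in auto)

lemma (in finite_measure) square_integrable_const: "square_integrable M (\<lambda>x. c)"
  by (rule square_integrable_bounded[where B = "\<bar>c\<bar>"]) auto

lemma (in finite_measure) square_integrable_integrable:
  assumes "square_integrable M f"
  shows "integrable M f"
  using square_integrable_mult[OF assms square_integrable_const[of 1]] by simp

definition orthonormal_family :: "'a measure \<Rightarrow> 'i set \<Rightarrow> ('i \<Rightarrow> 'a \<Rightarrow> real) \<Rightarrow> bool" where
  "orthonormal_family M J e \<longleftrightarrow> finite J \<and> (\<forall>j\<in>J. square_integrable M (e j)) \<and>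
     (\<forall>j\<in>J. \<forall>l\<in>J. (\<integral>x. e j x * e l x \<partial>M) = (if j = l then 1 else 0))"

lemma orthonormal_integral_residual:
  assumes "orthonormal_family M J e" "square_integrable M f"
  shows "(\<integral>x. (f x - (\<Sum>j\<in>J. (\<integral>y. f y * e j y \<partial>M) * e j x))\<^sup>2 \<partial>M)
    = (\<integral>x. (f x)\<^sup>2 \<partial>M) - (\<Sum>j\<in>J. (\<integral>y. f y * e j y \<partial>M)\<^sup>2)"
proof -
  define c where "c j = (\<integral>y. f y * e j y \<partial>M)" for j
  have fin: "finite J" and e: "\<And>j. j \<in> J \<Longrightarrow> square_integrable M (e j)"
    and on: "\<And>j l. j \<in> J \<Longrightarrow> l \<in> J \<Longrightarrow> (\<integral>x. e j x * e l x \<partial>M) = (if j = l then 1 else 0)"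
    using assms(1) by (auto simp: orthonormal_family_def)
  have if2: "integrable M (\<lambda>x. (f x)\<^sup>2)" using assms(2) by (simp add: square_integrable_def)
  have ife: "integrable M (\<lambda>x. f x * e j x)" if "j \<in> J" for j
    using square_integrable_mult[OF assms(2) e[OF that]] .
  have iee: "integrable M (\<lambda>x. e j x * e l x)" if "j \<in> J" "l \<in> J" for j l
    using square_integrable_mult[OF e e] that by auto
  have eq: "(f x - (\<Sum>j\<in>J. c j * e j x))\<^sup>2 = (f x)\<^sup>2 - 2 * (\<Sum>j\<in>J. c j * (f x * e j x))
      + (\<Sum>j\<in>J. \<Sum>l\<in>J. (c j * c l) * (e j x * e l x))" for x
  proof -
    have "(\<Sum>j\<in>J. c j * e j x)\<^sup>2 = (\<Sum>j\<in>J. \<Sum>l\<in>J. (c j * c l) * (e j x * e l x))"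
      by (simp add: power2_eq_square sum_product algebra_simps)
    moreover have "f x * (\<Sum>j\<in>J. c j * e j x) = (\<Sum>j\<in>J. c j * (f x * e j x))"
      by (simp add: sum_distrib_left algebra_simps)
    ultimately show ?thesis by (simp add: power2_diff algebra_simps)
  qed
  have "(\<integral>x. (f x - (\<Sum>j\<in>J. c j * e j x))\<^sup>2 \<partial>M)
      = (\<integral>x. (f x)\<^sup>2 \<partial>M) - 2 * (\<Sum>j\<in>J. c j * (\<integral>x. f x * e j x \<partial>M))
      + (\<Sum>j\<in>J. \<Sum>l\<in>J. (c j * c l) * (\<integral>x. e j x * e l x \<partial>M))"
    unfolding eq using if2 ife iee by simp
  also have "(\<Sum>j\<in>J. \<Sum>l\<in>J. (c j * c l) * (\<integral>x. e j x * e l x \<partial>M)) = (\<Sum>j\<in>J. (c j)\<^sup>2)"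
    using fin by (intro sum.cong refl) (simp add: on power2_eq_square if_distrib cong: if_cong)
  also have "(\<Sum>j\<in>J. c j * (\<integral>x. f x * e j x \<partial>M)) = (\<Sum>j\<in>J. (c j)\<^sup>2)"
    by (simp add: c_def power2_eq_square)
  finally show ?thesis by (simp add: c_def)
qed

lemma bessel_inequality:
  assumes "orthonormal_family M J e" "square_integrable M f"
  shows "(\<Sum>j\<in>J. (\<integral>y. f y * e j y \<partial>M)\<^sup>2) \<le> (\<integral>x. (f x)\<^sup>2 \<partial>M)"
proof -
  have "0 \<le> (\<integral>x. (f x - (\<Sum>j\<in>J. (\<integral>y. f y * e j y \<partial>M) * e j x))\<^sup>2 \<partial>M)" by simp
  then show ?thesis unfolding orthonormal_integral_residual[OF assms] by simp
qed

lemma (in prob_space) abs_integral_bounded_mult_le: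
  fixes f g :: "'a \<Rightarrow> real"
  assumes "f \<in> borel_measurable M" "\<And>x. x \<in> space M \<Longrightarrow> \<bar>f x\<bar> \<le> B" "integrable M g"
  shows "\<bar>\<integral>x. f x * g x \<partial>M\<bar> \<le> B * (\<integral>x. \<bar>g x\<bar> \<partial>M)"
proof -
  have le: "norm (f x * g x) \<le> B * \<bar>g x\<bar>" if "x \<in> space M" for x
    using assms(2)[OF that] by (simp add: abs_mult mult_right_mono)
  have bound: "integrable M (\<lambda>x. B * \<bar>g x\<bar>)" using assms(3) by simp
  have "integrable M (\<lambda>x. f x * g x)"
    by (rule Bochner_Integration.integrable_bound[OF bound])
      (use assms le in \<open>auto intro!: AE_I2 order_trans[OF _ abs_ge_self]\<close>)
  then have "(\<integral>x. \<bar>f x * g x\<bar> \<partial>M) \<le> (\<integral>x. B * \<bar>g x\<bar> \<partial>M)"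
    using bound le by (intro integral_mono) auto
  then have "\<bar>\<integral>x. f x * g x \<partial>M\<bar> \<le> (\<integral>x. B * \<bar>g x\<bar> \<partial>M)"
    by (rule order_trans[OF integral_abs_bound])
  then show ?thesis by simp
qed

text \<open>Let \<open>r\<close> be what remains of \<open>f\<close> after projection onto the
  \<open>g l\<close> in the second variable. The coefficient of \<open>r\<close> along
  \<open>e j\<close> is \<open>c j\<close> minus its own projection onto the \<open>g l\<close>.
  Bessel's inequality in the first variable, integrated over the second, then compares the distances
  of the \<open>c j\<close> from the span of the \<open>g l\<close> with the mean distance of the
  fibres of \<open>f\<close> from that span. Boundedness of \<open>f\<close> makes every exchange of
  integrals legitimate.\<close>

lemma (in pair_prob_space) bessel_inequality_product:
  fixes f :: "'a \<times> 'b \<Rightarrow> real"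
  assumes f[measurable]: "f \<in> borel_measurable (M1 \<Otimes>\<^sub>M M2)"
    and B: "\<And>z. z \<in> space (M1 \<Otimes>\<^sub>M M2) \<Longrightarrow> \<bar>f z\<bar> \<le> B"
    and e: "orthonormal_family M1 J e" and g: "orthonormal_family M2 L g"
  defines "c \<equiv> \<lambda>j t. \<integral>x. f (x, t) * e j x \<partial>M1"
    and "d \<equiv> \<lambda>l x. \<integral>t. f (x, t) * g l t \<partial>M2"
  shows "(\<Sum>j\<in>J. (\<integral>t. (c j t)\<^sup>2 \<partial>M2) - (\<Sum>l\<in>L. (\<integral>t. c j t * g l t \<partial>M2)\<^sup>2))
    \<le> (\<integral>x. (\<integral>t. (f (x, t))\<^sup>2 \<partial>M2) - (\<Sum>l\<in>L. (d l x)\<^sup>2) \<partial>M1)"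
proof -
  have finJ: "finite J" and finL: "finite L"
    and se: "\<And>j. j \<in> J \<Longrightarrow> square_integrable M1 (e j)"
    and sg: "\<And>l. l \<in> L \<Longrightarrow> square_integrable M2 (g l)"
    using e g by (auto simp: orthonormal_family_def)
  have ie: "\<And>j. j \<in> J \<Longrightarrow> integrable M1 (e j)" and ig: "\<And>l. l \<in> L \<Longrightarrow> integrable M2 (g l)"
    using se sg M1.square_integrable_integrable M2.square_integrable_integrable by auto
  have me[measurable]: "\<And>j. j \<in> J \<Longrightarrow> e j \<in> borel_measurable M1"
    and mg[measurable]: "\<And>l. l \<in> L \<Longrightarrow> g l \<in> borel_measurable M2"
    using ie ig by auto
  have Bxt: "\<bar>f (x, t)\<bar> \<le> B" if "x \<in> space M1" "t \<in> space M2" for x t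
    using B that by (auto simp: space_pair_measure)
  have mc[measurable]: "c j \<in> borel_measurable M2" if [measurable]: "j \<in> J" for j
    unfolding c_def by measurable
  have md[measurable]: "d l \<in> borel_measurable M1" if [measurable]: "l \<in> L" for l
    unfolding d_def by measurable
  have bc: "\<bar>c j t\<bar> \<le> B * (\<integral>x. \<bar>e j x\<bar> \<partial>M1)" if "j \<in> J" "t \<in> space M2" for j t
    unfolding c_def using that Bxt ie by (intro M1.abs_integral_bounded_mult_le) auto
  have bd: "\<bar>d l x\<bar> \<le> B * (\<integral>t. \<bar>g l t\<bar> \<partial>M2)" if "l \<in> L" "x \<in> space M1" for l x
    unfolding d_def using that Bxt ig by (intro M2.abs_integral_bounded_mult_le) auto
  have sc: "square_integrable M2 (c j)" if "j \<in> J" for j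
    using M2.square_integrable_bounded[OF mc[OF that] bc[OF that]] .
  have sd: "square_integrable M1 (d l)" if "l \<in> L" for l
    using M1.square_integrable_bounded[OF md[OF that] bd[OF that]] .
  have sf1: "square_integrable M1 (\<lambda>x. f (x, t))" if "t \<in> space M2" for t
    using M1.square_integrable_bounded[of "\<lambda>x. f (x, t)" B] Bxt that by simp
  have sf2: "square_integrable M2 (\<lambda>t. f (x, t))" if "x \<in> space M1" for x
    using M2.square_integrable_bounded[of "\<lambda>t. f (x, t)" B] Bxt that by simp
  have prod_int: "integrable (M1 \<Otimes>\<^sub>M M2) (\<lambda>z. p (fst z) * q (snd z))"
    if "integrable M1 p" "integrable M2 q" for p :: "'a \<Rightarrow> real" and q :: "'b \<Rightarrow> real"
  proof -
    have [measurable]: "p \<in> borel_measurable M1" "q \<in> borel_measurable M2" using that by auto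
    show ?thesis
      by (rule Fubini_integrable) (use that in \<open>auto simp: abs_mult\<close>)
  qed
  define k where "k j l = (\<integral>t. c j t * g l t \<partial>M2)" for j l
  \<comment> \<open>The double coefficient of \<open>f\<close> along \<open>e j\<close> and
    \<open>g l\<close> does not depend on the order of integration; this is what makes projection in
    one variable commute with taking coefficients in the other.\<close>
  have k: "(\<integral>x. d l x * e j x \<partial>M1) = k j l" if [measurable]: "j \<in> J" "l \<in> L" for j l
  proof -
    have int: "integrable (M1 \<Otimes>\<^sub>M M2) (\<lambda>(x, t). f (x, t) * e j x * g l t)"
    proof (rule Bochner_Integration.integrable_bound[of _ "\<lambda>z. B * (e j (fst z) * g l (snd z))"])
      show "integrable (M1 \<Otimes>\<^sub>M M2) (\<lambda>z. B * (e j (fst z) * g l (snd z)))"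
        using prod_int[OF ie[OF that(1)] ig[OF that(2)]] by simp
      show "AE z in M1 \<Otimes>\<^sub>M M2. norm (case z of (x, t) \<Rightarrow> f (x, t) * e j x * g l t)
          \<le> norm (B * (e j (fst z) * g l (snd z)))"
      proof (rule AE_I2)
        fix z assume z: "z \<in> space (M1 \<Otimes>\<^sub>M M2)"
        have "\<bar>f z\<bar> \<le> \<bar>B\<bar>" using B[OF z] by simp
        then have "\<bar>f z\<bar> * \<bar>e j (fst z) * g l (snd z)\<bar> \<le> \<bar>B\<bar> * \<bar>e j (fst z) * g l (snd z)\<bar>"
          by (rule mult_right_mono) simp
        then show "norm (case z of (x, t) \<Rightarrow> f (x, t) * e j x * g l t)
          \<le> norm (B * (e j (fst z) * g l (snd z)))"
          by (simp add: split_beta abs_mult mult.assoc)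
      qed
    qed (use that in measurable)
    have "(\<integral>x. d l x * e j x \<partial>M1) = (\<integral>x. \<integral>t. f (x, t) * e j x * g l t \<partial>M2 \<partial>M1)"
      unfolding d_def by (simp add: integral_mult_left_zero[symmetric] ac_simps)
    also have "\<dots> = (\<integral>t. \<integral>x. f (x, t) * e j x * g l t \<partial>M1 \<partial>M2)"
      using Fubini_integral[OF int] by simp
    also have "\<dots> = k j l" unfolding k_def c_def by simp
    finally show ?thesis .
  qed
  define r where "r = (\<lambda>(x, t). f (x, t) - (\<Sum>l\<in>L. d l x * g l t))"
  have mr[measurable]: "r \<in> borel_measurable (M1 \<Otimes>\<^sub>M M2)"
    unfolding r_def by measurable
  have ir: "integrable (M1 \<Otimes>\<^sub>M M2) (\<lambda>(x, t). (r (x, t))\<^sup>2)"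
  proof -
    have "prob_space (M1 \<Otimes>\<^sub>M M2)" by unfold_locales
    then interpret P: prob_space "M1 \<Otimes>\<^sub>M M2" .
    have "square_integrable (M1 \<Otimes>\<^sub>M M2) f" using P.square_integrable_bounded[OF f B] .
    moreover have "square_integrable (M1 \<Otimes>\<^sub>M M2) (\<lambda>z. d l (fst z) * g l (snd z))"
      if [measurable]: "l \<in> L" for l
      using prod_int[of "\<lambda>x. (d l x)\<^sup>2" "\<lambda>x. (g l x)\<^sup>2"] sd[OF that] sg[OF that] 
      by (auto simp: square_integrable_def power_mult_distrib)
    ultimately have "square_integrable (M1 \<Otimes>\<^sub>M M2) (\<lambda>z. f z - (\<Sum>l\<in>L. d l (fst z) * g l (snd z)))"
      by (intro square_integrable_diff square_integrable_sum finL) auto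
    then show ?thesis by (auto simp: r_def split_beta' square_integrable_def)
  qed
  have fib1: "(\<Sum>j\<in>J. (c j t - (\<Sum>l\<in>L. k j l * g l t))\<^sup>2) \<le> (\<integral>x. (r (x, t))\<^sup>2 \<partial>M1)"
    if t: "t \<in> space M2" for t
  proof -
    have sdg: "square_integrable M1 (\<lambda>x. d l x * g l t)" if "l \<in> L" for l
      using square_integrable_cmult[OF sd[OF that], of "g l t"] by (simp add: mult.commute)
    have "square_integrable M1 (\<lambda>x. r (x, t))"
      unfolding r_def prod.case
      by (intro square_integrable_diff square_integrable_sum finL sf1 t sdg)
    from bessel_inequality[OF e this]
    have "(\<Sum>j\<in>J. (\<integral>y. r (y, t) * e j y \<partial>M1)\<^sup>2) \<le> (\<integral>x. (r (x, t))\<^sup>2 \<partial>M1)" .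
    moreover have "(\<integral>y. r (y, t) * e j y \<partial>M1) = c j t - (\<Sum>l\<in>L. k j l * g l t)" if j: "j \<in> J" for j
    proof -
      have 1: "integrable M1 (\<lambda>y. f (y, t) * e j y)"
        using square_integrable_mult[OF sf1[OF t] se[OF j]] .
      have 2: "integrable M1 (\<lambda>y. g l t * (d l y * e j y))" if "l \<in> L" for l
        using square_integrable_mult[OF sd[OF that] se[OF j]] by simp
      have "(\<integral>y. r (y, t) * e j y \<partial>M1)
          = (\<integral>y. f (y, t) * e j y - (\<Sum>l\<in>L. g l t * (d l y * e j y)) \<partial>M1)"
        by (simp add: r_def right_diff_distrib sum_distrib_left ac_simps)
      also have "\<dots> = c j t - (\<Sum>l\<in>L. g l t * (\<integral>y. d l y * e j y \<partial>M1))"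
        using 1 2 by (simp add: c_def)
      also have "\<dots> = c j t - (\<Sum>l\<in>L. k j l * g l t)"
        using k[OF j] by (simp add: ac_simps)
      finally show ?thesis .
    qed
    ultimately show ?thesis by simp
  qed
  have sr2: "square_integrable M2 (\<lambda>t. c j t - (\<Sum>l\<in>L. k j l * g l t))" if "j \<in> J" for j
    by (intro square_integrable_diff square_integrable_sum finL sc square_integrable_cmult sg that)
  have "(\<Sum>j\<in>J. (\<integral>t. (c j t)\<^sup>2 \<partial>M2) - (\<Sum>l\<in>L. (k j l)\<^sup>2))
      = (\<Sum>j\<in>J. \<integral>t. (c j t - (\<Sum>l\<in>L. k j l * g l t))\<^sup>2 \<partial>M2)"
    unfolding k_def by (intro sum.cong refl orthonormal_integral_residual[OF g, symmetric] sc)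
  also have "\<dots> = (\<integral>t. (\<Sum>j\<in>J. (c j t - (\<Sum>l\<in>L. k j l * g l t))\<^sup>2) \<partial>M2)"
    using sr2 by (simp add: square_integrable_def)
  also have "\<dots> \<le> (\<integral>t. \<integral>x. (r (x, t))\<^sup>2 \<partial>M1 \<partial>M2)"
  proof (rule integral_mono)
    show "integrable M2 (\<lambda>t. \<Sum>j\<in>J. (c j t - (\<Sum>l\<in>L. k j l * g l t))\<^sup>2)"
      using sr2 by (simp add: square_integrable_def)
    show "integrable M2 (\<lambda>t. \<integral>x. (r (x, t))\<^sup>2 \<partial>M1)"
      using integrable_snd[OF ir] .
  qed (rule fib1)
  also have "\<dots> = (\<integral>x. \<integral>t. (r (x, t))\<^sup>2 \<partial>M2 \<partial>M1)"
    using Fubini_integral[OF ir] by simp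
  also have "\<dots> = (\<integral>x. (\<integral>t. (f (x, t))\<^sup>2 \<partial>M2) - (\<Sum>l\<in>L. (d l x)\<^sup>2) \<partial>M1)"
    unfolding r_def prod.case d_def
    by (intro Bochner_Integration.integral_cong refl orthonormal_integral_residual[OF g] sf2)
  finally show ?thesis by (simp add: k_def)
qed

section \<open>Tensorization of the spectral gap\<close>

text \<open>Twice the variance of \<open>h\<close> plus twice its squared distance from the span of \<open>1\<close> and \<open>e\<close>,
  for \<open>e\<close> of mean 0 and variance 1.\<close>

definition gap_form :: "'a measure \<Rightarrow> ('a \<Rightarrow> real) \<Rightarrow> ('a \<Rightarrow> real) \<Rightarrow> real" where
  "gap_form M e h = 4 * (\<integral>x. (h x)\<^sup>2 \<partial>M) - 4 * (\<integral>x. h x \<partial>M)\<^sup>2 - 2 * (\<integral>x. h x * e x \<partial>M)\<^sup>2"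

definition standardized :: "'a measure \<Rightarrow> ('a \<Rightarrow> real) \<Rightarrow> bool" where
  "standardized M e \<longleftrightarrow> square_integrable M e \<and> (\<integral>x. e x \<partial>M) = 0 \<and> (\<integral>x. (e x)\<^sup>2 \<partial>M) = 1"

text \<open>The option index puts the constant function and the one-variable modes into a single
  family, so that one application of Bessel's inequality handles approximation by both.\<close>

definition coord_modes :: "('i \<Rightarrow> 'a \<Rightarrow> real) \<Rightarrow> 'i option \<Rightarrow> ('i \<Rightarrow> 'a) \<Rightarrow> real" where
  "coord_modes e p = (case p of None \<Rightarrow> \<lambda>_. 1 | Some i \<Rightarrow> \<lambda>w. e i (w i))"

lemma coord_modes_simps [simp]:
  "coord_modes e None = (\<lambda>_. 1)" "coord_modes e (Some i) = (\<lambda>w. e i (w i))"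
  by (simp_all add: coord_modes_def)

text \<open>Each mode is a product of one-variable factors, at most one of them not constant, so
  inner products factorise. Two different modes disagree in some coordinate of \<open>I\<close>;
  there the factor is the mean of \<open>e i\<close>, which is 0.\<close>

lemma orthonormal_coord_modes:
  assumes prob: "\<And>i. prob_space (M i)" and fin: "finite I" and st: "\<And>i. i \<in> I \<Longrightarrow> standardized (M i) (e i)"
  shows "orthonormal_family (PiM I M) (insert None (Some ` I)) (coord_modes e)"
proof -
  interpret product_sigma_finite M
    using prob by (intro product_sigma_finite.intro) (rule prob_space_imp_sigma_finite)
  define \<phi> where "\<phi> p i = (if p = Some i then e i else (\<lambda>_. 1))" for p i
  have se: "square_integrable (M i) (e i)" "(\<integral>x. e i x \<partial>M i) = 0" "(\<integral>x. (e i x)\<^sup>2 \<partial>M i) = 1"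
    if "i \<in> I" for i
    using st[OF that] by (auto simp: standardized_def)
  have s\<phi>: "square_integrable (M i) (\<phi> p i)" if "i \<in> I" for p i
    using se(1)[OF that] prob_space.finite_measure[OF prob, of i]
    by (auto simp: \<phi>_def intro: finite_measure.square_integrable_const)
  have mode: "coord_modes e p w = (\<Prod>i\<in>I. \<phi> p i (w i))" if "p \<in> insert None (Some ` I)" for p w
  proof (cases p)
    case None
    then show ?thesis by (simp add: \<phi>_def)
  next
    case (Some j)
    then have "j \<in> I" using that by auto
    have "(\<Prod>i\<in>I. \<phi> p i (w i)) = (\<Prod>i\<in>I. if i = j then e j (w j) else 1)"
      using Some by (intro prod.cong) (auto simp: \<phi>_def)
    then show ?thesis using Some \<open>j \<in> I\<close> fin by simp
  qed
  have int1: "integrable (PiM I M) (\<lambda>w. coord_modes e p w * coord_modes e q w)"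
    and int2: "(\<integral>w. coord_modes e p w * coord_modes e q w \<partial>PiM I M)
      = (\<Prod>i\<in>I. \<integral>x. \<phi> p i x * \<phi> q i x \<partial>M i)"
    if pq: "p \<in> insert None (Some ` I)" "q \<in> insert None (Some ` I)" for p q
  proof -
    have eq: "(\<lambda>w. coord_modes e p w * coord_modes e q w) = (\<lambda>w. \<Prod>i\<in>I. \<phi> p i (w i) * \<phi> q i (w i))"
      using mode[OF pq(1)] mode[OF pq(2)] by (simp add: prod.distrib)
    show "integrable (PiM I M) (\<lambda>w. coord_modes e p w * coord_modes e q w)"
      unfolding eq by (intro product_integrable_prod fin square_integrable_mult s\<phi>)
    show "(\<integral>w. coord_modes e p w * coord_modes e q w \<partial>PiM I M)
      = (\<Prod>i\<in>I. \<integral>x. \<phi> p i x * \<phi> q i x \<partial>M i)"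
      unfolding eq by (intro product_integral_prod fin square_integrable_mult s\<phi>)
  qed
  have factor: "(\<integral>x. \<phi> p i x * \<phi> q i x \<partial>M i) = (if (p = Some i) = (q = Some i) then 1 else 0)"
    if "i \<in> I" for p q i
    using se[OF that] prob_space.prob_space[OF prob, of i] by (auto simp: \<phi>_def power2_eq_square)
  have on: "(\<integral>w. coord_modes e p w * coord_modes e q w \<partial>PiM I M) = (if p = q then 1 else 0)"
    if pq: "p \<in> insert None (Some ` I)" "q \<in> insert None (Some ` I)" for p q
  proof (cases "p = q")
    case True
    then show ?thesis unfolding int2[OF pq] using factor by simp
  next
    case False
    then obtain i where "i \<in> I" "(p = Some i) \<noteq> (q = Some i)" using pq by auto
    then have "\<exists>i\<in>I. (\<integral>x. \<phi> p i x * \<phi> q i x \<partial>M i) = 0" using factor by auto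
    then show ?thesis unfolding int2[OF pq] using False fin by (simp add: prod_zero)
  qed
  have meas: "coord_modes e p \<in> borel_measurable (PiM I M)" if p: "p \<in> insert None (Some ` I)" for p
  proof (cases p)
    case (Some j)
    then have [measurable]: "j \<in> I" "e j \<in> borel_measurable (M j)"
      using p se(1) by (auto simp: square_integrable_def)
    show ?thesis using Some by simp
  qed simp
  show ?thesis
    unfolding orthonormal_family_def square_integrable_def
    using fin on int1 meas by (auto simp: power2_eq_square)
qed

lemma integrable_PiM_insert_iff:
  fixes h :: "('i \<Rightarrow> 'a) \<Rightarrow> real"
  assumes prob: "\<And>i. prob_space (M i)" and "h \<in> borel_measurable (PiM (insert k I) M)"
  shows "integrable (PiM (insert k I) M) h
    \<longleftrightarrow> integrable (M k \<Otimes>\<^sub>M PiM I M) (\<lambda>(t, w). h (w(k := t)))"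
proof -
  have "integrable (PiM (insert k I) M) h
    \<longleftrightarrow> integrable (distr (M k \<Otimes>\<^sub>M PiM I M) (PiM (insert k I) M) (\<lambda>(t, w). w(k := t))) h"
    using distr_pair_PiM_eq_PiM[of I M k] prob by simp
  also have "\<dots> \<longleftrightarrow> integrable (M k \<Otimes>\<^sub>M PiM I M) (\<lambda>z. h ((\<lambda>(t, w). w(k := t)) z))"
    by (rule integrable_distr_eq) (use assms(2) in measurable)
  finally show ?thesis by (simp add: split_beta')
qed

lemma integral_PiM_insert:
  fixes h :: "('i \<Rightarrow> 'a) \<Rightarrow> real"
  assumes prob: "\<And>i. prob_space (M i)" and h: "integrable (PiM (insert k I) M) h"
  shows "(\<integral>w. h w \<partial>PiM (insert k I) M) = (\<integral>t. \<integral>w. h (w(k := t)) \<partial>PiM I M \<partial>M k)"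
    and "(\<integral>w. h w \<partial>PiM (insert k I) M) = (\<integral>w. \<integral>t. h (w(k := t)) \<partial>M k \<partial>PiM I M)"
proof -
  have meas: "h \<in> borel_measurable (PiM (insert k I) M)" using h by simp
  interpret A: prob_space "PiM I M" by (intro prob_space_PiM prob)
  interpret B: prob_space "M k" by (rule prob)
  interpret P: pair_prob_space "M k" "PiM I M" ..
  have int: "integrable (M k \<Otimes>\<^sub>M PiM I M) (\<lambda>(t, w). h (w(k := t)))"
    using h integrable_PiM_insert_iff[OF prob meas] by simp
  have "(\<integral>w. h w \<partial>PiM (insert k I) M)
    = (\<integral>w. h w \<partial>distr (M k \<Otimes>\<^sub>M PiM I M) (PiM (insert k I) M) (\<lambda>(t, w). w(k := t)))"
    using distr_pair_PiM_eq_PiM[of I M k] prob by simp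
  also have "\<dots> = (\<integral>z. h ((\<lambda>(t, w). w(k := t)) z) \<partial>(M k \<Otimes>\<^sub>M PiM I M))"
    by (rule integral_distr) (use meas in measurable)
  also have "\<dots> = (\<integral>(t, w). h (w(k := t)) \<partial>(M k \<Otimes>\<^sub>M PiM I M))" by (simp add: split_beta')
  finally have eq: "(\<integral>w. h w \<partial>PiM (insert k I) M) = (\<integral>(t, w). h (w(k := t)) \<partial>(M k \<Otimes>\<^sub>M PiM I M))" .
  show "(\<integral>w. h w \<partial>PiM (insert k I) M) = (\<integral>t. \<integral>w. h (w(k := t)) \<partial>PiM I M \<partial>M k)"
    unfolding eq using P.integral_fst[OF int] by simp
  show "(\<integral>w. h w \<partial>PiM (insert k I) M) = (\<integral>w. \<integral>t. h (w(k := t)) \<partial>M k \<partial>PiM I M)"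
    unfolding eq using P.integral_snd[OF int] by simp
qed

text \<open>Induction on the coordinates. The induction hypothesis, applied to slices in which the
  new coordinate is frozen and then averaged, leaves the coefficients \<open>c p\<close> of the
  slices as functions of the new variable. What is missing is a bound for the fluctuation of these
  coefficients by the energy in the new variable, and \<open>bessel_inequality_product\<close>
  supplies it. \<open>\<Gamma> i\<close> plays the part of the energy density in direction
  \<open>i\<close> and is compared with the gap only after averaging over coordinate
  \<open>i\<close>; this leaves room for an integration by parts there.\<close>

theorem tensorization:
  fixes M :: "'i \<Rightarrow> 'a measure" and f :: "('i \<Rightarrow> 'a) \<Rightarrow> real"
  assumes prob: "\<And>i. prob_space (M i)" and "finite I" and "\<And>i. i \<in> I \<Longrightarrow> standardized (M i) (e i)"
    and "f \<in> borel_measurable (PiM I M)" "\<And>w. w \<in> space (PiM I M) \<Longrightarrow> \<bar>f w\<bar> \<le> B"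
    and "\<And>i. i \<in> I \<Longrightarrow> \<Gamma> i \<in> borel_measurable (PiM I M)"
    and "\<And>i w. i \<in> I \<Longrightarrow> w \<in> space (PiM I M) \<Longrightarrow> \<bar>\<Gamma> i w\<bar> \<le> B"
    and "\<And>i w. i \<in> I \<Longrightarrow> w \<in> space (PiM I M) \<Longrightarrow>
      gap_form (M i) (e i) (\<lambda>t. f (w(i := t))) \<le> (\<integral>t. \<Gamma> i (w(i := t)) \<partial>M i)"
  shows "4 * (\<integral>w. (f w)\<^sup>2 \<partial>PiM I M) - 4 * (\<integral>w. f w \<partial>PiM I M)\<^sup>2
      - 2 * (\<Sum>i\<in>I. (\<integral>w. f w * e i (w i) \<partial>PiM I M)\<^sup>2) \<le> (\<Sum>i\<in>I. \<integral>w. \<Gamma> i w \<partial>PiM I M)"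
  using assms(2-)
proof (induction I arbitrary: f \<Gamma> rule: finite_induct)
  case empty
  then show ?case by (simp add: PiM_empty lebesgue_integral_count_space_finite)
next
  case (insert k I)
  let ?J = "insert k I"
  note [measurable] = insert.prems(2)
  have st: "standardized (M i) (e i)" if "i \<in> ?J" for i using insert.prems(1) that .
  have m\<Gamma>[measurable]: "\<Gamma> i \<in> borel_measurable (PiM ?J M)" if "i \<in> ?J" for i
    using insert.prems(4) that .
  note fB = insert.prems(3) and \<Gamma>B = insert.prems(5) and gap = insert.prems(6)
  interpret M1: prob_space "PiM I M" by (intro prob_space_PiM prob)
  interpret M2: prob_space "M k" by (rule prob)
  interpret MJ: prob_space "PiM ?J M" by (intro prob_space_PiM prob)
  interpret P: pair_prob_space "PiM I M" "M k" ..
  have upd_space: "x(k := t) \<in> space (PiM ?J M)" if "x \<in> space (PiM I M)" "t \<in> space (M k)" for x t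
    using that by (auto simp: space_PiM PiE_def extensional_def)
  have upd_meas[measurable]: "(\<lambda>x. x(k := t)) \<in> measurable (PiM I M) (PiM ?J M)"
    if "t \<in> space (M k)" for t
  proof -
    have "(\<lambda>x. (x, t)) \<in> measurable (PiM I M) (PiM I M \<Otimes>\<^sub>M M k)" using that by measurable
    from measurable_compose[OF this measurable_add_dim] show ?thesis by simp
  qed
  have upd_meas2[measurable]: "(\<lambda>t. x(k := t)) \<in> measurable (M k) (PiM ?J M)"
    if "x \<in> space (PiM I M)" for x
    using measurable_component_update[OF that insert.hyps(2)] .
  define c where "c p t = (\<integral>x. f (x(k := t)) * coord_modes e p x \<partial>PiM I M)" for p t
  define E where "E = (\<lambda>(p :: 'i option) t. if p = None then 1 else e k t)"
  have onI: "orthonormal_family (PiM I M) (insert None (Some ` I)) (coord_modes e)"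
    using insert.hyps(1) st by (intro orthonormal_coord_modes prob) auto
  have onN: "orthonormal_family (PiM I M) {None} (coord_modes e)"
    using onI by (auto simp: orthonormal_family_def)
  have onk: "orthonormal_family (M k) {None, Some k} E"
    using st[of k] M2.prob_space
    by (auto simp: orthonormal_family_def standardized_def E_def M2.square_integrable_const power2_eq_square)
  have onkN: "orthonormal_family (M k) {None} E"
    using onk by (auto simp: orthonormal_family_def)
  have F: "(\<lambda>(x, t). f (x(k := t))) \<in> borel_measurable (PiM I M \<Otimes>\<^sub>M M k)"
    using measurable_add_dim[of k I M] by measurable
  have FB: "\<bar>(\<lambda>(x, t). f (x(k := t))) z\<bar> \<le> B" if "z \<in> space (PiM I M \<Otimes>\<^sub>M M k)" for z
    using that by (auto simp: space_pair_measure intro!: fB upd_space)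
  have fB': "\<bar>f (x(k := t))\<bar> \<le> B" if "x \<in> space (PiM I M)" "t \<in> space (M k)" for x t
    by (rule fB, rule upd_space) fact+
  have \<Gamma>B': "\<bar>\<Gamma> i (x(k := t))\<bar> \<le> B" if "i \<in> ?J" "x \<in> space (PiM I M)" "t \<in> space (M k)" for i x t
    by (rule \<Gamma>B, fact, rule upd_space) fact+
  define V where "V x = (\<integral>t. (f (x(k := t)))\<^sup>2 \<partial>M k)" for x
  define d where "d p x = (\<integral>t. f (x(k := t)) * E p t \<partial>M k)" for p x
  have se: "square_integrable (PiM I M) (coord_modes e p)" if "p \<in> insert None (Some ` I)" for p
    using onI that by (auto simp: orthonormal_family_def)
  have sc: "square_integrable (M k) (c p)" if p: "p \<in> insert None (Some ` I)" for p
  proof (rule M2.square_integrable_bounded)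
    have [measurable]: "coord_modes e p \<in> borel_measurable (PiM I M)"
      using se[OF p] by (simp add: square_integrable_def)
    show "c p \<in> borel_measurable (M k)" unfolding c_def using F by measurable
    show "\<bar>c p t\<bar> \<le> B * (\<integral>x. \<bar>coord_modes e p x\<bar> \<partial>PiM I M)" if t: "t \<in> space (M k)" for t
      unfolding c_def
    proof (rule M1.abs_integral_bounded_mult_le)
      show "(\<lambda>x. f (x(k := t))) \<in> borel_measurable (PiM I M)" using t by measurable
    qed (use t fB' M1.square_integrable_integrable[OF se[OF p]] in auto)
  qed
  have sd: "square_integrable (PiM I M) (d p)" if p: "p \<in> {None, Some k}" for p
  proof (rule M1.square_integrable_bounded)
    have sE: "square_integrable (M k) (E p)" using onk p by (auto simp: orthonormal_family_def)
    then have [measurable]: "E p \<in> borel_measurable (M k)" by (simp add: square_integrable_def)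
    show "d p \<in> borel_measurable (PiM I M)" unfolding d_def using F by measurable
    show "\<bar>d p x\<bar> \<le> B * (\<integral>t. \<bar>E p t\<bar> \<partial>M k)" if x: "x \<in> space (PiM I M)" for x
      unfolding d_def
    proof (rule M2.abs_integral_bounded_mult_le)
      show "(\<lambda>t. f (x(k := t))) \<in> borel_measurable (M k)" using x by measurable
    qed (use x fB' M2.square_integrable_integrable[OF sE] in auto)
  qed
  have B2: "\<bar>(f z)\<^sup>2\<bar> \<le> B\<^sup>2" if "z \<in> space (PiM ?J M)" for z
    using fB[OF that] by (metis abs_ge_zero abs_power2 power2_abs power_mono)
  have iV: "integrable (PiM I M) V"
  proof (rule M1.integrable_bounded)
    show "V \<in> borel_measurable (PiM I M)" unfolding V_def using F by measurable
    show "\<bar>V x\<bar> \<le> B\<^sup>2" if x: "x \<in> space (PiM I M)" for x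
    proof -
      have "\<bar>\<integral>t. (f (x(k := t)))\<^sup>2 * 1 \<partial>M k\<bar> \<le> B\<^sup>2 * (\<integral>t. \<bar>1\<bar> \<partial>M k)"
        using x by (intro M2.abs_integral_bounded_mult_le) (auto intro!: B2[simplified] upd_space)
      then show ?thesis using M2.prob_space by (simp add: V_def)
    qed
  qed
  have if2: "integrable (PiM ?J M) (\<lambda>w. (f w)\<^sup>2)"
    using B2 by (intro MJ.integrable_bounded[where B = "B\<^sup>2"]) auto
  have iJ: "integrable (PiM ?J M) (\<Gamma> i)" if "i \<in> ?J" for i
    using \<Gamma>B that by (intro MJ.integrable_bounded[where B = B]) auto
  have sf: "square_integrable (PiM ?J M) f"
    using fB by (intro MJ.square_integrable_bounded[where B = B]) auto
  have seJ: "square_integrable (PiM ?J M) (\<lambda>w. e i (w i))" if "i \<in> ?J" for i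
    using orthonormal_coord_modes[OF prob, where I = ?J and e = e] insert.hyps(1) st that by (auto simp: orthonormal_family_def)
  have int_f: "(\<integral>w. f w \<partial>PiM ?J M) = (\<integral>t. c None t \<partial>M k)"
    unfolding c_def using integral_PiM_insert(1)[OF prob MJ.square_integrable_integrable[OF sf]] by simp
  have int_fk: "(\<integral>w. f w * e k (w k) \<partial>PiM ?J M) = (\<integral>t. c None t * e k t \<partial>M k)"
    unfolding c_def using integral_PiM_insert(1)[OF prob square_integrable_mult[OF sf seJ[of k]]] by simp
  have int_fi: "(\<integral>w. f w * e i (w i) \<partial>PiM ?J M) = (\<integral>t. c (Some i) t \<partial>M k)" if "i \<in> I" for i
  proof -
    have "i \<noteq> k" using that insert.hyps(2) by auto
    then show ?thesis
      unfolding c_def using integral_PiM_insert(1)[OF prob square_integrable_mult[OF sf seJ[of i]]] that by simp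
  qed
  \<comment> \<open>The slice frozen at \<open>t\<close> inherits the one-variable gap in every
    direction of \<open>I\<close>, because updates at \<open>i\<close> and at \<open>k\<close>
    commute.\<close>
  have IH: "4 * (\<integral>x. (f (x(k := t)))\<^sup>2 \<partial>PiM I M) - 4 * (c None t)\<^sup>2 - 2 * (\<Sum>i\<in>I. (c (Some i) t)\<^sup>2)
      \<le> (\<Sum>i\<in>I. \<integral>x. \<Gamma> i (x(k := t)) \<partial>PiM I M)" if t: "t \<in> space (M k)" for t
  proof -
    have g: "gap_form (M i) (e i) (\<lambda>s. f (x(i := s, k := t))) \<le> (\<integral>s. \<Gamma> i (x(i := s, k := t)) \<partial>M i)"
      if "i \<in> I" "x \<in> space (PiM I M)" for i x
    proof -
      have "i \<noteq> k" using that insert.hyps(2) by auto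
      then have eq: "x(i := s, k := t) = x(k := t, i := s)" for s by (rule fun_upd_twist)
      show ?thesis
        unfolding eq by (rule gap, use that in simp, rule upd_space[OF that(2) t])
    qed
    have mf: "(\<lambda>x. f (x(k := t))) \<in> borel_measurable (PiM I M)" using t by measurable
    have mg: "(\<lambda>x. \<Gamma> i (x(k := t))) \<in> borel_measurable (PiM I M)" if "i \<in> I" for i
      using measurable_compose[OF upd_meas[OF t] m\<Gamma>[of i]] that by simp
    show ?thesis
      unfolding c_def coord_modes_simps mult_1_right
    proof (rule insert.IH[of "\<lambda>x. f (x(k := t))" "\<lambda>i x. \<Gamma> i (x(k := t))"])
      show "standardized (M i) (e i)" if "i \<in> I" for i using st that by simp
      show "\<bar>f (x(k := t))\<bar> \<le> B" if "x \<in> space (PiM I M)" for x by (rule fB'[OF that t])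
      show "\<bar>\<Gamma> i (x(k := t))\<bar> \<le> B" if "i \<in> I" "x \<in> space (PiM I M)" for i x
        by (rule \<Gamma>B'[OF _ that(2) t]) (use that in simp)
    qed (rule mf mg g; assumption)+
  qed
  have fib_f2: "integrable (M k) (\<lambda>t. \<integral>x. (f (x(k := t)))\<^sup>2 \<partial>PiM I M)"
    and fib_\<Gamma>: "i \<in> ?J \<Longrightarrow> integrable (M k) (\<lambda>t. \<integral>x. \<Gamma> i (x(k := t)) \<partial>PiM I M)"
    and fib_\<Gamma>': "i \<in> ?J \<Longrightarrow> integrable (PiM I M) (\<lambda>x. \<integral>t. \<Gamma> i (x(k := t)) \<partial>M k)" for i
  proof -
    interpret Q: pair_prob_space "M k" "PiM I M" ..
    show "integrable (M k) (\<lambda>t. \<integral>x. (f (x(k := t)))\<^sup>2 \<partial>PiM I M)"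
      using Q.integrable_fst[of "\<lambda>t w. (f (w(k := t)))\<^sup>2"]
        integrable_PiM_insert_iff[THEN iffD1, OF prob _ if2] by simp
    assume i: "i \<in> ?J"
    show "integrable (M k) (\<lambda>t. \<integral>x. \<Gamma> i (x(k := t)) \<partial>PiM I M)"
      using Q.integrable_fst[of "\<lambda>t w. \<Gamma> i (w(k := t))"]
        integrable_PiM_insert_iff[THEN iffD1, OF prob _ iJ[OF i]] i by simp
    show "integrable (PiM I M) (\<lambda>x. \<integral>t. \<Gamma> i (x(k := t)) \<partial>M k)"
      using Q.integrable_snd[of "\<lambda>t w. \<Gamma> i (w(k := t))"]
        integrable_PiM_insert_iff[THEN iffD1, OF prob _ iJ[OF i]] i by simp
  qed
  have A: "4 * (\<integral>w. (f w)\<^sup>2 \<partial>PiM ?J M) - 4 * (\<integral>t. (c None t)\<^sup>2 \<partial>M k)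
      - 2 * (\<Sum>i\<in>I. \<integral>t. (c (Some i) t)\<^sup>2 \<partial>M k) \<le> (\<Sum>i\<in>I. \<integral>w. \<Gamma> i w \<partial>PiM ?J M)"
  proof -
    have ic: "integrable (M k) (\<lambda>t. (c p t)\<^sup>2)" if "p \<in> insert None (Some ` I)" for p
      using sc[OF that] by (simp add: square_integrable_def)
    have i2: "integrable (M k) (\<lambda>t. \<Sum>i\<in>I. (c (Some i) t)\<^sup>2)" using ic by (intro Bochner_Integration.integrable_sum) auto
    have "(\<integral>t. 4 * (\<integral>x. (f (x(k := t)))\<^sup>2 \<partial>PiM I M) - 4 * (c None t)\<^sup>2 - 2 * (\<Sum>i\<in>I. (c (Some i) t)\<^sup>2) \<partial>M k)
      \<le> (\<integral>t. (\<Sum>i\<in>I. \<integral>x. \<Gamma> i (x(k := t)) \<partial>PiM I M) \<partial>M k)"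
      using fib_f2 fib_\<Gamma> ic i2
      by (intro integral_mono IH Bochner_Integration.integrable_diff integrable_mult_right Bochner_Integration.integrable_sum) auto
    also have "(\<integral>t. 4 * (\<integral>x. (f (x(k := t)))\<^sup>2 \<partial>PiM I M) - 4 * (c None t)\<^sup>2 - 2 * (\<Sum>i\<in>I. (c (Some i) t)\<^sup>2) \<partial>M k)
      = 4 * (\<integral>t. \<integral>x. (f (x(k := t)))\<^sup>2 \<partial>PiM I M \<partial>M k) - 4 * (\<integral>t. (c None t)\<^sup>2 \<partial>M k)
      - 2 * (\<Sum>i\<in>I. \<integral>t. (c (Some i) t)\<^sup>2 \<partial>M k)"
      using fib_f2 ic i2 by simp
    also have "(\<integral>t. (\<Sum>i\<in>I. \<integral>x. \<Gamma> i (x(k := t)) \<partial>PiM I M) \<partial>M k) = (\<Sum>i\<in>I. \<integral>w. \<Gamma> i w \<partial>PiM ?J M)"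
      using fib_\<Gamma> integral_PiM_insert(1)[OF prob iJ] by simp
    finally show ?thesis using integral_PiM_insert(1)[OF prob if2] by simp
  qed
  \<comment> \<open>\<open>gap_form\<close> in the new variable splits into a variance, which has to dominate the variances of all
    coefficients \<open>c p\<close>, and a distance from affine functions, which is only needed for \<open>c None\<close>.\<close>
  have C1: "((\<integral>t. (c None t)\<^sup>2 \<partial>M k) - (\<integral>t. c None t \<partial>M k)\<^sup>2)
      + (\<Sum>i\<in>I. (\<integral>t. (c (Some i) t)\<^sup>2 \<partial>M k) - (\<integral>t. c (Some i) t \<partial>M k)\<^sup>2)
      \<le> (\<integral>x. V x - (d None x)\<^sup>2 \<partial>PiM I M)"
    using P.bessel_inequality_product[OF F FB onI onkN] insert.hyps(1)
    by (simp add: c_def V_def d_def E_def sum.reindex cong: sum.cong_simp)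
  have C2: "(\<integral>t. (c None t)\<^sup>2 \<partial>M k) - ((\<integral>t. c None t \<partial>M k)\<^sup>2 + (\<integral>t. c None t * e k t \<partial>M k)\<^sup>2)
      \<le> (\<integral>x. V x - ((d None x)\<^sup>2 + (d (Some k) x)\<^sup>2) \<partial>PiM I M)"
    using P.bessel_inequality_product[OF F FB onN onk]
    by (simp add: c_def V_def d_def E_def)
  have D: "2 * (\<integral>x. V x - (d None x)\<^sup>2 \<partial>PiM I M) + 2 * (\<integral>x. V x - ((d None x)\<^sup>2 + (d (Some k) x)\<^sup>2) \<partial>PiM I M)
      \<le> (\<integral>w. \<Gamma> k w \<partial>PiM ?J M)"
  proof -
    have id: "integrable (PiM I M) (\<lambda>x. (d p x)\<^sup>2)" if "p \<in> {None, Some k}" for p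
      using sd[OF that] by (simp add: square_integrable_def)
    have "2 * (\<integral>x. V x - (d None x)\<^sup>2 \<partial>PiM I M) + 2 * (\<integral>x. V x - ((d None x)\<^sup>2 + (d (Some k) x)\<^sup>2) \<partial>PiM I M)
      = (\<integral>x. 4 * V x - 4 * (d None x)\<^sup>2 - 2 * (d (Some k) x)\<^sup>2 \<partial>PiM I M)"
      using iV id by simp
    also have "\<dots> \<le> (\<integral>x. \<integral>t. \<Gamma> k (x(k := t)) \<partial>M k \<partial>PiM I M)"
    proof (rule integral_mono)
      show "4 * V x - 4 * (d None x)\<^sup>2 - 2 * (d (Some k) x)\<^sup>2 \<le> (\<integral>t. \<Gamma> k (x(k := t)) \<partial>M k)"
        if x: "x \<in> space (PiM I M)" for x
      proof -
        \<comment> \<open>The gap hypothesis speaks of points of the full product; the value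
          \<open>t\<close> is arbitrary since it is overwritten by \<open>s\<close>.\<close>
        obtain t where t: "t \<in> space (M k)" using M2.not_empty by auto
        have "gap_form (M k) (e k) (\<lambda>s. f (x(k := t, k := s))) \<le> (\<integral>s. \<Gamma> k (x(k := t, k := s)) \<partial>M k)"
          by (rule gap[OF _ upd_space[OF x t]]) simp
        then show ?thesis
          unfolding fun_upd_upd gap_form_def V_def d_def E_def by simp
      qed
    qed (use iV id fib_\<Gamma>' in auto)
    also have "\<dots> = (\<integral>w. \<Gamma> k w \<partial>PiM ?J M)"
      using integral_PiM_insert(2)[OF prob iJ[of k]] by simp
    finally show ?thesis .
  qed
  \<comment> \<open>The sum of \<open>A\<close>, twice \<open>C1\<close>, twice \<open>C2\<close>
    and \<open>D\<close>. The constant coefficient occurs in both \<open>C1\<close> and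
    \<open>C2\<close>, giving the factor 4 = 2 + 2; each \<open>c (Some i)\<close> occurs only in
    \<open>C1\<close>, giving the factor 2.\<close>
  show ?case
    using A C1 C2 D insert.hyps int_f int_fk int_fi by (simp add: sum_subtractf)
qed

section \<open>The one-dimensional inequality\<close>

text \<open>In the application \<open>f'\<close> is \<open>f\<close> minus a square whose
  integrability up to the end points is not known beforehand. It is therefore integrated only over
  compact subintervals, where it is replaced by \<open>f\<close> before the limit is taken;
  integrability is asked of \<open>f\<close> alone.\<close>

lemma interval_integral_FTC_ge:
  fixes F f f' :: "real \<Rightarrow> real" and l r :: ereal
  assumes "l < r"
    and F: "\<And>x. l < ereal x \<Longrightarrow> ereal x < r \<Longrightarrow> (F has_real_derivative f' x) (at x)"
    and f': "\<And>x. l < ereal x \<Longrightarrow> ereal x < r \<Longrightarrow> isCont f' x"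
    and f: "\<And>x. l < ereal x \<Longrightarrow> ereal x < r \<Longrightarrow> isCont f x"
    and le: "\<And>x. l < ereal x \<Longrightarrow> ereal x < r \<Longrightarrow> f' x \<le> f x"
    and int: "set_integrable lborel (einterval l r) f"
    and A: "((F \<circ> real_of_ereal) \<longlongrightarrow> A) (at_right l)"
    and B: "((F \<circ> real_of_ereal) \<longlongrightarrow> B) (at_left r)"
  shows "B - A \<le> (LBINT x=l..r. f x)"
proof -
  obtain u v where approx:
    "einterval l r = (\<Union>i. {v i .. u i})"
    "incseq u" "decseq v" "\<And>i. v i < u i" "\<And>i. l < v i" "\<And>i. u i < r"
    "v \<longlonglongrightarrow> l" "u \<longlonglongrightarrow> r"
    by (blast intro: einterval_Icc_approximation[OF \<open>l < r\<close>])
  have gt: "l < ereal x" if "v i \<le> x" for x i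
    using approx(5)[of i] that by (meson ereal_less_eq(3) less_le_trans)
  have lt: "ereal x < r" if "x \<le> u i" for x i
    using approx(6)[of i] that by (meson ereal_less_eq(3) le_less_trans)
  have FTC: "F (u i) - F (v i) \<le> (LBINT x=v i..u i. f x)" for i
  proof -
    have vu: "v i \<le> u i" using approx(4)[of i] by simp
    have cf': "continuous_on {v i..u i} f'" and cf: "continuous_on {v i..u i} f"
      using f' f gt lt by (auto intro!: continuous_at_imp_continuous_on)
    have "(LBINT x=v i..u i. f' x) = F (u i) - F (v i)"
      using vu cf' F gt lt
      by (intro interval_integral_FTC_finite)
        (auto simp: min_def max_def has_real_derivative_iff_has_vector_derivative[symmetric]
          intro: has_field_derivative_at_within)
    moreover have "(LBINT x:{v i..u i}. f' x) \<le> (LBINT x:{v i..u i}. f x)"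
      using le gt lt
      by (intro set_integral_mono borel_integrable_atLeastAtMost' cf cf') auto
    ultimately show ?thesis using vu by (simp add: interval_integral_Icc)
  qed
  have "(\<lambda>i. F (v i)) \<longlonglongrightarrow> A"
    using A approx unfolding tendsto_at_iff_sequentially comp_def
    by (elim allE[of _ "\<lambda>i. ereal (v i)"], auto)
  moreover have "(\<lambda>i. F (u i)) \<longlonglongrightarrow> B"
    using B approx unfolding tendsto_at_iff_sequentially comp_def
    by (elim allE[of _ "\<lambda>i. ereal (u i)"], auto)
  ultimately have "(\<lambda>i. F (u i) - F (v i)) \<longlonglongrightarrow> B - A" by (intro tendsto_intros)
  moreover have "(\<lambda>i. LBINT x=v i..u i. f x) \<longlonglongrightarrow> (LBINT x=l..r. f x)"
    by (rule interval_integral_Icc_approx_integrable[OF \<open>l < r\<close> approx int])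
  ultimately show ?thesis using FTC by (intro LIMSEQ_le) auto
qed

section \<open>The weights \<open>t^b exp (- a t^2)\<close> on the line and the half-line\<close>

definition half :: "real \<Rightarrow> real set" where
  "half b = (if b > 0 then {0<..} else UNIV)"

text \<open>The case \<open>b = 0\<close> is separated because \<open>0 powr 0 = 0\<close>; the
  factors of \<open>xA\<close> are written in the same way.\<close>

definition wt :: "real \<Rightarrow> real \<Rightarrow> real" where
  "wt b t = (if b = 0 then 1 else t powr b)"

definition rho :: "real \<Rightarrow> real \<Rightarrow> real \<Rightarrow> real" where
  "rho a b t = indicator (half b) t * wt b t * exp (- a * t\<^sup>2)"

definition half_start :: "real \<Rightarrow> ereal" where
  "half_start b = (if b > 0 then 0 else -\<infinity>)"

lemma einterval_half_start: "einterval (half_start b) \<infinity> = half b"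
  by (auto simp: half_start_def half_def einterval_def zero_ereal_def)

lemma half_start_less: "half_start b < \<infinity>"
  by (simp add: half_start_def)

lemma half_measurable [measurable]: "half b \<in> sets borel"
  by (simp add: half_def)

lemma wt_measurable [measurable]: "wt b \<in> borel_measurable borel"
  unfolding wt_def by simp

lemma wt_nonneg: "0 \<le> wt b t"
  by (simp add: wt_def)

lemma rho_measurable [measurable]: "rho a b \<in> borel_measurable borel"
  unfolding rho_def by measurable

lemma rho_nonneg: "0 \<le> rho a b t"
  by (simp add: rho_def wt_nonneg)

lemma rho_pos: "b \<ge> 0 \<Longrightarrow> t \<in> half b \<Longrightarrow> 0 < rho a b t"
  by (auto simp: rho_def wt_def half_def split: if_splits)

lemma rho_eq: "t \<in> half b \<Longrightarrow> rho a b t = wt b t * exp (- a * t\<^sup>2)"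
  by (simp add: rho_def)

text \<open>The point \<open>t = 0\<close> is admitted only if \<open>b = 0\<close>, and then \<open>b / t = 0 / 0 = 0\<close>.\<close>

lemma has_real_derivative_rho:
  assumes "b \<ge> 0" "t \<in> half b"
  shows "(rho a b has_real_derivative (b / t - 2 * a * t) * rho a b t) (at t)"
proof (cases "b = 0")
  case True
  have "rho a b = (\<lambda>t. exp (- a * t\<^sup>2))" using True by (auto simp: rho_def wt_def half_def)
  then show ?thesis using True by (auto intro!: derivative_eq_intros)
next
  case False
  with assms have "b > 0" "t > 0" by (auto simp: half_def)
  have "((\<lambda>t. t powr b * exp (- a * t\<^sup>2)) has_real_derivative (b / t - 2 * a * t) * rho a b t) (at t)"
    using \<open>b > 0\<close> \<open>t > 0\<close>
    by (auto intro!: derivative_eq_intros simp: rho_def wt_def half_def field_simps powr_diff)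
  then show ?thesis
    by (rule has_field_derivative_transform_within_open[of _ _ _ "{0<..}"])
      (use \<open>b > 0\<close> \<open>t > 0\<close> in \<open>auto simp: rho_def wt_def half_def\<close>)
qed

lemma isCont_rho: "b \<ge> 0 \<Longrightarrow> t \<in> half b \<Longrightarrow> isCont (rho a b) t"
  using has_real_derivative_rho DERIV_isCont by blast

text \<open>On \<open>half b\<close> the power is at most \<open>1 + \<bar>t\<bar> ^ m\<close> with
  \<open>m\<close> the ceiling of \<open>b\<close>, and the Gaussian is a multiple of the normal
  density of variance \<open>1 / (2 * a)\<close>, all of whose absolute moments are finite.\<close>

lemma integrable_rho_moment:
  assumes "a > 0" "b \<ge> 0"
  shows "integrable lborel (\<lambda>t. \<bar>t\<bar> ^ k * rho a b t)"
proof -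
  define s where "s = sqrt (1 / (2 * a))"
  have s: "s > 0" "s\<^sup>2 = 1 / (2 * a)" using assms by (auto simp: s_def)
  have nd: "exp (- a * t\<^sup>2) = sqrt (2 * pi * s\<^sup>2) * normal_density 0 s t" for t
    using s assms by (simp add: normal_density_def)
  define m where "m = nat \<lceil>b\<rceil>"
  have bm: "b \<le> real m" unfolding m_def using assms(2) by linarith
  have "integrable lborel (\<lambda>t. sqrt (2 * pi * s\<^sup>2) * (normal_density 0 s t * \<bar>t - 0\<bar> ^ k + normal_density 0 s t * \<bar>t - 0\<bar> ^ (k + m)))"
    by (intro integrable_mult_right Bochner_Integration.integrable_add integrable_normal_moment_abs s)
  then have "integrable lborel (\<lambda>t. (\<bar>t\<bar> ^ k + \<bar>t\<bar> ^ (k + m)) * exp (- a * t\<^sup>2))"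
    unfolding nd by (simp add: algebra_simps)
  then show ?thesis
  proof (rule Bochner_Integration.integrable_bound)
    have w: "wt b t \<le> 1 + \<bar>t\<bar> ^ m" if "t \<in> half b" for t
    proof (cases "b = 0")
      case False
      then have t: "t > 0" and b: "b > 0" using that assms by (auto simp: half_def)
      have "t powr b \<le> 1 + t ^ m"
      proof (cases "t \<le> 1")
        case True
        then have "t powr b \<le> 1" using t b by (simp add: powr_le1)
        then show ?thesis using t by (smt (verit) zero_le_power)
      next
        case False
        then have "t powr b \<le> t powr real m" using bm by simp
        then show ?thesis using t by (simp add: powr_realpow)
      qed
      then show ?thesis using b t by (simp add: wt_def)
    qed (simp add: wt_def)
    have "\<bar>t\<bar> ^ k * rho a b t \<le> (\<bar>t\<bar> ^ k + \<bar>t\<bar> ^ (k + m)) * exp (- a * t\<^sup>2)" for t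
    proof (cases "t \<in> half b")
      case True
      have "\<bar>t\<bar> ^ k * (wt b t * exp (- a * t\<^sup>2)) \<le> \<bar>t\<bar> ^ k * ((1 + \<bar>t\<bar> ^ m) * exp (- a * t\<^sup>2))"
        using w[OF True] by (intro mult_left_mono mult_right_mono) auto
      then show ?thesis using True by (simp add: rho_eq power_add algebra_simps)
    qed (simp add: rho_def)
    then show "AE t in lborel. norm (\<bar>t\<bar> ^ k * rho a b t) \<le> norm ((\<bar>t\<bar> ^ k + \<bar>t\<bar> ^ (k + m)) * exp (- a * t\<^sup>2))"
      by (intro AE_I2) (simp add: abs_mult rho_nonneg)
  qed simp
qed

lemma integrable_rho_bounded:
  fixes g :: "real \<Rightarrow> real"
  assumes "a > 0" "b \<ge> 0" "g \<in> borel_measurable borel" "\<And>t. \<bar>g t\<bar> \<le> B * (1 + \<bar>t\<bar> ^ k)"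
  shows "integrable lborel (\<lambda>t. g t * rho a b t)"
proof (rule Bochner_Integration.integrable_bound[of _ "\<lambda>t. B * (\<bar>t\<bar> ^ 0 * rho a b t + \<bar>t\<bar> ^ k * rho a b t)"])
  show "integrable lborel (\<lambda>t. B * (\<bar>t\<bar> ^ 0 * rho a b t + \<bar>t\<bar> ^ k * rho a b t))"
    using assms by (intro integrable_mult_right Bochner_Integration.integrable_add integrable_rho_moment)
  show "AE t in lborel. norm (g t * rho a b t) \<le> norm (B * (\<bar>t\<bar> ^ 0 * rho a b t + \<bar>t\<bar> ^ k * rho a b t))"
  proof (rule AE_I2)
    fix t
    have "\<bar>g t\<bar> * rho a b t \<le> (B * (1 + \<bar>t\<bar> ^ k)) * rho a b t"
      using assms(4) rho_nonneg by (rule mult_right_mono)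
    then have "norm (g t * rho a b t) \<le> B * (\<bar>t\<bar> ^ 0 * rho a b t + \<bar>t\<bar> ^ k * rho a b t)"
      by (simp add: abs_mult rho_nonneg algebra_simps)
    then show "norm (g t * rho a b t) \<le> norm (B * (\<bar>t\<bar> ^ 0 * rho a b t + \<bar>t\<bar> ^ k * rho a b t))"
      unfolding real_norm_def[of "B * _"] by linarith
  qed
qed (use assms in measurable)

lemma interval_integral_rho:
  "(LBINT t=half_start b..\<infinity>. g t * rho a b t) = (\<integral>t. g t * rho a b t \<partial>lborel)"
proof -
  have "(\<lambda>t. indicator (half b) t *\<^sub>R (g t * rho a b t)) = (\<lambda>t. g t * rho a b t)"
    by (auto simp: rho_def indicator_def)
  then show ?thesis
    by (simp add: interval_lebesgue_integral_def half_start_def set_lebesgue_integral_def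
        einterval_half_start[unfolded half_start_def] split: if_splits)
qed

section \<open>Hardy-type inequality on a nodal interval and its boundary terms\<close>

text \<open>With \<open>q = 2 t / (t\<^sup>2 - x0\<^sup>2)\<close>, the logarithmic derivative of the second eigenfunction, the
  integrand equals \<open>(z' - q z)\<^sup>2 rho\<close> plus the derivative of \<open>q z\<^sup>2 rho\<close>.\<close>

lemma hardy_interval:
  fixes z z' :: "real \<Rightarrow> real" and l r :: ereal
  assumes b: "b \<ge> 0" and lr: "l < r" and sub: "einterval l r \<subseteq> half b"
    and x0: "2 * a * x0\<^sup>2 = b + 1" and nz: "\<And>t. t \<in> einterval l r \<Longrightarrow> t\<^sup>2 \<noteq> x0\<^sup>2"
    and z: "\<And>t. (z has_real_derivative z' t) (at t)" and z': "\<And>t. isCont z' t"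
    and int: "set_integrable lborel (einterval l r) (\<lambda>t. ((z' t)\<^sup>2 - 4 * a * (z t)\<^sup>2) * rho a b t)"
    and L: "(((\<lambda>t. 2 * t * (z t)\<^sup>2 * rho a b t / (t\<^sup>2 - x0\<^sup>2)) \<circ> real_of_ereal) \<longlongrightarrow> 0) (at_right l)"
    and R: "(((\<lambda>t. 2 * t * (z t)\<^sup>2 * rho a b t / (t\<^sup>2 - x0\<^sup>2)) \<circ> real_of_ereal) \<longlongrightarrow> 0) (at_left r)"
  shows "0 \<le> (LBINT t=l..r. ((z' t)\<^sup>2 - 4 * a * (z t)\<^sup>2) * rho a b t)"
proof -
  define f where "f t = ((z' t)\<^sup>2 - 4 * a * (z t)\<^sup>2) * rho a b t" for t
  define q where "q t = 2 * t / (t\<^sup>2 - x0\<^sup>2)" for t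
  have cz: "isCont z t" for t using z DERIV_isCont by blast
  have "0 - 0 \<le> (LBINT t=l..r. f t)"
  proof (rule interval_integral_FTC_ge[OF lr])
    fix t assume "l < ereal t" "ereal t < r"
    then have t: "t \<in> einterval l r" by (simp add: einterval_def)
    then have th: "t \<in> half b" and p: "t\<^sup>2 - x0\<^sup>2 \<noteq> 0" using sub nz[OF t] by auto
    show "((\<lambda>t. 2 * t * (z t)\<^sup>2 * rho a b t / (t\<^sup>2 - x0\<^sup>2)) has_real_derivative
      f t - (z' t - q t * z t)\<^sup>2 * rho a b t) (at t)"
    proof -
      have tb: "t * (b / t) = b"
        using th b by (cases "t = 0") (auto simp: half_def split: if_splits)
      have dp: "((\<lambda>t. t\<^sup>2 - x0\<^sup>2) has_real_derivative 2 * t) (at t)"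
        by (auto intro!: derivative_eq_intros)
      have dn: "((\<lambda>t. 2 * t * (z t)\<^sup>2 * rho a b t) has_real_derivative
          (2 * (z t)\<^sup>2 + 4 * t * z t * z' t) * rho a b t + 2 * t * (z t)\<^sup>2 * ((b / t - 2 * a * t) * rho a b t)) (at t)"
      proof -
        have "((\<lambda>t. 2 * t * (z t)\<^sup>2) has_real_derivative 2 * (z t)\<^sup>2 + 4 * t * z t * z' t) (at t)"
          by (auto intro!: derivative_eq_intros z simp: algebra_simps)
        from DERIV_mult[OF this has_real_derivative_rho[OF b th]] show ?thesis by (simp add: algebra_simps)
      qed
      have num: "(2 * (z t)\<^sup>2 + 4 * t * z t * z' t) * rho a b t + 2 * t * (z t)\<^sup>2 * ((b / t - 2 * a * t) * rho a b t)
        = (2 * (z t)\<^sup>2 + 4 * t * z t * z' t + 2 * (z t)\<^sup>2 * (b - 2 * a * t\<^sup>2)) * rho a b t"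
      proof -
        have "t * (b / t - 2 * a * t) = b - 2 * a * t\<^sup>2"
          using tb by (simp add: right_diff_distrib power2_eq_square)
        moreover have "2 * t * (z t)\<^sup>2 * (w * rho a b t) = 2 * (z t)\<^sup>2 * (t * w) * rho a b t" for w
          by simp
        ultimately show ?thesis by (simp only: distrib_right)
      qed
      \<comment> \<open>This amounts to the Riccati equation
        \<open>q' + q^2 + (b / t - 2 a t) q = - 4 a\<close>, which \<open>q\<close> satisfies as the
        logarithmic derivative of an eigenfunction for \<open>4 a\<close>. The relation
        \<open>2 a x0^2 = b + 1\<close> enters through \<open>bb\<close>.\<close>
      have "((2 * (z t)\<^sup>2 + 4 * t * z t * z' t + 2 * (z t)\<^sup>2 * (b - 2 * a * t\<^sup>2)) * rho a b t * (t\<^sup>2 - x0\<^sup>2)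
          - 2 * t * (z t)\<^sup>2 * rho a b t * (2 * t)) / ((t\<^sup>2 - x0\<^sup>2) * (t\<^sup>2 - x0\<^sup>2))
        = f t - (z' t - q t * z t)\<^sup>2 * rho a b t"
      proof -
        have b': "b = 2 * a * x0\<^sup>2 - 1" using x0 by simp
        define p where "p = t\<^sup>2 - x0\<^sup>2"
        have pn: "p \<noteq> 0" using p by (simp add: p_def)
        have bb: "b - 2 * a * t\<^sup>2 = - 1 - 2 * a * p" using b' by (simp add: p_def algebra_simps)
        show ?thesis
          unfolding f_def q_def bb p_def[symmetric]
          using pn by (simp add: field_simps power2_eq_square)
      qed
      with DERIV_divide[OF dn dp p] num show ?thesis by simp
    qed
    show "isCont (\<lambda>t. f t - (z' t - q t * z t)\<^sup>2 * rho a b t) t"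
      unfolding f_def q_def using p by (intro continuous_intros z' cz isCont_rho b th)
    show "isCont f t"
      unfolding f_def by (intro continuous_intros z' cz isCont_rho b th)
    show "f t - (z' t - q t * z t)\<^sup>2 * rho a b t \<le> f t"
      using rho_nonneg[of a b t] by simp
  qed (use int L R in \<open>simp_all add: f_def\<close>)
  then show ?thesis by (simp add: f_def)
qed

text \<open>The denominator has a simple zero at \<open>y\<close>, whereas the square of
  \<open>z\<close> has a zero of order at least two.\<close>

lemma hardy_boundary_node:
  fixes z :: "real \<Rightarrow> real"
  assumes b: "b \<ge> 0" and y: "y \<in> half b" "y\<^sup>2 = x0\<^sup>2" "y \<noteq> 0" and z: "(z has_real_derivative z') (at y)" and zy: "z y = 0"
  shows "((\<lambda>t. 2 * t * (z t)\<^sup>2 * rho a b t / (t\<^sup>2 - x0\<^sup>2)) \<longlongrightarrow> 0) (at y)"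
proof -
  have "((\<lambda>t. (z t - z y) / (t - y)) \<longlongrightarrow> z') (at y)"
    using z by (simp add: has_field_derivative_iff)
  moreover have "(z \<longlongrightarrow> z y) (at y)" using DERIV_isCont[OF z] by (simp add: isCont_def)
  moreover have "(rho a b \<longlongrightarrow> rho a b y) (at y)" using isCont_rho[OF b y(1)] by (simp add: isCont_def)
  ultimately have "((\<lambda>t. (2 * t * rho a b t / (t + y)) * ((z t - z y) / (t - y)) * z t) \<longlongrightarrow>
      (2 * y * rho a b y / (y + y)) * z' * z y) (at y)"
    using y(3) by (intro tendsto_intros) auto
  then have "((\<lambda>t. (2 * t * rho a b t / (t + y)) * ((z t - z y) / (t - y)) * z t) \<longlongrightarrow> 0) (at y)"
    using zy by simp
  then show ?thesis
  proof (rule Lim_transform_eventually)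
    show "\<forall>\<^sub>F t in at y. 2 * t * rho a b t / (t + y) * ((z t - z y) / (t - y)) * z t
        = 2 * t * (z t)\<^sup>2 * rho a b t / (t\<^sup>2 - x0\<^sup>2)"
    proof (rule always_eventually, rule allI)
      fix t
      have "t\<^sup>2 - x0\<^sup>2 = (t + y) * (t - y)" using y(2) by (simp add: power2_eq_square algebra_simps)
      then show "2 * t * rho a b t / (t + y) * ((z t - z y) / (t - y)) * z t
        = 2 * t * (z t)\<^sup>2 * rho a b t / (t\<^sup>2 - x0\<^sup>2)"
        using zy by (simp add: power2_eq_square)
    qed
  qed
qed

text \<open>A compactly supported function minus an affine one is affine near infinity, and the
  Gaussian factor beats any power of \<open>t\<close>. Writing \<open>z t = t * (c / t + d)\<close>
  separates the coefficients from the expression whose decay is computed.\<close>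

lemma hardy_boundary_top:
  fixes z :: "real \<Rightarrow> real"
  assumes a: "a > 0" and b: "b \<ge> 0" and z: "\<forall>\<^sub>F t in at_top. z t = c + d * t"
  shows "((\<lambda>t. 2 * t * (z t)\<^sup>2 * rho a b t / (t\<^sup>2 - y\<^sup>2)) \<longlongrightarrow> 0) at_top"
proof -
  have cd: "((\<lambda>t. c / t + d) \<longlongrightarrow> d) at_top"
    by real_asymp
  have "((\<lambda>t::real. 2 * t^3 * (t powr b * exp (- a * t\<^sup>2)) / (t\<^sup>2 - y\<^sup>2)) \<longlongrightarrow> 0) at_top"
    using a b by real_asymp
  from tendsto_mult[OF tendsto_power[OF cd, of 2] this]
  have "((\<lambda>t. (c / t + d)\<^sup>2 * (2 * t^3 * (t powr b * exp (- a * t\<^sup>2)) / (t\<^sup>2 - y\<^sup>2))) \<longlongrightarrow> 0) at_top"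
    by simp
  then show ?thesis
  proof (rule Lim_transform_eventually)
    show "\<forall>\<^sub>F t in at_top. (c / t + d)\<^sup>2 * (2 * t^3 * (t powr b * exp (- a * t\<^sup>2)) / (t\<^sup>2 - y\<^sup>2))
        = 2 * t * (z t)\<^sup>2 * rho a b t / (t\<^sup>2 - y\<^sup>2)"
      using z eventually_gt_at_top[of 0]
    proof eventually_elim
      case (elim t)
      then have "rho a b t = t powr b * exp (- a * t\<^sup>2)" using b by (auto simp: rho_def wt_def half_def)
      moreover have "(c / t + d)\<^sup>2 * t^3 = t * (z t)\<^sup>2"
        using elim by (simp add: field_simps power2_eq_square power3_eq_cube)
      moreover have "(c / t + d)\<^sup>2 * (2 * t^3 * w / (t\<^sup>2 - y\<^sup>2)) = 2 * ((c / t + d)\<^sup>2 * t^3) * w / (t\<^sup>2 - y\<^sup>2)" for w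
        by simp
      ultimately show ?case by (simp only:)
    qed
  qed
qed

lemma hardy_boundary_bot:
  fixes z :: "real \<Rightarrow> real"
  assumes a: "a > 0" and z: "\<forall>\<^sub>F t in at_bot. z t = c + d * t"
  shows "((\<lambda>t. 2 * t * (z t)\<^sup>2 * rho a 0 t / (t\<^sup>2 - y\<^sup>2)) \<longlongrightarrow> 0) at_bot"
proof -
  have rho: "rho a 0 (- t) = rho a 0 t" for t by (simp add: rho_def half_def wt_def)
  have "\<forall>\<^sub>F t in at_top. z (- t) = c + (- d) * t"
    using z unfolding at_bot_mirror eventually_filtermap by simp
  from tendsto_minus[OF hardy_boundary_top[OF a order_refl this, of y]]
  have "((\<lambda>t. - (2 * t * (z (- t))\<^sup>2 * rho a 0 t / (t\<^sup>2 - y\<^sup>2))) \<longlongrightarrow> 0) at_top" by simp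
  then show ?thesis unfolding filterlim_at_bot_mirror by (simp add: rho)
qed

lemma tendsto_rho_boundary_zero:
  assumes a: "a > 0" and b: "b > 0"
  shows "((\<lambda>t. t * rho a b t) \<longlongrightarrow> 0) (at_right 0)"
proof (rule Lim_transform_eventually)
  show "((\<lambda>t::real. t * (t powr b * exp (- a * t\<^sup>2))) \<longlongrightarrow> 0) (at_right 0)"
    using a b by real_asymp
  have "\<forall>\<^sub>F t::real in at_right 0. t > 0" by (rule eventually_at_right_less)
  then show "\<forall>\<^sub>F t in at_right 0. t * (t powr b * exp (- a * t\<^sup>2)) = t * rho a b t"
    by eventually_elim (use b in \<open>simp add: rho_def wt_def half_def\<close>)
qed

text \<open>The boundary term contains \<open>t * t powr b\<close>, which tends to 0 at the end
  point of the half-line, so continuity of \<open>z\<close> there is enough, whatever its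
  value.\<close>

lemma hardy_boundary_zero:
  fixes z :: "real \<Rightarrow> real"
  assumes a: "a > 0" and b: "b > 0" and z: "isCont z 0" and y: "y \<noteq> 0"
  shows "((\<lambda>t. 2 * t * (z t)\<^sup>2 * rho a b t / (t\<^sup>2 - y\<^sup>2)) \<longlongrightarrow> 0) (at_right 0)"
proof -
  have "(z \<longlongrightarrow> z 0) (at_right 0)" using z by (simp add: isCont_def filterlim_at_split)
  then have "((\<lambda>t. 2 * (z t)\<^sup>2 * (t * rho a b t) / (t\<^sup>2 - y\<^sup>2)) \<longlongrightarrow> 2 * (z 0)\<^sup>2 * 0 / (0\<^sup>2 - y\<^sup>2)) (at_right 0)"
    using y by (intro tendsto_intros tendsto_rho_boundary_zero a b) auto
  then show ?thesis by (simp add: mult_ac)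
qed

lemma continuous_compact_support_bounded:
  fixes g :: "real \<Rightarrow> real"
  assumes "\<And>t. isCont g t" "\<And>t. \<bar>t\<bar> > R \<Longrightarrow> g t = 0"
  obtains B where "\<And>t. \<bar>g t\<bar> \<le> B"
proof -
  have "continuous_on {-R..R} g" using assms(1) by (simp add: continuous_at_imp_continuous_on)
  then have "compact (g ` {-R..R})" by (intro compact_continuous_image) auto
  then obtain B where B: "\<And>x. x \<in> g ` {-R..R} \<Longrightarrow> norm x \<le> B"
    using compact_imp_bounded bounded_iff by metis
  have "\<bar>g t\<bar> \<le> max B 0" for t
  proof (cases "\<bar>t\<bar> > R")
    case False
    then have "t \<in> {-R..R}" by auto
    then have "g t \<in> g ` {-R..R}" by (rule imageI)
    from B[OF this] show ?thesis by simp
  qed (use assms(2) in simp)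
  then show thesis using that by blast
qed

lemma integrable_rho_compact_support:
  fixes g :: "real \<Rightarrow> real"
  assumes "a > 0" "b \<ge> 0" "\<And>t. isCont g t" "\<And>t. \<bar>t\<bar> > R \<Longrightarrow> g t = 0"
  shows "integrable lborel (\<lambda>t. g t * rho a b t)"
proof -
  obtain B where B: "\<And>t. \<bar>g t\<bar> \<le> B"
    using continuous_compact_support_bounded[of g R] assms(3,4) by blast
  have "continuous_on UNIV g" using assms(3) by (simp add: continuous_at_imp_continuous_on)
  then have "g \<in> borel_measurable borel" by (rule borel_measurable_continuous_onI)
  then show ?thesis
  proof (rule integrable_rho_bounded[OF assms(1,2)])
    show "\<bar>g t\<bar> \<le> B * (1 + \<bar>t\<bar> ^ 0)" for t
      using B[of t] by simp
  qed
qed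

lemma deriv_zero_outside:
  fixes v v' :: "real \<Rightarrow> real"
  assumes v: "(v has_real_derivative v' t) (at t)" and supp: "\<And>t. \<bar>t\<bar> > R \<Longrightarrow> v t = 0" and t: "\<bar>t\<bar> > R"
  shows "v' t = 0"
proof -
  have op: "open {t::real. \<bar>t\<bar> > R}" by (intro open_Collect_less continuous_intros)
  have "(v has_real_derivative 0) (at t)"
    by (rule has_field_derivative_transform_within_open[OF DERIV_const[of 0] op]) (use supp t in auto)
  then show ?thesis using v DERIV_unique by blast
qed

lemma interval_integrable_of_integrable:
  fixes f :: "real \<Rightarrow> real"
  assumes "integrable lborel f"
  shows "interval_lebesgue_integrable lborel p q f"
    and "set_integrable lborel (einterval p q) f"
  using integrable_mult_indicator[OF _ assms] by (auto simp: interval_lebesgue_integrable_def set_integrable_def)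

text \<open>The interval \<open>{0<..<1}\<close> lies in \<open>half b\<close> for every
  \<open>b\<close>; a vanishing integral would make it a null set. The exceptional point
  \<open>m\<close> allows \<open>g\<close> to be a squared deviation from the mean, as in the
  positivity of the variance.\<close>

lemma integral_rho_weight_pos:
  assumes b: "b \<ge> 0" and int: "integrable lborel (\<lambda>t. g t * rho a b t)"
    and g: "\<And>t. 0 \<le> g t" "\<And>t. t \<noteq> m \<Longrightarrow> 0 < g t"
  shows "0 < (\<integral>t. g t * rho a b t \<partial>lborel)"
proof (rule ccontr)
  have nn: "0 \<le> g t * rho a b t" for t using g(1) rho_nonneg by simp
  assume "\<not> 0 < (\<integral>t. g t * rho a b t \<partial>lborel)"
  moreover have "0 \<le> (\<integral>t. g t * rho a b t \<partial>lborel)" by (rule Bochner_Integration.integral_nonneg) (rule nn)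
  ultimately have "(\<integral>t. g t * rho a b t \<partial>lborel) = 0" by simp
  then have "AE t in lborel. g t * rho a b t = 0"
    using integral_nonneg_eq_0_iff_AE[OF int] nn by simp
  moreover have "AE t in lborel. t \<noteq> m" by (rule AE_lborel_singleton)
  ultimately have "AE t in lborel. t \<notin> {0<..<1::real}"
  proof eventually_elim
    case (elim t)
    show ?case
    proof
      assume "t \<in> {0<..<1}"
      then have "t \<in> half b" by (auto simp: half_def)
      then have "0 < g t * rho a b t" using rho_pos[OF b, of t a] g(2)[of t] elim(2) by (intro mult_pos_pos) auto
      with elim show False by auto
    qed
  qed
  then have "emeasure lborel {0<..<1::real} = 0"
    by (subst (asm) AE_iff_measurable[where N = "{0<..<1}"]) auto
  then show False by simp
qed

lemma integral_rho_pos: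
  assumes "a > 0" "b \<ge> 0"
  shows "0 < (\<integral>t. rho a b t \<partial>lborel)"
  using integral_rho_weight_pos[of b "\<lambda>_. 1" a] integrable_rho_moment[OF assms, of 0] assms by simp

section \<open>Spectral gap for compactly supported functions of one variable\<close>

locale test_function_1d =
  fixes a b R :: real and v v' :: "real \<Rightarrow> real"
  assumes a: "a > 0" and b: "b \<ge> 0"
    and v: "\<And>t. (v has_real_derivative v' t) (at t)" and v': "\<And>t. isCont v' t"
    and supp: "\<And>t. \<bar>t\<bar> > R \<Longrightarrow> v t = 0"
begin

lemma supp': "\<bar>t\<bar> > R \<Longrightarrow> v' t = 0"
  by (rule deriv_zero_outside[where v = v and R = R]) (use v supp in auto)

lemma isCont_v: "isCont v t"
  using v DERIV_isCont by blast

lemma integrable_v: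
  "integrable lborel (\<lambda>t. v t * rho a b t)"
  "integrable lborel (\<lambda>t. t * v t * rho a b t)"
  "integrable lborel (\<lambda>t. (v t)\<^sup>2 * rho a b t)"
  "integrable lborel (\<lambda>t. v' t * rho a b t)"
  "integrable lborel (\<lambda>t. (v' t)\<^sup>2 * rho a b t)"
  by (rule integrable_rho_compact_support[OF a b, of _ R];
      (intro continuous_intros isCont_v v')?; simp add: supp supp')+

lemma integrable_one: "integrable lborel (rho a b)"
  using integrable_rho_moment[OF a b, of 0] by simp

lemma integrable_t: "integrable lborel (\<lambda>t. t * rho a b t)"
  by (rule integrable_rho_bounded[OF a b, of _ 1 1]) auto

lemma integrable_t2: "integrable lborel (\<lambda>t. t\<^sup>2 * rho a b t)"
  using integrable_rho_moment[OF a b, of 2] by simp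

lemma residual_expand:
  "((v' t - d)\<^sup>2 - 4 * a * (v t - (c + d * t))\<^sup>2) * rho a b t
   = (v' t)\<^sup>2 * rho a b t - 2 * d * (v' t * rho a b t) + d\<^sup>2 * rho a b t
     - 4 * a * ((v t)\<^sup>2 * rho a b t) + 8 * a * c * (v t * rho a b t) + 8 * a * d * (t * v t * rho a b t)
     - 4 * a * c\<^sup>2 * rho a b t - 8 * a * c * d * (t * rho a b t) - 4 * a * d\<^sup>2 * (t\<^sup>2 * rho a b t)"
  by (simp add: power2_eq_square algebra_simps)

lemma integrable_residual:
  "integrable lborel (\<lambda>t. ((v' t - d)\<^sup>2 - 4 * a * (v t - (c + d * t))\<^sup>2) * rho a b t)"
  unfolding residual_expand
  by (intro Bochner_Integration.integrable_add Bochner_Integration.integrable_diff integrable_mult_right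
      integrable_v integrable_one integrable_t integrable_t2)

lemma integral_residual:
  "(\<integral>t. ((v' t - d)\<^sup>2 - 4 * a * (v t - (c + d * t))\<^sup>2) * rho a b t \<partial>lborel)
   = (\<integral>t. (v' t)\<^sup>2 * rho a b t \<partial>lborel) - 2 * d * (\<integral>t. v' t * rho a b t \<partial>lborel) + d\<^sup>2 * (\<integral>t. rho a b t \<partial>lborel)
     - 4 * a * (\<integral>t. (v t)\<^sup>2 * rho a b t \<partial>lborel) + 8 * a * c * (\<integral>t. v t * rho a b t \<partial>lborel)
     + 8 * a * d * (\<integral>t. t * v t * rho a b t \<partial>lborel)
     - 4 * a * c\<^sup>2 * (\<integral>t. rho a b t \<partial>lborel) - 8 * a * c * d * (\<integral>t. t * rho a b t \<partial>lborel)
     - 4 * a * d\<^sup>2 * (\<integral>t. t\<^sup>2 * rho a b t \<partial>lborel)"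
  unfolding residual_expand using integrable_v integrable_one integrable_t integrable_t2 by simp

lemma residual_deriv: "((\<lambda>t. v t - (c + d * t)) has_real_derivative v' t - d) (at t)"
  by (auto intro!: derivative_eq_intros v)

lemma residual_top: "\<forall>\<^sub>F t in at_top. v t - (c + d * t) = - c + (- d) * t"
  using eventually_gt_at_top[of R] by eventually_elim (simp add: supp)

lemma residual_bot: "\<forall>\<^sub>F t in at_bot. v t - (c + d * t) = - c + (- d) * t"
  using eventually_gt_at_bot[of "-R"] by eventually_elim (simp add: supp)

text \<open>The positive zero of the polynomial eigenfunction for \<open>4 * a\<close>: the Hermite
  polynomial of degree 2 if \<open>b = 0\<close>, and the Laguerre polynomial of degree 1 in the
  variable \<open>t^2\<close> if \<open>b > 0\<close>, up to scaling.\<close>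

definition node :: real where "node = sqrt ((b + 1) / (2 * a))"

lemma node: "node > 0" "2 * a * node\<^sup>2 = b + 1"
  using a b by (auto simp: node_def)

lemma residual_interval:
  assumes "l < r" "einterval l r \<subseteq> half b" "\<And>t. t \<in> einterval l r \<Longrightarrow> t\<^sup>2 \<noteq> node\<^sup>2"
    and "(((\<lambda>t. 2 * t * (v t - (c + d * t))\<^sup>2 * rho a b t / (t\<^sup>2 - node\<^sup>2)) \<circ> real_of_ereal) \<longlongrightarrow> 0) (at_right l)"
    and "(((\<lambda>t. 2 * t * (v t - (c + d * t))\<^sup>2 * rho a b t / (t\<^sup>2 - node\<^sup>2)) \<circ> real_of_ereal) \<longlongrightarrow> 0) (at_left r)"
  shows "0 \<le> (LBINT t=l..r. ((v' t - d)\<^sup>2 - 4 * a * (v t - (c + d * t))\<^sup>2) * rho a b t)"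
  by (rule hardy_interval[OF b assms(1,2) node(2) assms(3) residual_deriv[of c d] _ _ assms(4,5)])
    (auto intro!: continuous_intros v' interval_integrable_of_integrable integrable_residual)

lemma residual_node:
  assumes "y \<in> half b" "y = node \<or> y = - node" "v y = c + d * y"
  shows "((\<lambda>t. 2 * t * (v t - (c + d * t))\<^sup>2 * rho a b t / (t\<^sup>2 - node\<^sup>2)) \<longlongrightarrow> 0) (at y)"
  by (rule hardy_boundary_node[OF b assms(1) _ _ residual_deriv]) (use assms node(1) in auto)

text \<open>Subtracting from \<open>v\<close> its interpolant at the zeros of the eigenfunction \<open>t\<^sup>2 - node\<^sup>2\<close> for the
  spectral value \<open>4 * a\<close> leaves a function with Dirichlet data on each nodal interval.\<close>

lemma poincare_half_line:
  assumes bpos: "b > 0"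
  shows "4 * a * (\<integral>t. (v t)\<^sup>2 * rho a b t \<partial>lborel)
      - 4 * a * (\<integral>t. v t * rho a b t \<partial>lborel)\<^sup>2 / (\<integral>t. rho a b t \<partial>lborel)
    \<le> (\<integral>t. (v' t)\<^sup>2 * rho a b t \<partial>lborel)"
proof -
  \<comment> \<open>Only one zero lies in the half-line, so a constant interpolates. The slope 0 is
    written out below to match the lemmas on residuals with slope \<open>d\<close>.\<close>
  define c where "c = v node"
  define H where "H t = 2 * t * (v t - (c + 0 * t))\<^sup>2 * rho a b t / (t\<^sup>2 - node\<^sup>2)" for t
  define f where "f t = ((v' t - 0)\<^sup>2 - 4 * a * (v t - (c + 0 * t))\<^sup>2) * rho a b t" for t
  have nh: "node \<in> half b" using node(1) bpos by (simp add: half_def)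
  have Hn: "(H \<longlongrightarrow> 0) (at node)"
    unfolding H_def by (rule residual_node[OF nh]) (auto simp: c_def)
  have H0: "(H \<longlongrightarrow> 0) (at_right 0)"
    unfolding H_def using node(1) by (intro hardy_boundary_zero a bpos continuous_intros isCont_v) auto
  have Ht: "(H \<longlongrightarrow> 0) at_top"
    unfolding H_def by (rule hardy_boundary_top[OF a b residual_top])
  have sq: "t\<^sup>2 \<noteq> node\<^sup>2" if "t > 0" "t \<noteq> node" for t
    using that node(1) by (simp add: power2_eq_iff)
  have 1: "0 \<le> (LBINT t=ereal 0..ereal node. f t)"
    unfolding f_def
    by (rule residual_interval; (fold H_def)?)
      (use node(1) bpos sq H0 Hn in \<open>auto simp: einterval_def half_def ereal_tendsto_simps filterlim_at_split\<close>)
  have 2: "0 \<le> (LBINT t=ereal node..\<infinity>. f t)"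
    unfolding f_def
    by (rule residual_interval; (fold H_def)?)
      (use node(1) bpos sq Ht Hn in \<open>auto simp: einterval_def half_def ereal_tendsto_simps filterlim_at_split\<close>)
  have "(LBINT t=ereal 0..ereal node. f t) + (LBINT t=ereal node..\<infinity>. f t) = (LBINT t=ereal 0..\<infinity>. f t)"
    unfolding f_def by (intro interval_integral_sum interval_integrable_of_integrable integrable_residual)
  also have "\<dots> = (\<integral>t. f t \<partial>lborel)"
    using interval_integral_rho[of b] bpos by (simp add: f_def half_start_def zero_ereal_def)
  finally have f0: "0 \<le> (\<integral>t. f t \<partial>lborel)" using 1 2 by linarith
  define Z m S E where "Z = (\<integral>t. rho a b t \<partial>lborel)" and "m = (\<integral>t. v t * rho a b t \<partial>lborel)"
    and "S = (\<integral>t. (v t)\<^sup>2 * rho a b t \<partial>lborel)" and "E = (\<integral>t. (v' t)\<^sup>2 * rho a b t \<partial>lborel)"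
  have "0 \<le> E - 4 * a * S + 8 * a * c * m - 4 * a * c\<^sup>2 * Z"
    using f0 unfolding f_def integral_residual by (simp add: Z_def m_def S_def E_def)
  \<comment> \<open>The interpolating constant \<open>c\<close> is in general not the mean of
    \<open>v\<close>, but as a function of \<open>c\<close> the left side is largest at the mean
    \<open>m / Z\<close>, where it becomes the term of the variance.\<close>
  moreover have "2 * c * m - c\<^sup>2 * Z \<le> m\<^sup>2 / Z" if "Z > 0"
  proof -
    have "0 \<le> (m - c * Z)\<^sup>2 / Z" using that by simp
    also have "\<dots> = m\<^sup>2 / Z - (2 * c * m - c\<^sup>2 * Z)" using that by (simp add: power2_eq_square field_simps)
    finally show ?thesis by simp
  qed
  moreover have "Z > 0" unfolding Z_def by (rule integral_rho_pos[OF a b])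
  ultimately have "0 \<le> E - 4 * a * S + 4 * a * (m\<^sup>2 / Z)"
    using a mult_left_mono[of "2 * c * m - c\<^sup>2 * Z" "m\<^sup>2 / Z" "4 * a"] by (simp add: algebra_simps)
  then show ?thesis by (simp add: Z_def m_def S_def E_def)
qed

lemma rho_line: "b = 0 \<Longrightarrow> rho a b t = exp (- a * t\<^sup>2)"
  by (simp add: rho_def half_def wt_def)

lemma line_moments:
  assumes b0: "b = 0"
  shows "(\<integral>t. t * rho a b t \<partial>lborel) = 0"
    and "2 * a * (\<integral>t. t\<^sup>2 * rho a b t \<partial>lborel) = (\<integral>t. rho a b t \<partial>lborel)"
proof -
  define s where "s = sqrt (1 / (2 * a))"
  define K where "K = sqrt (2 * pi * s\<^sup>2)"
  have s: "s > 0" "s\<^sup>2 = 1 / (2 * a)" using a by (auto simp: s_def)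
  have nd: "rho a b t = K * normal_density 0 s t" for t
    using s a by (simp add: normal_density_def rho_line[OF b0] K_def)
  show "(\<integral>t. t * rho a b t \<partial>lborel) = 0"
    using integral_normal_moment_odd[OF s(1), of 0 0] 
    by (simp add: nd mult.left_commute[of _ K] mult.commute[of "normal_density _ _ _" "_ :: real"])
  have "(\<integral>t. normal_density 0 s t * t\<^sup>2 \<partial>lborel) = s\<^sup>2"
    using integral_normal_moment_even[OF s(1), of 0 1] by simp
  then show "2 * a * (\<integral>t. t\<^sup>2 * rho a b t \<partial>lborel) = (\<integral>t. rho a b t \<partial>lborel)"
    using s a by (simp add: nd mult_ac)
qed

text \<open>Expanding the residual with slope \<open>d\<close> produces the mean of
  \<open>v'\<close>; integrating the derivative of \<open>v t * rho a b t\<close> turns it into the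
  first moment of \<open>v\<close>, that is, into its coefficient on the linear mode.\<close>

lemma line_parts:
  assumes b0: "b = 0"
  shows "(\<integral>t. v' t * rho a b t \<partial>lborel) = 2 * a * (\<integral>t. t * v t * rho a b t \<partial>lborel)"
proof -
  define f where "f t = (v' t - 2 * a * (t * v t)) * rho a b t" for t
  have int: "integrable lborel f"
    unfolding f_def left_diff_distrib
    by (intro Bochner_Integration.integrable_diff integrable_v)
      (use integrable_v(2) in \<open>simp add: mult.assoc\<close>)
  have half: "t \<in> half b" for t using b0 by (simp add: half_def)
  have "(LBINT t=-\<infinity>..\<infinity>. f t) = 0 - 0"
  proof (rule interval_integral_FTC_integrable)
    show "((\<lambda>t. v t * rho a b t) has_vector_derivative f t) (at t)" for t
      using DERIV_mult[OF v has_real_derivative_rho[OF b half]] b0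
      by (simp add: f_def has_real_derivative_iff_has_vector_derivative[symmetric] algebra_simps)
    show "isCont f t" for t
      unfolding f_def by (intro continuous_intros v' isCont_v isCont_rho b half)
    have "\<forall>\<^sub>F t in at_top. v t * rho a b t = 0"
      using eventually_gt_at_top[of R] by eventually_elim (simp add: supp)
    then show "(((\<lambda>t. v t * rho a b t) \<circ> real_of_ereal) \<longlongrightarrow> 0) (at_left \<infinity>)"
      unfolding ereal_tendsto_simps by (rule tendsto_eventually)
    have "\<forall>\<^sub>F t in at_bot. v t * rho a b t = 0"
      using eventually_gt_at_bot[of "-R"]
      by eventually_elim (simp add: supp)
    then show "(((\<lambda>t. v t * rho a b t) \<circ> real_of_ereal) \<longlongrightarrow> 0) (at_right (-\<infinity>))"
      unfolding ereal_tendsto_simps by (rule tendsto_eventually)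
    show "set_integrable lborel (einterval (-\<infinity>) \<infinity>) f" by (rule interval_integrable_of_integrable(2)[OF int])
  qed simp
  then have "(\<integral>t. f t \<partial>lborel) = 0"
    using interval_integral_rho[of b] b0 by (simp add: f_def half_start_def)
  moreover have "(\<integral>t. f t \<partial>lborel) = (\<integral>t. v' t * rho a b t \<partial>lborel) - 2 * a * (\<integral>t. t * v t * rho a b t \<partial>lborel)"
    unfolding f_def left_diff_distrib mult.assoc[of "2 * a"] using integrable_v(2,4) by simp
  ultimately show ?thesis by simp
qed

text \<open>The line has the two nodes \<open>node\<close> and \<open>- node\<close>, hence an
  affine interpolant and three nodal intervals. Adding the three nonnegative integrals and expanding
  leaves a concave quadratic in the interpolation coefficients \<open>c\<close> and
  \<open>d\<close>. Replacing it by its maximum gives the projections onto constants and linear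
  functions.\<close>

lemma poincare_line:
  assumes b0: "b = 0"
  shows "4 * a * (\<integral>t. (v t)\<^sup>2 * rho a b t \<partial>lborel)
      - 4 * a * (\<integral>t. v t * rho a b t \<partial>lborel)\<^sup>2 / (\<integral>t. rho a b t \<partial>lborel)
      - 4 * a\<^sup>2 * (\<integral>t. t * v t * rho a b t \<partial>lborel)\<^sup>2 / (\<integral>t. rho a b t \<partial>lborel)
    \<le> (\<integral>t. (v' t)\<^sup>2 * rho a b t \<partial>lborel)"
proof -
  define d where "d = (v node - v (- node)) / (2 * node)"
  define c where "c = (v node + v (- node)) / 2"
  define H where "H t = 2 * t * (v t - (c + d * t))\<^sup>2 * rho a b t / (t\<^sup>2 - node\<^sup>2)" for t
  define f where "f t = ((v' t - d)\<^sup>2 - 4 * a * (v t - (c + d * t))\<^sup>2) * rho a b t" for t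
  have half: "t \<in> half b" for t using b0 by (simp add: half_def)
  have vn: "v node = c + d * node" "v (- node) = c + d * (- node)"
    using node(1) by (simp_all add: c_def d_def field_simps)
  have Hn: "(H \<longlongrightarrow> 0) (at node)"
    unfolding H_def by (rule residual_node[OF half]) (use vn in auto)
  have Hm: "(H \<longlongrightarrow> 0) (at (- node))"
    unfolding H_def by (rule residual_node[OF half]) (use vn in auto)
  have Ht: "(H \<longlongrightarrow> 0) at_top"
    unfolding H_def by (rule hardy_boundary_top[OF a b residual_top])
  have Hb: "(H \<longlongrightarrow> 0) at_bot"
    unfolding H_def b0 by (rule hardy_boundary_bot[OF a residual_bot])
  have sq: "t\<^sup>2 \<noteq> node\<^sup>2" if "t \<noteq> - node" "t \<noteq> node" for t
    using that by (simp add: power2_eq_iff)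
  have 1: "0 \<le> (LBINT t=-\<infinity>..ereal (- node). f t)"
    unfolding f_def
    by (rule residual_interval; (fold H_def)?)
      (use node(1) half sq Hb Hm in \<open>auto simp: einterval_def ereal_tendsto_simps filterlim_at_split\<close>)
  have 2: "0 \<le> (LBINT t=ereal (- node)..ereal node. f t)"
    unfolding f_def
    by (rule residual_interval; (fold H_def)?)
      (use node(1) half sq Hm Hn in \<open>auto simp: einterval_def ereal_tendsto_simps filterlim_at_split\<close>)
  have 3: "0 \<le> (LBINT t=ereal node..\<infinity>. f t)"
    unfolding f_def
    by (rule residual_interval; (fold H_def)?)
      (use node(1) half sq Ht Hn in \<open>auto simp: einterval_def ereal_tendsto_simps filterlim_at_split\<close>)
  have "(LBINT t=-\<infinity>..ereal (- node). f t) + (LBINT t=ereal (- node)..ereal node. f t) = (LBINT t=-\<infinity>..ereal node. f t)"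
    unfolding f_def by (intro interval_integral_sum interval_integrable_of_integrable integrable_residual)
  moreover have "(LBINT t=-\<infinity>..ereal node. f t) + (LBINT t=ereal node..\<infinity>. f t) = (LBINT t=-\<infinity>..\<infinity>. f t)"
    unfolding f_def by (intro interval_integral_sum interval_integrable_of_integrable integrable_residual)
  moreover have "(LBINT t=-\<infinity>..\<infinity>. f t) = (\<integral>t. f t \<partial>lborel)"
    using interval_integral_rho[of b] b0 by (simp add: f_def half_start_def)
  ultimately have f0: "0 \<le> (\<integral>t. f t \<partial>lborel)" using 1 2 3 by linarith
  define Z m n W S E where "Z = (\<integral>t. rho a b t \<partial>lborel)" and "m = (\<integral>t. v t * rho a b t \<partial>lborel)"
    and "n = (\<integral>t. t * v t * rho a b t \<partial>lborel)" and "W = (\<integral>t. t\<^sup>2 * rho a b t \<partial>lborel)"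
    and "S = (\<integral>t. (v t)\<^sup>2 * rho a b t \<partial>lborel)" and "E = (\<integral>t. (v' t)\<^sup>2 * rho a b t \<partial>lborel)"
  have Z: "Z > 0" unfolding Z_def by (rule integral_rho_pos[OF a b])
  have W: "4 * a * d\<^sup>2 * W = 2 * d\<^sup>2 * Z"
  proof -
    have "2 * a * W = Z" using line_moments(2)[OF b0] by (simp add: W_def Z_def)
    moreover have "4 * a * d\<^sup>2 * W = 2 * d\<^sup>2 * (2 * a * W)" by simp
    ultimately show ?thesis by simp
  qed
  have "0 \<le> E - 2 * d * (2 * a * n) + d\<^sup>2 * Z - 4 * a * S + 8 * a * c * m + 8 * a * d * n - 4 * a * c\<^sup>2 * Z - 4 * a * d\<^sup>2 * W"
    using f0 unfolding f_def integral_residual line_parts[OF b0] line_moments(1)[OF b0]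
    by (simp add: Z_def m_def n_def S_def E_def W_def)
  \<comment> \<open>The mixed terms in \<open>d\<close> combine as \<open>- 4 + 8 = 4\<close> by
    \<open>line_parts\<close>, and the squares as \<open>1 - 2 = - 1\<close> because the variance is
    \<open>1 / (2 * a)\<close>.\<close>
  then have "0 \<le> E - 4 * a * S + 4 * a * (2 * c * m - c\<^sup>2 * Z) + (4 * a * d * n - d\<^sup>2 * Z)"
    unfolding W by (simp add: algebra_simps)
  moreover have sq: "2 * x * y - x\<^sup>2 * Z \<le> y\<^sup>2 / Z" for x y
  proof -
    have "0 \<le> (y - x * Z)\<^sup>2 / Z" using Z by simp
    also have "\<dots> = y\<^sup>2 / Z - (2 * x * y - x\<^sup>2 * Z)" using Z by (simp add: power2_eq_square field_simps)
    finally show ?thesis by simp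
  qed
  moreover have "4 * a * (2 * c * m - c\<^sup>2 * Z) \<le> 4 * a * (m\<^sup>2 / Z)"
    using sq[of c m] a by (intro mult_left_mono) auto
  moreover have "4 * a * d * n - d\<^sup>2 * Z \<le> (2 * a * n)\<^sup>2 / Z"
    using sq[of d "2 * a * n"] by (simp add: algebra_simps)
  moreover have "(2 * a * n)\<^sup>2 / Z = 4 * a\<^sup>2 * n\<^sup>2 / Z" by (simp add: power_mult_distrib)
  ultimately have "0 \<le> E - 4 * a * S + 4 * a * (m\<^sup>2 / Z) + 4 * a\<^sup>2 * n\<^sup>2 / Z" by linarith
  then show ?thesis by (simp add: Z_def m_def n_def S_def E_def)
qed

end

text \<open>With \<open>v t = h t * exp (a * t^2 / 2)\<close>, the left integrand differs from
  \<open>(v' t)^2 * rho a b t / a\<close> by the derivative of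
  \<open>t * (v t)^2 * rho a b t\<close>. This primitive vanishes at both ends: by compact support
  at infinity, and by the factor \<open>t\<close> at 0 when \<open>b > 0\<close>. The constant
  \<open>1 + b\<close> is the share of one coordinate in \<open>homdim\<close>, and
  \<open>exp (a * t^2)\<close> cancels the Gaussian in \<open>rho\<close>.\<close>

lemma energy_identity:
  fixes h h' :: "real \<Rightarrow> real"
  assumes a: "a > 0" and b: "b \<ge> 0"
    and h: "\<And>t. (h has_real_derivative h' t) (at t)" and h': "\<And>t. isCont h' t"
    and hsupp: "\<And>t. \<bar>t\<bar> > R \<Longrightarrow> h t = 0"
  shows "(\<integral>t. ((h' t)\<^sup>2 / a + a * t\<^sup>2 * (h t)\<^sup>2 - (1 + b) * (h t)\<^sup>2) * exp (a * t\<^sup>2) * rho a b t \<partial>lborel)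
    = (\<integral>t. ((h' t + a * t * h t) * exp (a * t\<^sup>2 / 2))\<^sup>2 * rho a b t \<partial>lborel) / a"
proof -
  define v where "v t = h t * exp (a * t\<^sup>2 / 2)" for t
  define v' where "v' t = (h' t + a * t * h t) * exp (a * t\<^sup>2 / 2)" for t
  have ch: "isCont h t" for t using h DERIV_isCont by blast
  interpret test_function_1d a b R v v'
  proof
    show "(v has_real_derivative v' t) (at t)" for t
      unfolding v_def v'_def by (auto intro!: derivative_eq_intros h simp: algebra_simps)
    show "isCont v' t" for t
      unfolding v'_def by (intro continuous_intros h' ch) simp
  qed (use a b hsupp in \<open>auto simp: v_def\<close>)
  define F' where "F' t = ((1 + b - 2 * a * t\<^sup>2) * (v t)\<^sup>2 + 2 * t * v t * v' t) * rho a b t" for t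
  have intF: "integrable lborel F'"
    unfolding F'_def
    by (rule integrable_rho_compact_support[OF a b, of _ R])
      ((intro continuous_intros isCont_v v')?; simp add: supp)+
  have "(LBINT t=half_start b..\<infinity>. F' t) = 0 - 0"
  proof (rule interval_integral_FTC_integrable[OF half_start_less])
    fix t assume "half_start b < ereal t" "ereal t < \<infinity>"
    then have t: "t \<in> half b" unfolding einterval_half_start[symmetric] by (simp add: einterval_def)
    show "((\<lambda>t. (v t)\<^sup>2 * (t * rho a b t)) has_vector_derivative F' t) (at t)"
    proof -
      have "t * (b / t) = b" using t b by (cases "t = 0") (auto simp: half_def split: if_splits)
      then have tb: "t * (b / t - 2 * a * t) = b - 2 * a * t\<^sup>2"
        by (simp add: right_diff_distrib power2_eq_square)
      have 1: "((\<lambda>t. (v t)\<^sup>2 * t) has_real_derivative 2 * v t * v' t * t + (v t)\<^sup>2) (at t)"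
        using test_function_1d.v[OF test_function_1d_axioms] by (auto intro!: derivative_eq_intros)
      have "(2 * v t * v' t * t + (v t)\<^sup>2) * rho a b t + (b / t - 2 * a * t) * rho a b t * ((v t)\<^sup>2 * t)
        = (2 * v t * v' t * t + (v t)\<^sup>2) * rho a b t + (t * (b / t - 2 * a * t)) * rho a b t * (v t)\<^sup>2"
        by simp
      also have "\<dots> = F' t" unfolding tb F'_def by (simp add: algebra_simps)
      finally show ?thesis
        using DERIV_mult[OF 1 has_real_derivative_rho[OF b t, of a]]
        by (simp add: has_real_derivative_iff_has_vector_derivative[symmetric] mult.assoc)
    qed
    show "isCont F' t"
      unfolding F'_def by (intro continuous_intros v' isCont_v isCont_rho b t)
  next
    have "\<forall>\<^sub>F t in at_top. (v t)\<^sup>2 * (t * rho a b t) = 0"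
      using eventually_gt_at_top[of R] by eventually_elim (simp add: supp)
    then show "(((\<lambda>t. (v t)\<^sup>2 * (t * rho a b t)) \<circ> real_of_ereal) \<longlongrightarrow> 0) (at_left \<infinity>)"
      unfolding ereal_tendsto_simps by (rule tendsto_eventually)
    show "(((\<lambda>t. (v t)\<^sup>2 * (t * rho a b t)) \<circ> real_of_ereal) \<longlongrightarrow> 0) (at_right (half_start b))"
    proof (cases "b = 0")
      case True
      have "\<forall>\<^sub>F t in at_bot. (v t)\<^sup>2 * (t * rho a b t) = 0"
        using eventually_gt_at_bot[of "-R"]
        by eventually_elim (simp add: supp)
      then show ?thesis using True unfolding half_start_def
        by (simp add: ereal_tendsto_simps tendsto_eventually)
    next
      case False
      then have bpos: "b > 0" using b by simp
      have "(v \<longlongrightarrow> v 0) (at_right 0)" using isCont_v[of 0] by (simp add: isCont_def filterlim_at_split)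
      then have "((\<lambda>t. (v t)\<^sup>2 * (t * rho a b t)) \<longlongrightarrow> (v 0)\<^sup>2 * 0) (at_right 0)"
        by (intro tendsto_intros tendsto_rho_boundary_zero a bpos)
      then show ?thesis using bpos by (simp add: half_start_def zero_ereal_def ereal_tendsto_simps)
    qed
  qed (use intF interval_integrable_of_integrable in auto)
  then have F0: "(\<integral>t. F' t \<partial>lborel) = 0"
    using interval_integral_rho[of b] by (simp add: F'_def)
  have "((h' t)\<^sup>2 / a + a * t\<^sup>2 * (h t)\<^sup>2 - (1 + b) * (h t)\<^sup>2) * exp (a * t\<^sup>2) * rho a b t
    = (v' t)\<^sup>2 * rho a b t / a - F' t" for t
  proof -
    have "exp (a * t\<^sup>2) = (exp (a * t\<^sup>2 / 2))\<^sup>2" by (simp add: power2_eq_square exp_add[symmetric])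
    then show ?thesis
      unfolding F'_def v_def v'_def using a by (simp add: field_simps power2_eq_square)
  qed
  then have "(\<integral>t. ((h' t)\<^sup>2 / a + a * t\<^sup>2 * (h t)\<^sup>2 - (1 + b) * (h t)\<^sup>2) * exp (a * t\<^sup>2) * rho a b t \<partial>lborel)
    = (\<integral>t. (v' t)\<^sup>2 * rho a b t / a - F' t \<partial>lborel)" by simp
  also have "\<dots> = (\<integral>t. (v' t)\<^sup>2 * rho a b t \<partial>lborel) / a"
    using integrable_v(5) intF F0 by simp
  finally show ?thesis by (simp add: v'_def)
qed

section \<open>Normalised one-dimensional measures and their affine mode\<close>

definition gauss_meas :: "real \<Rightarrow> real \<Rightarrow> real measure" where
  "gauss_meas a b = density lborel (\<lambda>t. ennreal (rho a b t / (\<integral>s. rho a b s \<partial>lborel)))"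

definition gauss_mean :: "real \<Rightarrow> real \<Rightarrow> real" where
  "gauss_mean a b = (\<integral>t. t \<partial>gauss_meas a b)"

definition gauss_var :: "real \<Rightarrow> real \<Rightarrow> real" where
  "gauss_var a b = (\<integral>t. (t - gauss_mean a b)\<^sup>2 \<partial>gauss_meas a b)"

text \<open>For \<open>b > 0\<close> the mean is not 0 and this is not an eigenfunction. It serves
  to span, together with 1, the affine functions by an orthonormal pair; for \<open>b = 0\<close> it
  is the linear eigenfunction \<open>sqrt (2 a) t\<close>.\<close>

definition gauss_mode :: "real \<Rightarrow> real \<Rightarrow> real \<Rightarrow> real" where
  "gauss_mode a b t = (t - gauss_mean a b) / sqrt (gauss_var a b)"

lemma sets_gauss_meas [measurable_cong, simp]: "sets (gauss_meas a b) = sets borel"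
  by (simp add: gauss_meas_def)

lemma space_gauss_meas [simp]: "space (gauss_meas a b) = UNIV"
  by (simp add: gauss_meas_def)

lemma integral_gauss_meas:
  fixes g :: "real \<Rightarrow> real"
  assumes "a > 0" "b \<ge> 0" "g \<in> borel_measurable borel"
  shows "(\<integral>t. g t \<partial>gauss_meas a b) = (\<integral>t. g t * rho a b t \<partial>lborel) / (\<integral>t. rho a b t \<partial>lborel)"
  unfolding gauss_meas_def using assms integral_rho_pos[OF assms(1,2)]
  by (subst integral_density) (auto simp: rho_nonneg mult.commute)

lemma integrable_gauss_meas:
  fixes g :: "real \<Rightarrow> real"
  assumes "a > 0" "b \<ge> 0" "g \<in> borel_measurable borel" "integrable lborel (\<lambda>t. g t * rho a b t)"
  shows "integrable (gauss_meas a b) g"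
proof -
  have "integrable lborel (\<lambda>t. (g t * rho a b t) / (\<integral>t. rho a b t \<partial>lborel))" using assms(4) by simp
  then show ?thesis
    unfolding gauss_meas_def using assms integral_rho_pos[OF assms(1,2)]
    by (subst integrable_density) (auto simp: rho_nonneg mult.commute)
qed

lemma prob_space_gauss_meas:
  assumes "a > 0" "b \<ge> 0"
  shows "prob_space (gauss_meas a b)"
proof
  have Z: "0 < (\<integral>s. rho a b s \<partial>lborel)" by (rule integral_rho_pos[OF assms])
  have int: "integrable lborel (\<lambda>t. rho a b t / (\<integral>s. rho a b s \<partial>lborel))"
    using integrable_rho_moment[OF assms, of 0] by simp
  have "emeasure (gauss_meas a b) UNIV = (\<integral>\<^sup>+t. ennreal (rho a b t / (\<integral>s. rho a b s \<partial>lborel)) \<partial>lborel)"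
    unfolding gauss_meas_def by (subst emeasure_density) auto
  also have "\<dots> = ennreal (\<integral>t. rho a b t / (\<integral>s. rho a b s \<partial>lborel) \<partial>lborel)"
    using Z by (intro nn_integral_eq_integral int) (simp add: rho_nonneg)
  also have "\<dots> = 1" using Z by simp
  finally show "emeasure (gauss_meas a b) (space (gauss_meas a b)) = 1" by simp
qed

lemma standardized_gauss_mode:
  assumes "a > 0" "b \<ge> 0"
  shows "standardized (gauss_meas a b) (gauss_mode a b)"
proof -
  interpret prob_space "gauss_meas a b" by (rule prob_space_gauss_meas[OF assms])
  have it: "integrable (gauss_meas a b) (\<lambda>t. t)"
    by (intro integrable_gauss_meas assms integrable_rho_bounded[of _ _ _ 1 1]) auto
  have it2: "integrable (gauss_meas a b) (\<lambda>t. t\<^sup>2)"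
    by (intro integrable_gauss_meas assms integrable_rho_bounded[of _ _ _ 1 2]) auto
  define m where "m = gauss_mean a b"
  have st: "square_integrable (gauss_meas a b) (\<lambda>t. t - m)"
    by (intro square_integrable_diff square_integrable_const) (use it2 in \<open>simp add: square_integrable_def\<close>)
  have "gauss_var a b = (\<integral>t. (t - m)\<^sup>2 * rho a b t \<partial>lborel) / (\<integral>t. rho a b t \<partial>lborel)"
    unfolding gauss_var_def m_def by (rule integral_gauss_meas[OF assms]) simp
  moreover have "0 < (\<integral>t. (t - m)\<^sup>2 * rho a b t \<partial>lborel)"
  proof (rule integral_rho_weight_pos[OF assms(2)])
    have "integrable lborel (\<lambda>t. t\<^sup>2 * rho a b t - 2 * m * (t * rho a b t) + m\<^sup>2 * rho a b t)"
    proof (intro Bochner_Integration.integrable_add Bochner_Integration.integrable_diff integrable_mult_right)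
      show "integrable lborel (\<lambda>t. t\<^sup>2 * rho a b t)" "integrable lborel (rho a b)"
        using integrable_rho_moment[OF assms, of 2] integrable_rho_moment[OF assms, of 0] by simp_all
      show "integrable lborel (\<lambda>t. t * rho a b t)"
        by (rule integrable_rho_bounded[OF assms, of _ 1 1]) auto
    qed
    then show "integrable lborel (\<lambda>t. (t - m)\<^sup>2 * rho a b t)"
      by (simp add: power2_diff algebra_simps)
  qed auto
  ultimately have var: "gauss_var a b > 0" using integral_rho_pos[OF assms] by simp
  have "square_integrable (gauss_meas a b) (gauss_mode a b)"
    using square_integrable_cmult[OF st, of "1 / sqrt (gauss_var a b)"]
    by (simp add: gauss_mode_def[abs_def] m_def)
  moreover have "(\<integral>t. gauss_mode a b t \<partial>gauss_meas a b) = 0"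
    unfolding gauss_mode_def using it prob_space by (simp add: gauss_mean_def)
  moreover have "(\<integral>t. (gauss_mode a b t)\<^sup>2 \<partial>gauss_meas a b) = 1"
    unfolding gauss_mode_def power_divide using var by (simp add: gauss_var_def[symmetric])
  ultimately show ?thesis by (simp add: standardized_def)
qed

text \<open>Division by \<open>a * Z\<close> turns the spectral value \<open>4 * a\<close> into 4.
  On the line the linear mode costs the energy 2, which accounts for the coefficient 2 of its
  squared projection in \<open>gap_form\<close>. On the half-line the gap is already 4 above the
  constants, more than \<open>gap_form\<close> demands.\<close>

theorem gap_form_gauss:
  fixes h h' :: "real \<Rightarrow> real"
  assumes a: "a > 0" and b: "b \<ge> 0"
    and h: "\<And>t. (h has_real_derivative h' t) (at t)" and h': "\<And>t. isCont h' t"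
    and hsupp: "\<And>t. \<bar>t\<bar> > R \<Longrightarrow> h t = 0"
  shows "gap_form (gauss_meas a b) (gauss_mode a b) (\<lambda>t. h t * exp (a * t\<^sup>2 / 2))
    \<le> (\<integral>t. ((h' t)\<^sup>2 / a + a * t\<^sup>2 * (h t)\<^sup>2 - (1 + b) * (h t)\<^sup>2) * exp (a * t\<^sup>2) \<partial>gauss_meas a b)"
proof -
  define v where "v t = h t * exp (a * t\<^sup>2 / 2)" for t
  define v' where "v' t = (h' t + a * t * h t) * exp (a * t\<^sup>2 / 2)" for t
  have ch: "isCont h t" for t using h DERIV_isCont by blast
  interpret test_function_1d a b R v v'
  proof
    show "(v has_real_derivative v' t) (at t)" for t
      unfolding v_def v'_def by (auto intro!: derivative_eq_intros h simp: algebra_simps)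
    show "isCont v' t" for t
      unfolding v'_def by (intro continuous_intros h' ch) simp
  qed (use a b hsupp in \<open>auto simp: v_def\<close>)
  have [measurable]: "h \<in> borel_measurable borel" "h' \<in> borel_measurable borel"
    using ch h' by (auto intro!: borel_measurable_continuous_onI continuous_at_imp_continuous_on)
  have [measurable]: "v \<in> borel_measurable borel" unfolding v_def by measurable
  have [measurable]: "gauss_mode a b \<in> borel_measurable borel"
    unfolding gauss_mode_def by measurable
  define Z where "Z = (\<integral>t. rho a b t \<partial>lborel)"
  define m n S E where "m = (\<integral>t. v t * rho a b t \<partial>lborel)"
    and "n = (\<integral>t. v t * gauss_mode a b t * rho a b t \<partial>lborel)"
    and "S = (\<integral>t. (v t)\<^sup>2 * rho a b t \<partial>lborel)" and "E = (\<integral>t. (v' t)\<^sup>2 * rho a b t \<partial>lborel)"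
  have Z: "Z > 0" unfolding Z_def by (rule integral_rho_pos[OF a b])
  have "gap_form (gauss_meas a b) (gauss_mode a b) v = 4 * (S / Z) - 4 * (m / Z)\<^sup>2 - 2 * (n / Z)\<^sup>2"
    unfolding gap_form_def m_def n_def S_def Z_def
    by (subst (1 2 3) integral_gauss_meas[OF a b]) auto
  moreover have "(\<integral>t. ((h' t)\<^sup>2 / a + a * t\<^sup>2 * (h t)\<^sup>2 - (1 + b) * (h t)\<^sup>2) * exp (a * t\<^sup>2) \<partial>gauss_meas a b)
    = E / a / Z"
    using energy_identity[OF a b h h' hsupp, of R]
    by (subst integral_gauss_meas[OF a b]) (auto simp: Z_def E_def v'_def)
  moreover have "4 * (S / Z) - 4 * (m / Z)\<^sup>2 - 2 * (n / Z)\<^sup>2 \<le> E / a / Z"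
  proof (cases "b = 0")
    case False
    with b have "b > 0" by simp
    from poincare_half_line[OF this] have "4 * a * S - 4 * a * m\<^sup>2 / Z \<le> E"
      by (simp add: S_def m_def Z_def E_def)
    then have "(4 * a * S - 4 * a * m\<^sup>2 / Z) / (a * Z) \<le> E / (a * Z)"
      using a Z by (intro divide_right_mono) auto
    moreover have "(4 * a * S - 4 * a * m\<^sup>2 / Z) / (a * Z) = 4 * (S / Z) - 4 * (m / Z)\<^sup>2"
      using a Z by (simp add: field_simps power2_eq_square)
    \<comment> \<open>The half-line estimate contains no affine mode; subtracting its squared
      coefficient only lowers the left side.\<close>
    ultimately show ?thesis by simp (smt (verit) zero_le_power2)
  next
    case True
    have mean: "gauss_mean a b = 0"
      unfolding gauss_mean_def using line_moments(1)[OF True] integral_gauss_meas[OF a b, of "\<lambda>t. t"] by simp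
    have var: "gauss_var a b = 1 / (2 * a)"
    proof -
      have "gauss_var a b = (\<integral>t. t\<^sup>2 * rho a b t \<partial>lborel) / Z"
        unfolding gauss_var_def mean Z_def using integral_gauss_meas[OF a b, of "\<lambda>t. t\<^sup>2"] by simp
      moreover have "(\<integral>t. t\<^sup>2 * rho a b t \<partial>lborel) = Z / (2 * a)"
        using line_moments(2)[OF True, folded Z_def] a by (simp add: field_simps)
      ultimately show ?thesis using Z by simp
    qed
    define N where "N = (\<integral>t. t * v t * rho a b t \<partial>lborel)"
    have "n = N / sqrt (1 / (2 * a))"
      unfolding n_def gauss_mode_def mean var N_def by (simp add: mult.commute)
    \<comment> \<open>Standardising \<open>t\<close> by the variance \<open>1 / (2 * a)\<close>
      converts the term \<open>4 * a^2 * N^2\<close> of \<open>poincare_line\<close> into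
      \<open>2 * a * n^2\<close>.\<close>
    then have n2: "n\<^sup>2 = 2 * a * N\<^sup>2" using a by (simp add: power_divide real_sqrt_pow2)
    from poincare_line[OF True] have "4 * a * S - 4 * a * m\<^sup>2 / Z - 4 * a\<^sup>2 * N\<^sup>2 / Z \<le> E"
      by (simp add: S_def m_def Z_def E_def N_def)
    then have "(4 * a * S - 4 * a * m\<^sup>2 / Z - 4 * a\<^sup>2 * N\<^sup>2 / Z) / (a * Z) \<le> E / (a * Z)"
      using a Z by (intro divide_right_mono) auto
    moreover have "(4 * a * S - 4 * a * m\<^sup>2 / Z - 4 * a\<^sup>2 * N\<^sup>2 / Z) / (a * Z)
      = 4 * (S / Z) - 4 * (m / Z)\<^sup>2 - 2 * (n / Z)\<^sup>2"
      unfolding power_divide n2 using a Z by (simp add: field_simps power2_eq_square)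
    ultimately show ?thesis by simp
  qed
  ultimately show ?thesis unfolding v_def[abs_def] by simp
qed

section \<open>Product Gaussian weights\<close>

lemma Basis_vec_real: "(Basis :: (real^'n::finite) set) = (\<lambda>i. axis i 1) ` UNIV"
  by (auto simp: Basis_vec_def)

lemma measurable_vec_lambda:
  "(\<lambda>w. \<chi> i. w i) \<in> measurable (PiM (UNIV :: 'n::finite set) (\<lambda>_. borel :: real measure)) (borel :: (real^'n) measure)"
proof (rule borel_measurable_euclidean_space[THEN iffD2], rule ballI)
  fix b :: "real^'n" assume "b \<in> Basis"
  then obtain i where b: "b = axis i 1" unfolding Basis_vec_real by auto
  show "(\<lambda>w. (\<chi> i. w i) \<bullet> b) \<in> borel_measurable (PiM (UNIV :: 'n set) (\<lambda>_. borel :: real measure))"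
    unfolding b by (simp add: inner_axis)
qed

lemma lborel_eq_distr_PiM:
  "(lborel :: (real^'n::finite) measure) = distr (PiM UNIV (\<lambda>_. lborel)) borel (\<lambda>w. \<chi> i. w i)"
proof (rule lborel_eqI)
  interpret product_sigma_finite "\<lambda>_::'n. lborel :: real measure" ..
  fix l u :: "real^'n" assume le: "\<And>b. b \<in> Basis \<Longrightarrow> l \<bullet> b \<le> u \<bullet> b"
  have le': "l $ i \<le> u $ i" for i using le[of "axis i 1"] by (simp add: Basis_vec_real inner_axis)
  have m: "(\<lambda>w. \<chi> i. w i) \<in> measurable (PiM UNIV (\<lambda>_. lborel)) (borel :: (real^'n) measure)"
    using measurable_vec_lambda by (simp cong: measurable_cong_sets sets_PiM_cong)
  have "(\<lambda>w. \<chi> i. w i) -` box l u \<inter> space (PiM UNIV (\<lambda>_. lborel)) = (\<Pi>\<^sub>E i\<in>UNIV. {l $ i<..<u $ i})"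
    by (auto simp: space_PiM mem_box Basis_vec_real inner_axis PiE_def Pi_def)
  then have "emeasure (distr (PiM UNIV (\<lambda>_. lborel)) borel (\<lambda>w. \<chi> i. w i)) (box l u)
    = emeasure (PiM UNIV (\<lambda>_. lborel)) (\<Pi>\<^sub>E i\<in>UNIV. {l $ i<..<u $ i})"
    using m by (simp add: emeasure_distr)
  also have "\<dots> = (\<Prod>i\<in>UNIV. ennreal (u $ i - l $ i))"
    by (subst emeasure_PiM) (auto simp: le')
  also have "\<dots> = ennreal (\<Prod>b\<in>Basis. (u - l) \<bullet> b)"
    unfolding Basis_vec_real
    by (subst prod.reindex) (auto simp: inj_on_def axis_eq_axis inner_axis prod_ennreal le')
  finally show "emeasure (distr (PiM UNIV (\<lambda>_. lborel)) borel (\<lambda>w. \<chi> i. w i)) (box l u)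
    = (\<Prod>b\<in>Basis. (u - l) \<bullet> b)" .
qed simp

text \<open>It suffices to compare the two measures on rectangles, where the integral of a product
  of one-variable functions factorises.\<close>

lemma PiM_density:
  fixes M :: "'i \<Rightarrow> 'a measure" and r :: "'i \<Rightarrow> 'a \<Rightarrow> ennreal"
  assumes "finite I" and r[measurable]: "\<And>i. r i \<in> borel_measurable (M i)"
    and sf: "\<And>i. sigma_finite_measure (M i)" "\<And>i. sigma_finite_measure (density (M i) (r i))"
  shows "density (PiM I M) (\<lambda>w. \<Prod>i\<in>I. r i (w i)) = PiM I (\<lambda>i. density (M i) (r i))"
proof -
  interpret M: product_sigma_finite M using sf(1) by (rule product_sigma_finite.intro)
  interpret D: product_sigma_finite "\<lambda>i. density (M i) (r i)"
    using sf(2) by (rule product_sigma_finite.intro)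
  show ?thesis
  proof (rule D.PiM_eqI[OF assms(1)])
    show "sets (density (PiM I M) (\<lambda>w. \<Prod>i\<in>I. r i (w i))) = sets (PiM I (\<lambda>i. density (M i) (r i)))"
      by (simp cong: sets_PiM_cong)
    fix A assume "\<And>i. i \<in> I \<Longrightarrow> A i \<in> sets (density (M i) (r i))"
    then have A[measurable]: "\<And>i. i \<in> I \<Longrightarrow> A i \<in> sets (M i)" by simp
    have "emeasure (density (PiM I M) (\<lambda>w. \<Prod>i\<in>I. r i (w i))) (Pi\<^sub>E I A)
      = (\<integral>\<^sup>+w. (\<Prod>i\<in>I. r i (w i)) * indicator (Pi\<^sub>E I A) w \<partial>PiM I M)"
      using assms(1) by (intro emeasure_density) (auto intro!: sets_PiM_I_finite)
    also have "\<dots> = (\<integral>\<^sup>+w. (\<Prod>i\<in>I. r i (w i) * indicator (A i) (w i)) \<partial>PiM I M)"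
    proof (rule nn_integral_cong)
      fix w assume w: "w \<in> space (PiM I M)"
      have "(indicator (Pi\<^sub>E I A) w :: ennreal) = (\<Prod>i\<in>I. indicator (A i) (w i))"
      proof (cases "w \<in> Pi\<^sub>E I A")
        case False
        then obtain i where "i \<in> I" "w i \<notin> A i" using w by (auto simp: space_PiM PiE_def)
        then show ?thesis using False assms(1) by (auto simp: indicator_def)
      qed (auto simp: PiE_def Pi_def)
      then show "(\<Prod>i\<in>I. r i (w i)) * indicator (Pi\<^sub>E I A) w = (\<Prod>i\<in>I. r i (w i) * indicator (A i) (w i))"
        by (simp add: prod.distrib)
    qed
    also have "\<dots> = (\<Prod>i\<in>I. \<integral>\<^sup>+x. r i x * indicator (A i) x \<partial>M i)"
      by (intro M.product_nn_integral_prod assms(1)) measurable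
    also have "\<dots> = (\<Prod>i\<in>I. emeasure (density (M i) (r i)) (A i))"
      by (intro prod.cong refl) (simp add: emeasure_density)
    finally show "emeasure (density (PiM I M) (\<lambda>w. \<Prod>i\<in>I. r i (w i))) (Pi\<^sub>E I A)
      = (\<Prod>i\<in>I. emeasure (density (M i) (r i)) (A i))" .
  qed
qed

definition wmeas :: "real^'n::finite \<Rightarrow> (real^'n) measure" where
  "wmeas \<alpha> = density lborel (\<lambda>x. ennreal (indicator (RNs \<alpha>) x * xA \<alpha> x))"

text \<open>Tensorization takes place on a product of measures over functions, the inequality on
  vectors; this image measure connects the two.\<close>

definition gaussN :: "real \<Rightarrow> real^'n::finite \<Rightarrow> (real^'n) measure" where
  "gaussN a \<alpha> = distr (PiM UNIV (\<lambda>i. gauss_meas a (\<alpha> $ i))) borel (\<lambda>w. \<chi> i. w i)"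

definition gauss_mass :: "real \<Rightarrow> real^'n::finite \<Rightarrow> real" where
  "gauss_mass a \<alpha> = (\<Prod>i\<in>UNIV. \<integral>t. rho a (\<alpha> $ i) t \<partial>lborel)"

lemma sets_wmeas [measurable_cong, simp]: "sets (wmeas \<alpha>) = sets borel"
  by (simp add: wmeas_def)

lemma space_wmeas [simp]: "space (wmeas \<alpha>) = UNIV"
  by (simp add: wmeas_def)

lemma xA_nonneg: "0 \<le> xA \<alpha> x"
  by (auto simp: xA_def intro!: prod_nonneg)

lemma RNs_measurable [measurable]: "RNs \<alpha> \<in> sets borel"
  unfolding RNs_def by measurable

lemma xA_measurable [measurable]: "xA \<alpha> \<in> borel_measurable borel"
  unfolding xA_def by measurable

lemma prod_rho:
  assumes "\<And>i. \<alpha> $ i \<ge> 0"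
  shows "(\<Prod>i\<in>UNIV. rho a (\<alpha> $ i) (x $ i)) = indicator (RNs \<alpha>) x * xA \<alpha> x * exp (- a * (norm x)\<^sup>2)"
proof -
  have "(\<Prod>i\<in>UNIV. indicator (half (\<alpha> $ i)) (x $ i) :: real) = indicator (RNs \<alpha>) x"
  proof (cases "x \<in> RNs \<alpha>")
    case False
    then obtain i where "\<alpha> $ i > 0" "\<not> x $ i > 0" by (auto simp: RNs_def)
    then have "indicator (half (\<alpha> $ i)) (x $ i) = (0 :: real)" by (simp add: half_def)
    then have "\<exists>i\<in>UNIV. indicator (half (\<alpha> $ i)) (x $ i) = (0 :: real)" by blast
    then show ?thesis using False by (simp add: prod_zero)
  qed (auto simp: RNs_def half_def intro!: prod.neutral)
  moreover have "(\<Prod>i\<in>UNIV. wt (\<alpha> $ i) (x $ i)) = xA \<alpha> x" by (simp add: xA_def wt_def)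
  moreover have "(\<Prod>i\<in>UNIV. exp (- a * (x $ i)\<^sup>2)) = exp (- a * (norm x)\<^sup>2)"
    by (simp add: exp_sum[symmetric] norm_vec_def L2_set_def sum_nonneg sum_distrib_left sum_negf)
  ultimately show ?thesis by (simp add: rho_def prod.distrib)
qed

lemma gauss_mass_pos:
  assumes "a > 0" "\<And>i. \<alpha> $ i \<ge> 0"
  shows "0 < gauss_mass a \<alpha>"
  unfolding gauss_mass_def using integral_rho_pos assms by (intro prod_pos) auto

lemma gaussN_eq:
  fixes \<alpha> :: "real^'n::finite"
  assumes a: "a > 0" and \<alpha>: "\<And>i. \<alpha> $ i \<ge> 0"
  shows "gaussN a \<alpha> = density (wmeas \<alpha>) (\<lambda>x. ennreal (exp (- a * (norm x)\<^sup>2) / gauss_mass a \<alpha>))"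
proof -
  define r where "r i t = ennreal (rho a (\<alpha> $ i) t / (\<integral>s. rho a (\<alpha> $ i) s \<partial>lborel))" for i t
  have [measurable]: "r i \<in> borel_measurable borel" for i unfolding r_def by measurable
  have gm: "gauss_meas a (\<alpha> $ i) = density lborel (r i)" for i
    by (simp add: gauss_meas_def r_def[abs_def])
  have sf: "sigma_finite_measure (density lborel (r i))" for i
    unfolding gm[symmetric] using prob_space_gauss_meas[OF a \<alpha>] by (rule prob_space_imp_sigma_finite)
  have m: "(\<lambda>w. \<chi> i. w i) \<in> measurable (PiM UNIV (\<lambda>_. lborel)) (borel :: (real^'n) measure)"
    using measurable_vec_lambda by (simp cong: measurable_cong_sets sets_PiM_cong)
  define q where "q x = (\<Prod>i\<in>UNIV. r i (x $ i))" for x :: "real^'n"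
  have [measurable]: "q \<in> borel_measurable borel" unfolding q_def by measurable
  have q: "q x = ennreal (indicator (RNs \<alpha>) x * xA \<alpha> x) * ennreal (exp (- a * (norm x)\<^sup>2) / gauss_mass a \<alpha>)" for x
  proof -
    have "q x = ennreal (\<Prod>i\<in>UNIV. rho a (\<alpha> $ i) (x $ i) / (\<integral>s. rho a (\<alpha> $ i) s \<partial>lborel))"
      unfolding q_def r_def
      by (rule prod_ennreal) (simp add: rho_nonneg integral_rho_pos[OF a \<alpha>] less_imp_le)
    also have "(\<Prod>i\<in>UNIV. rho a (\<alpha> $ i) (x $ i) / (\<integral>s. rho a (\<alpha> $ i) s \<partial>lborel))
      = (indicator (RNs \<alpha>) x * xA \<alpha> x) * (exp (- a * (norm x)\<^sup>2) / gauss_mass a \<alpha>)"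
      by (simp add: prod_dividef prod_rho[OF \<alpha>] gauss_mass_def)
    finally show ?thesis
      using gauss_mass_pos[OF a \<alpha>]
      by (simp only:) (rule ennreal_mult, simp_all add: xA_nonneg less_imp_le)
  qed
  have "gaussN a \<alpha> = distr (density (PiM UNIV (\<lambda>_. lborel)) (\<lambda>w. \<Prod>i\<in>UNIV. r i (w i))) borel (\<lambda>w. \<chi> i. w i)"
    unfolding gaussN_def gm
    by (subst PiM_density) (auto intro: sf sigma_finite_lborel)
  also have "\<dots> = density (distr (PiM UNIV (\<lambda>_. lborel)) borel (\<lambda>w. \<chi> i. w i)) q"
    by (subst density_distr[OF _ m]) (simp_all add: q_def)
  also have "\<dots> = density lborel q" by (simp add: lborel_eq_distr_PiM[symmetric])
  also have "\<dots> = density (wmeas \<alpha>) (\<lambda>x. ennreal (exp (- a * (norm x)\<^sup>2) / gauss_mass a \<alpha>))"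
    unfolding wmeas_def by (subst density_density_eq) (simp_all add: q[abs_def])
  finally show ?thesis .
qed

lemma integral_gaussN:
  fixes F :: "real^'n::finite \<Rightarrow> real"
  assumes a: "a > 0" and \<alpha>: "\<And>i. \<alpha> $ i \<ge> 0" and [measurable]: "F \<in> borel_measurable borel"
  shows "(\<integral>w. F (\<chi> i. w i) \<partial>PiM UNIV (\<lambda>i. gauss_meas a (\<alpha> $ i)))
      = (\<integral>x. F x * exp (- a * (norm x)\<^sup>2) \<partial>wmeas \<alpha>) / gauss_mass a \<alpha>"
    and "integrable (PiM UNIV (\<lambda>i. gauss_meas a (\<alpha> $ i))) (\<lambda>w. F (\<chi> i. w i))
      \<longleftrightarrow> integrable (wmeas \<alpha>) (\<lambda>x. F x * exp (- a * (norm x)\<^sup>2))"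
proof -
  have m: "(\<lambda>w. \<chi> i. w i) \<in> measurable (PiM UNIV (\<lambda>i. gauss_meas a (\<alpha> $ i))) (borel :: (real^'n) measure)"
    using measurable_vec_lambda by (simp cong: measurable_cong_sets sets_PiM_cong)
  have Z: "gauss_mass a \<alpha> > 0" by (rule gauss_mass_pos[OF a \<alpha>])
  have "(\<integral>w. F (\<chi> i. w i) \<partial>PiM UNIV (\<lambda>i. gauss_meas a (\<alpha> $ i))) = (\<integral>x. F x \<partial>gaussN a \<alpha>)"
    unfolding gaussN_def by (subst integral_distr[OF m]) simp_all
  also have "\<dots> = (\<integral>x. F x * exp (- a * (norm x)\<^sup>2) \<partial>wmeas \<alpha>) / gauss_mass a \<alpha>"
    unfolding gaussN_eq[OF a \<alpha>] using Z by (subst integral_density) (auto simp: mult.commute)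
  finally show "(\<integral>w. F (\<chi> i. w i) \<partial>PiM UNIV (\<lambda>i. gauss_meas a (\<alpha> $ i)))
      = (\<integral>x. F x * exp (- a * (norm x)\<^sup>2) \<partial>wmeas \<alpha>) / gauss_mass a \<alpha>" .
  have "integrable (PiM UNIV (\<lambda>i. gauss_meas a (\<alpha> $ i))) (\<lambda>w. F (\<chi> i. w i)) \<longleftrightarrow> integrable (gaussN a \<alpha>) F"
    unfolding gaussN_def by (subst integrable_distr_eq[OF m]) simp_all
  also have "\<dots> \<longleftrightarrow> integrable (wmeas \<alpha>) (\<lambda>x. F x * exp (- a * (norm x)\<^sup>2) / gauss_mass a \<alpha>)"
    unfolding gaussN_eq[OF a \<alpha>] using Z by (subst integrable_density) (auto simp: mult.commute)
  also have "\<dots> \<longleftrightarrow> integrable (wmeas \<alpha>) (\<lambda>x. F x * exp (- a * (norm x)\<^sup>2))"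
    using Z integrable_mult_left_iff[of "wmeas \<alpha>" "1 / gauss_mass a \<alpha>" "\<lambda>x. F x * exp (- a * (norm x)\<^sup>2)"] by simp
  finally show "integrable (PiM UNIV (\<lambda>i. gauss_meas a (\<alpha> $ i))) (\<lambda>w. F (\<chi> i. w i))
      \<longleftrightarrow> integrable (wmeas \<alpha>) (\<lambda>x. F x * exp (- a * (norm x)\<^sup>2))" .
qed

text \<open>The class in which the inequality at a fixed scale is proved. It contains the members of
  \<open>Nstar\<close> and is closed under differences, to which the uncertainty principle is
  applied in \<open>L2_limit\<close>.\<close>

definition C1_compact :: "(real^'n::finite \<Rightarrow> real) \<Rightarrow> bool" where
  "C1_compact \<phi> \<longleftrightarrow> (\<forall>x. \<phi> differentiable (at x)) \<and> (\<forall>i. continuous_on UNIV (partial i \<phi>)) \<and>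
     (\<exists>R. \<forall>x. norm x > R \<longrightarrow> \<phi> x = 0)"

lemma C1_compact_continuous: "C1_compact \<phi> \<Longrightarrow> continuous_on UNIV \<phi>"
  by (auto simp: C1_compact_def intro!: continuous_at_imp_continuous_on differentiable_imp_continuous_within)

lemma has_derivative_partial:
  fixes \<phi> :: "real^'n::finite \<Rightarrow> real"
  assumes "C1_compact \<phi>"
  shows "((\<lambda>t. \<phi> (\<chi> j. (w(i := t)) j)) has_real_derivative partial i \<phi> (\<chi> j. (w(i := t)) j)) (at t)"
proof -
  let ?L = "\<lambda>t. (\<chi> j. (w(i := t)) j) :: real^'n"
  have L: "?L = (\<lambda>t. (\<chi> j. (w(i := 0)) j) + t *\<^sub>R axis i 1)"
    by (auto simp: vec_eq_iff axis_def)
  have dL: "(?L has_derivative (\<lambda>s. s *\<^sub>R axis i 1)) (at t)"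
    unfolding L by (auto intro!: derivative_eq_intros)
  have "(\<phi> has_derivative frechet_derivative \<phi> (at (?L t))) (at (?L t))"
    using assms frechet_derivative_works by (auto simp: C1_compact_def)
  from has_derivative_compose[OF dL this]
  have *: "((\<lambda>t. \<phi> (?L t)) has_derivative (\<lambda>s. frechet_derivative \<phi> (at (?L t)) (s *\<^sub>R axis i 1))) (at t)" .
  have "linear (frechet_derivative \<phi> (at (?L t)))"
    using assms by (auto simp: C1_compact_def intro!: linear_frechet_derivative)
  then have "(\<lambda>s. frechet_derivative \<phi> (at (?L t)) (s *\<^sub>R axis i 1)) = (*) (partial i \<phi> (?L t))"
    by (auto simp: partial_def linear_cmul)
  with * show ?thesis by (simp add: has_field_derivative_def)
qed

lemma continuous_compact_support_bounded_vec:
  fixes g :: "real^'n::finite \<Rightarrow> real"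
  assumes "continuous_on UNIV g" "\<And>x. norm x > R \<Longrightarrow> g x = 0"
  obtains B where "\<And>x. \<bar>g x\<bar> \<le> B"
proof -
  have "compact (g ` cball 0 R)"
    using assms(1) by (intro compact_continuous_image continuous_on_subset[OF assms(1)]) auto
  then obtain B where B: "\<And>x. x \<in> g ` cball 0 R \<Longrightarrow> norm x \<le> B"
    using compact_imp_bounded bounded_iff by metis
  have "\<bar>g x\<bar> \<le> max B 0" for x
  proof (cases "norm x > R")
    case False
    then have "x \<in> cball 0 R" by simp
    then have "g x \<in> g ` cball 0 R" by (rule imageI)
    from B[OF this] show ?thesis by simp
  qed (use assms(2) in simp)
  then show thesis using that by blast
qed

text \<open>Multiplied by \<open>exp ((norm x)^2)\<close> the function is still bounded, hence
  integrable for the product of the probability measures \<open>gauss_meas 1 (\<alpha> $ i)\<close>.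
  The Gaussian density of that product cancels the factor again.\<close>

lemma integrable_wmeas_compact_support:
  fixes g :: "real^'n::finite \<Rightarrow> real"
  assumes \<alpha>: "\<And>i. \<alpha> $ i \<ge> 0" and g: "continuous_on UNIV g" and supp: "\<And>x. norm x > R \<Longrightarrow> g x = 0"
  shows "integrable (wmeas \<alpha>) g"
proof -
  define F where "F x = g x * exp ((norm x)\<^sup>2)" for x
  have cF: "continuous_on UNIV F" unfolding F_def by (intro continuous_intros g)
  obtain B where B: "\<And>x. \<bar>F x\<bar> \<le> B"
    by (rule continuous_compact_support_bounded_vec[OF cF, of R]) (auto simp: F_def supp)
  have mF[measurable]: "F \<in> borel_measurable borel" using cF by (rule borel_measurable_continuous_onI)
  let ?P = "PiM UNIV (\<lambda>i. gauss_meas 1 (\<alpha> $ i))"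
  interpret prob_space ?P by (intro prob_space_PiM prob_space_gauss_meas \<alpha>) simp
  have "(\<lambda>w. \<chi> i. w i) \<in> measurable ?P (borel :: (real^'n) measure)"
    using measurable_vec_lambda by (simp cong: measurable_cong_sets sets_PiM_cong)
  from measurable_compose[OF this mF] have "integrable ?P (\<lambda>w. F (\<chi> i. w i))"
    using B by (rule integrable_bounded)
  then have "integrable (wmeas \<alpha>) (\<lambda>x. F x * exp (- 1 * (norm x)\<^sup>2))"
    using integral_gaussN(2)[OF _ \<alpha> mF, of 1] by simp
  then show ?thesis by (simp add: F_def mult.assoc exp_add[symmetric])
qed

lemma norm_power2_vec: "(norm x)\<^sup>2 = (\<Sum>i\<in>UNIV. (x $ i)\<^sup>2)" for x :: "real^'n::finite"
  by (simp add: norm_vec_def L2_set_def sum_nonneg)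

text \<open>The share of coordinate \<open>i\<close> in the quadratic functional at scale
  \<open>a\<close>: the constants \<open>1 + \<alpha> $ i\<close> add up to
  \<open>homdim \<alpha>\<close>, and the exponential cancels the density of \<open>gaussN\<close>
  relative to \<open>wmeas\<close>.\<close>

definition energy_density :: "real \<Rightarrow> real^'n::finite \<Rightarrow> (real^'n \<Rightarrow> real) \<Rightarrow> 'n \<Rightarrow> real^'n \<Rightarrow> real" where
  "energy_density a \<alpha> \<phi> i x = ((partial i \<phi> x)\<^sup>2 / a + a * (x $ i)\<^sup>2 * (\<phi> x)\<^sup>2 - (1 + \<alpha> $ i) * (\<phi> x)\<^sup>2) * exp (a * (norm x)\<^sup>2)"

lemma partial_zero_outside:
  fixes \<phi> :: "real^'n::finite \<Rightarrow> real"
  assumes \<phi>: "C1_compact \<phi>" and supp: "\<And>x. norm x > R \<Longrightarrow> \<phi> x = 0" and x: "norm x > R"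
  shows "partial i \<phi> x = 0"
proof -
  have "open {x::real^'n. norm x > R}" by (intro open_Collect_less continuous_intros)
  then have "(\<phi> has_derivative (\<lambda>_. 0)) (at x)"
    using x supp by (intro has_derivative_transform_within_open[OF has_derivative_const[of 0]]) auto
  then show ?thesis by (metis partial_def frechet_derivative_at)
qed

text \<open>Along a coordinate line the squared norm is \<open>t^2\<close> plus a constant, so the
  Gaussian of the remaining coordinates is a fixed factor \<open>k\<close>. Absorbed into the test
  function, it enters both sides through its square.\<close>

lemma gap_form_fibre:
  fixes \<phi> :: "real^'n::finite \<Rightarrow> real"
  assumes a: "a > 0" and \<alpha>: "\<And>i. \<alpha> $ i \<ge> 0" and \<phi>: "C1_compact \<phi>"
  shows "gap_form (gauss_meas a (\<alpha> $ i)) (gauss_mode a (\<alpha> $ i))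
      (\<lambda>t. \<phi> (\<chi> j. (w(i := t)) j) * exp (a * (norm (\<chi> j. (w(i := t)) j))\<^sup>2 / 2))
    \<le> (\<integral>t. energy_density a \<alpha> \<phi> i (\<chi> j. (w(i := t)) j) \<partial>gauss_meas a (\<alpha> $ i))"
proof -
  obtain R where R: "\<And>x. norm x > R \<Longrightarrow> \<phi> x = 0" using \<phi> by (auto simp: C1_compact_def)
  let ?L = "\<lambda>t. (\<chi> j. (w(i := t)) j) :: real^'n"
  define k where "k = exp (a * (\<Sum>j\<in>UNIV - {i}. (w j)\<^sup>2) / 2)"
  have nL: "(norm (?L t))\<^sup>2 = t\<^sup>2 + (\<Sum>j\<in>UNIV - {i}. (w j)\<^sup>2)" for t
    unfolding norm_power2_vec by (subst sum.remove[of UNIV i]) auto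
  have e1: "exp (a * (norm (?L t))\<^sup>2 / 2) = k * exp (a * t\<^sup>2 / 2)" for t
    unfolding nL k_def by (simp add: exp_add[symmetric] field_simps)
  have e2: "exp (a * (norm (?L t))\<^sup>2) = k\<^sup>2 * exp (a * t\<^sup>2)" for t
    unfolding nL k_def by (simp add: exp_add[symmetric] field_simps power2_eq_square)
  define h h' where "h t = \<phi> (?L t) * k" and "h' t = partial i \<phi> (?L t) * k" for t
  have cL: "continuous_on UNIV ?L"
  proof (rule continuous_on_vec_lambda)
    show "continuous_on UNIV (\<lambda>t. (w(i := t)) j)" for j
      by (cases "j = i") auto
  qed
  have cont: "continuous_on UNIV (\<lambda>t. partial i \<phi> (?L t))"
    using \<phi> cL by (intro continuous_on_compose2[of UNIV "partial i \<phi>" UNIV ?L]) (auto simp: C1_compact_def)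
  have "gap_form (gauss_meas a (\<alpha> $ i)) (gauss_mode a (\<alpha> $ i)) (\<lambda>t. h t * exp (a * t\<^sup>2 / 2))
    \<le> (\<integral>t. ((h' t)\<^sup>2 / a + a * t\<^sup>2 * (h t)\<^sup>2 - (1 + \<alpha> $ i) * (h t)\<^sup>2) * exp (a * t\<^sup>2) \<partial>gauss_meas a (\<alpha> $ i))"
  proof (rule gap_form_gauss[OF a \<alpha>])
    show "(h has_real_derivative h' t) (at t)" for t
      unfolding h_def h'_def by (intro DERIV_cmult_right has_derivative_partial[OF \<phi>])
    show "isCont h' t" for t
      using cont continuous_on_eq_continuous_at[OF open_UNIV] unfolding h'_def
      by (intro continuous_intros) blast
    show "h t = 0" if "\<bar>t\<bar> > R" for t
    proof -
      have "\<bar>?L t $ i\<bar> \<le> norm (?L t)" by (rule component_le_norm_cart)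
      then show ?thesis using that R[of "?L t"] by (simp add: h_def)
    qed
  qed
  moreover have "((h' t)\<^sup>2 / a + a * t\<^sup>2 * (h t)\<^sup>2 - (1 + \<alpha> $ i) * (h t)\<^sup>2) * exp (a * t\<^sup>2)
    = energy_density a \<alpha> \<phi> i (?L t)" for t
    unfolding energy_density_def e2 h_def h'_def by (simp add: power_mult_distrib algebra_simps add_divide_distrib)
  moreover have "h t * exp (a * t\<^sup>2 / 2) = \<phi> (?L t) * exp (a * (norm (?L t))\<^sup>2 / 2)" for t
    unfolding e1 h_def by (rule mult.assoc)
  ultimately show ?thesis by simp
qed

text \<open>Tensorization is applied to \<open>V x = \<phi> x * exp (a * (norm x)^2 / 2)\<close>,
  which is bounded because \<open>\<phi>\<close> has bounded support; the approximants are its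
  projections onto constants and affine functions. Both therefore carry the Gaussian of width fixed
  by \<open>a\<close>, and only the polynomial coefficients depend on \<open>\<phi>\<close>. Square
  integrability is part of the conclusion since these integrals later serve as norms in a triangle
  inequality, and the integral of a nonintegrable function would be 0 by convention.\<close>

theorem gaussian_deficit:
  fixes \<phi> :: "real^'n::finite \<Rightarrow> real"
  assumes a: "a > 0" and \<alpha>: "\<And>i. \<alpha> $ i \<ge> 0" and \<phi>: "C1_compact \<phi>"
  obtains c c' d where
    "square_integrable (wmeas \<alpha>) (\<lambda>x. \<phi> x - c * exp (- a * (norm x)\<^sup>2 / 2))"
    "square_integrable (wmeas \<alpha>) (\<lambda>x. \<phi> x - (c' + d \<bullet> x) * exp (- a * (norm x)\<^sup>2 / 2))"
    "2 * (\<integral>x. (\<phi> x - c * exp (- a * (norm x)\<^sup>2 / 2))\<^sup>2 \<partial>wmeas \<alpha>)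
      + 2 * (\<integral>x. (\<phi> x - (c' + d \<bullet> x) * exp (- a * (norm x)\<^sup>2 / 2))\<^sup>2 \<partial>wmeas \<alpha>)
     \<le> (\<integral>x. (norm (grad \<phi> x))\<^sup>2 \<partial>wmeas \<alpha>) / a + a * (\<integral>x. (\<phi> x)\<^sup>2 * (norm x)\<^sup>2 \<partial>wmeas \<alpha>)
       - homdim \<alpha> * (\<integral>x. (\<phi> x)\<^sup>2 \<partial>wmeas \<alpha>)"
proof -
  obtain R where R: "\<And>x. norm x > R \<Longrightarrow> \<phi> x = 0" using \<phi> by (auto simp: C1_compact_def)
  have c\<phi>: "continuous_on UNIV \<phi>" by (rule C1_compact_continuous[OF \<phi>])
  have cp: "continuous_on UNIV (partial i \<phi>)" for i using \<phi> by (simp add: C1_compact_def)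
  have Rp: "partial i \<phi> x = 0" if "norm x > R" for i x by (rule partial_zero_outside[OF \<phi> R that])
  define M where "M i = gauss_meas a (\<alpha> $ i)" for i
  define e where "e i = gauss_mode a (\<alpha> $ i)" for i
  have prob: "prob_space (M i)" for i unfolding M_def by (rule prob_space_gauss_meas[OF a \<alpha>])
  have st: "standardized (M i) (e i)" for i
    unfolding M_def e_def by (rule standardized_gauss_mode[OF a \<alpha>])
  interpret P: prob_space "PiM UNIV M" by (intro prob_space_PiM prob)
  define V where "V x = \<phi> x * exp (a * (norm x)\<^sup>2 / 2)" for x
  have cV: "continuous_on UNIV V" unfolding V_def by (intro continuous_intros c\<phi>) simp
  have cG: "continuous_on UNIV (energy_density a \<alpha> \<phi> i)" for i
    unfolding energy_density_def by (intro continuous_intros c\<phi> cp) (use a in simp)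
  have [measurable]: "V \<in> borel_measurable borel" "\<phi> \<in> borel_measurable borel"
    "energy_density a \<alpha> \<phi> i \<in> borel_measurable borel" for i
    using cV c\<phi> cG by (simp_all add: borel_measurable_continuous_onI)
  have vm[measurable]: "(\<lambda>w. \<chi> i. w i) \<in> measurable (PiM UNIV M) (borel :: (real^'n) measure)"
    using measurable_vec_lambda unfolding M_def by (simp cong: measurable_cong_sets sets_PiM_cong)
  obtain B1 where B1: "\<And>x. \<bar>V x\<bar> \<le> B1"
    by (rule continuous_compact_support_bounded_vec[OF cV, of R]) (auto simp: V_def R)
  have "\<exists>B. \<forall>x. \<bar>energy_density a \<alpha> \<phi> i x\<bar> \<le> B" for i
    by (rule continuous_compact_support_bounded_vec[OF cG, of R i]) (auto simp: energy_density_def R Rp)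
  then obtain B2 where B2: "\<And>i x. \<bar>energy_density a \<alpha> \<phi> i x\<bar> \<le> B2 i" by metis
  define B where "B = \<bar>B1\<bar> + (\<Sum>i\<in>UNIV. \<bar>B2 i\<bar>)"
  have BV: "\<bar>V x\<bar> \<le> B" for x
  proof -
    have "0 \<le> (\<Sum>i\<in>UNIV. \<bar>B2 i\<bar>)" by (rule sum_nonneg) simp
    then show ?thesis unfolding B_def using B1[of x] by linarith
  qed
  have BG: "\<bar>energy_density a \<alpha> \<phi> i x\<bar> \<le> B" for i x
    unfolding B_def using B2[of i x] member_le_sum[of i UNIV "\<lambda>i. \<bar>B2 i\<bar>"] by simp
  define f where "f w = V (\<chi> i. w i)" for w
  define \<Gamma> where "\<Gamma> i w = energy_density a \<alpha> \<phi> i (\<chi> i. w i)" for i w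
  have mf[measurable]: "f \<in> borel_measurable (PiM UNIV M)" unfolding f_def by measurable
  have m\<Gamma>[measurable]: "\<Gamma> i \<in> borel_measurable (PiM UNIV M)" for i unfolding \<Gamma>_def by measurable
  have tens: "4 * (\<integral>w. (f w)\<^sup>2 \<partial>PiM UNIV M) - 4 * (\<integral>w. f w \<partial>PiM UNIV M)\<^sup>2
      - 2 * (\<Sum>i\<in>UNIV. (\<integral>w. f w * e i (w i) \<partial>PiM UNIV M)\<^sup>2) \<le> (\<Sum>i\<in>UNIV. \<integral>w. \<Gamma> i w \<partial>PiM UNIV M)"
  proof (rule tensorization[OF prob _ st mf _ m\<Gamma>])
    show "gap_form (M i) (e i) (\<lambda>t. f (w(i := t))) \<le> (\<integral>t. \<Gamma> i (w(i := t)) \<partial>M i)" for i w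
      unfolding f_def \<Gamma>_def M_def e_def V_def by (rule gap_form_fibre[OF a \<alpha> \<phi>])
    show "\<bar>f w\<bar> \<le> B" "\<bar>\<Gamma> i w\<bar> \<le> B" for i w
      by (auto simp: f_def \<Gamma>_def BV BG)
  qed simp
  have sf: "square_integrable (PiM UNIV M) f"
    by (rule P.square_integrable_bounded[OF mf, of B]) (simp add: f_def BV)
  have on: "orthonormal_family (PiM UNIV M) (insert None (range Some)) (coord_modes e)"
    using orthonormal_coord_modes[OF prob finite st] .
  then have onN: "orthonormal_family (PiM UNIV M) {None} (coord_modes e)"
    by (auto simp: orthonormal_family_def)
  have sm: "square_integrable (PiM UNIV M) (\<lambda>w. e i (w i))" for i
    using on by (auto simp: orthonormal_family_def)
  define c0 where "c0 = (\<integral>w. f w \<partial>PiM UNIV M)"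
  define ci where "ci i = (\<integral>w. f w * e i (w i) \<partial>PiM UNIV M)" for i
  have r1: "(\<integral>w. (f w - c0)\<^sup>2 \<partial>PiM UNIV M) = (\<integral>w. (f w)\<^sup>2 \<partial>PiM UNIV M) - c0\<^sup>2"
    using orthonormal_integral_residual[OF onN sf] by (simp add: c0_def)
  have r2: "(\<integral>w. (f w - (c0 + (\<Sum>i\<in>UNIV. ci i * e i (w i))))\<^sup>2 \<partial>PiM UNIV M)
    = (\<integral>w. (f w)\<^sup>2 \<partial>PiM UNIV M) - (c0\<^sup>2 + (\<Sum>i\<in>UNIV. (ci i)\<^sup>2))"
    using orthonormal_integral_residual[OF on sf] by (simp add: c0_def ci_def sum.reindex)
  \<comment> \<open>Undoing the standardisation of the modes: the scaling by the standard deviation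
    goes into the slope \<open>d\<close>, and the shift by the means goes into the constant
    \<open>c'\<close>.\<close>
  define d where "d = (\<chi> i. ci i / sqrt (gauss_var a (\<alpha> $ i)))"
  define c' where "c' = c0 - (\<Sum>i\<in>UNIV. ci i * gauss_mean a (\<alpha> $ i) / sqrt (gauss_var a (\<alpha> $ i)))"
  have lin: "c0 + (\<Sum>i\<in>UNIV. ci i * e i (w i)) = c' + d \<bullet> (\<chi> i. w i)" for w
  proof -
    have "ci i * e i (w i) = ci i / sqrt (gauss_var a (\<alpha> $ i)) * w i
        - ci i * gauss_mean a (\<alpha> $ i) / sqrt (gauss_var a (\<alpha> $ i))" for i
      by (simp add: e_def gauss_mode_def diff_divide_distrib right_diff_distrib)
    then show ?thesis
      by (simp add: c'_def d_def inner_vec_def sum_subtractf)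
  qed
  have s1: "integrable (PiM UNIV M) (\<lambda>w. (V (\<chi> i. w i) - c0)\<^sup>2)"
    using square_integrable_diff[OF sf P.square_integrable_const[of c0]]
    by (simp add: square_integrable_def f_def)
  have s2: "integrable (PiM UNIV M) (\<lambda>w. (V (\<chi> i. w i) - (c' + d \<bullet> (\<chi> i. w i)))\<^sup>2)"
  proof -
    have "square_integrable (PiM UNIV M) (\<lambda>w. f w - (c0 + (\<Sum>i\<in>UNIV. ci i * e i (w i))))"
      by (intro square_integrable_diff sf square_integrable_add P.square_integrable_const
          square_integrable_sum square_integrable_cmult sm) simp
    then show ?thesis unfolding lin by (simp add: square_integrable_def f_def)
  qed
  define Z where "Z = gauss_mass a \<alpha>"
  have Z: "Z > 0" unfolding Z_def by (rule gauss_mass_pos[OF a \<alpha>])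
  \<comment> \<open>Passing back from the Gaussian measure to \<open>wmeas\<close>, the distance of
    \<open>V\<close> from \<open>p\<close> becomes the distance of \<open>\<phi>\<close> from
    \<open>p\<close> times a Gaussian. It is used with \<open>p\<close> constant and with
    \<open>p\<close> affine in \<open>x\<close>.\<close>
  have sq: "(V x - p)\<^sup>2 * exp (- a * (norm x)\<^sup>2) = (\<phi> x - p * exp (- a * (norm x)\<^sup>2 / 2))\<^sup>2" for x p
  proof -
    have "exp (- a * (norm x)\<^sup>2) = (exp (- a * (norm x)\<^sup>2 / 2))\<^sup>2"
      by (simp add: power2_eq_square exp_add[symmetric])
    then have "(V x - p)\<^sup>2 * exp (- a * (norm x)\<^sup>2) = ((V x - p) * exp (- a * (norm x)\<^sup>2 / 2))\<^sup>2"
      by (simp only: power_mult_distrib)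
    also have "(V x - p) * exp (- a * (norm x)\<^sup>2 / 2) = \<phi> x - p * exp (- a * (norm x)\<^sup>2 / 2)"
      by (simp add: V_def left_diff_distrib mult.assoc exp_add[symmetric])
    finally show ?thesis .
  qed
  have M_eq: "PiM UNIV M = PiM UNIV (\<lambda>i. gauss_meas a (\<alpha> $ i))" by (simp add: M_def[abs_def])
  have i1: "(\<integral>w. (f w - c0)\<^sup>2 \<partial>PiM UNIV M) = (\<integral>x. (\<phi> x - c0 * exp (- a * (norm x)\<^sup>2 / 2))\<^sup>2 \<partial>wmeas \<alpha>) / Z"
    unfolding f_def sq[symmetric] M_eq Z_def by (rule integral_gaussN(1)[OF a \<alpha>]) measurable
  have i2: "(\<integral>w. (f w - (c0 + (\<Sum>i\<in>UNIV. ci i * e i (w i))))\<^sup>2 \<partial>PiM UNIV M)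
      = (\<integral>x. (\<phi> x - (c' + d \<bullet> x) * exp (- a * (norm x)\<^sup>2 / 2))\<^sup>2 \<partial>wmeas \<alpha>) / Z"
    unfolding f_def lin sq[symmetric] M_eq Z_def
    by (rule integral_gaussN(1)[OF a \<alpha>, of "\<lambda>x. (V x - (c' + d \<bullet> x))\<^sup>2"]) measurable
  have iG: "(\<Sum>i\<in>UNIV. \<integral>w. \<Gamma> i w \<partial>PiM UNIV M) = ((\<integral>x. (norm (grad \<phi> x))\<^sup>2 \<partial>wmeas \<alpha>) / a
      + a * (\<integral>x. (\<phi> x)\<^sup>2 * (norm x)\<^sup>2 \<partial>wmeas \<alpha>) - homdim \<alpha> * (\<integral>x. (\<phi> x)\<^sup>2 \<partial>wmeas \<alpha>)) / Z"
  proof -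
    have ip: "integrable (wmeas \<alpha>) (\<lambda>x. (partial i \<phi> x)\<^sup>2)"
      and ix: "integrable (wmeas \<alpha>) (\<lambda>x. (x $ i)\<^sup>2 * (\<phi> x)\<^sup>2)"
      and i\<phi>: "integrable (wmeas \<alpha>) (\<lambda>x. (\<phi> x)\<^sup>2)" for i
      by (rule integrable_wmeas_compact_support[OF \<alpha>, of _ R];
          (intro continuous_intros c\<phi> cp)?; simp add: R Rp)+
    have "(\<integral>w. \<Gamma> i w \<partial>PiM UNIV M) = ((\<integral>x. (partial i \<phi> x)\<^sup>2 \<partial>wmeas \<alpha>) / a
      + a * (\<integral>x. (x $ i)\<^sup>2 * (\<phi> x)\<^sup>2 \<partial>wmeas \<alpha>) - (1 + \<alpha> $ i) * (\<integral>x. (\<phi> x)\<^sup>2 \<partial>wmeas \<alpha>)) / Z" for i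
    proof -
      have "(\<integral>w. \<Gamma> i w \<partial>PiM UNIV M) = (\<integral>x. energy_density a \<alpha> \<phi> i x * exp (- a * (norm x)\<^sup>2) \<partial>wmeas \<alpha>) / Z"
        unfolding \<Gamma>_def M_eq Z_def by (rule integral_gaussN(1)[OF a \<alpha>]) measurable
      also have "(\<lambda>x. energy_density a \<alpha> \<phi> i x * exp (- a * (norm x)\<^sup>2))
        = (\<lambda>x. (partial i \<phi> x)\<^sup>2 / a + a * ((x $ i)\<^sup>2 * (\<phi> x)\<^sup>2) - (1 + \<alpha> $ i) * (\<phi> x)\<^sup>2)"
        by (simp add: energy_density_def mult.assoc exp_add[symmetric])
      finally show ?thesis using ip ix i\<phi> by simp
    qed
    then have "(\<Sum>i\<in>UNIV. \<integral>w. \<Gamma> i w \<partial>PiM UNIV M) = ((\<Sum>i\<in>UNIV. \<integral>x. (partial i \<phi> x)\<^sup>2 \<partial>wmeas \<alpha>) / a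
      + a * (\<Sum>i\<in>UNIV. \<integral>x. (x $ i)\<^sup>2 * (\<phi> x)\<^sup>2 \<partial>wmeas \<alpha>)
      - (\<Sum>i\<in>UNIV. 1 + \<alpha> $ i) * (\<integral>x. (\<phi> x)\<^sup>2 \<partial>wmeas \<alpha>)) / Z"
      by (simp only: sum_divide_distrib[symmetric] sum_subtractf sum.distrib
          sum_distrib_left[symmetric] sum_distrib_right[symmetric])
    also have "(\<Sum>i\<in>UNIV. \<integral>x. (partial i \<phi> x)\<^sup>2 \<partial>wmeas \<alpha>) = (\<integral>x. (norm (grad \<phi> x))\<^sup>2 \<partial>wmeas \<alpha>)"
      unfolding norm_power2_vec grad_def using ip by simp
    also have "(\<Sum>i\<in>UNIV. \<integral>x. (x $ i)\<^sup>2 * (\<phi> x)\<^sup>2 \<partial>wmeas \<alpha>) = (\<integral>x. (\<phi> x)\<^sup>2 * (norm x)\<^sup>2 \<partial>wmeas \<alpha>)"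
      unfolding norm_power2_vec using ix by (simp add: sum_distrib_left mult.commute)
    also have "(\<Sum>i\<in>UNIV. 1 + \<alpha> $ i) = homdim \<alpha>" by (simp add: homdim_def sum.distrib)
    finally show ?thesis .
  qed
  have "2 * (\<integral>w. (f w - c0)\<^sup>2 \<partial>PiM UNIV M)
      + 2 * (\<integral>w. (f w - (c0 + (\<Sum>i\<in>UNIV. ci i * e i (w i))))\<^sup>2 \<partial>PiM UNIV M) \<le> (\<Sum>i\<in>UNIV. \<integral>w. \<Gamma> i w \<partial>PiM UNIV M)"
    using tens unfolding r1 r2 by (simp add: c0_def ci_def)
  then have main: "2 * (\<integral>x. (\<phi> x - c0 * exp (- a * (norm x)\<^sup>2 / 2))\<^sup>2 \<partial>wmeas \<alpha>)
      + 2 * (\<integral>x. (\<phi> x - (c' + d \<bullet> x) * exp (- a * (norm x)\<^sup>2 / 2))\<^sup>2 \<partial>wmeas \<alpha>)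
     \<le> (\<integral>x. (norm (grad \<phi> x))\<^sup>2 \<partial>wmeas \<alpha>) / a + a * (\<integral>x. (\<phi> x)\<^sup>2 * (norm x)\<^sup>2 \<partial>wmeas \<alpha>)
       - homdim \<alpha> * (\<integral>x. (\<phi> x)\<^sup>2 \<partial>wmeas \<alpha>)"
    unfolding i1 i2 iG using Z by (simp add: divide_simps)
  have q1: "square_integrable (wmeas \<alpha>) (\<lambda>x. \<phi> x - c0 * exp (- a * (norm x)\<^sup>2 / 2))"
    unfolding square_integrable_def sq[symmetric]
    using s1 integral_gaussN(2)[OF a \<alpha>, of "\<lambda>x. (V x - c0)\<^sup>2"] by (simp add: M_eq)
  have q2: "square_integrable (wmeas \<alpha>) (\<lambda>x. \<phi> x - (c' + d \<bullet> x) * exp (- a * (norm x)\<^sup>2 / 2))"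
    unfolding square_integrable_def sq[symmetric]
    using s2 integral_gaussN(2)[OF a \<alpha>, of "\<lambda>x. (V x - (c' + d \<bullet> x))\<^sup>2"] by (simp add: M_eq)
  show thesis by (rule that[OF q1 q2 main])
qed

section \<open>Passage to the completion\<close>

lemma cauchy_schwarz_integral:
  assumes f: "square_integrable M f" and g: "square_integrable M g"
  shows "(\<integral>x. f x * g x \<partial>M) \<le> sqrt (\<integral>x. (f x)\<^sup>2 \<partial>M) * sqrt (\<integral>x. (g x)\<^sup>2 \<partial>M)"
proof -
  define A B C where "A = (\<integral>x. (f x)\<^sup>2 \<partial>M)" and "B = (\<integral>x. (g x)\<^sup>2 \<partial>M)" and "C = (\<integral>x. f x * g x \<partial>M)"
  have int: "integrable M (\<lambda>x. (f x)\<^sup>2)" "integrable M (\<lambda>x. (g x)\<^sup>2)" "integrable M (\<lambda>x. f x * g x)"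
    using f g square_integrable_mult[OF f g] by (auto simp: square_integrable_def)
  have quad: "0 \<le> t\<^sup>2 * A - 2 * t * C + B" for t
  proof -
    have "0 \<le> (\<integral>x. (t * f x - g x)\<^sup>2 \<partial>M)" by simp
    also have "(\<lambda>x. (t * f x - g x)\<^sup>2) = (\<lambda>x. t\<^sup>2 * (f x)\<^sup>2 - 2 * t * (f x * g x) + (g x)\<^sup>2)"
      by (simp add: power2_diff power_mult_distrib algebra_simps)
    finally show ?thesis using int by (simp add: A_def B_def C_def)
  qed
  have "C\<^sup>2 \<le> A * B"
  proof (cases "A = 0")
    case True
    have "C = 0"
    proof (rule ccontr)
      assume "C \<noteq> 0"
      \<comment> \<open>With \<open>A = 0\<close> this choice of \<open>t\<close> gives the
        quadratic the value \<open>- 1\<close>.\<close>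
      then show False using quad[of "(B + 1) / (2 * C)"] True by (simp add: field_simps)
    qed
    then show ?thesis using True by simp
  next
    case False
    moreover have "A \<ge> 0" unfolding A_def by simp
    ultimately have "A > 0" by simp
    have "0 \<le> A * ((C / A)\<^sup>2 * A - 2 * (C / A) * C + B)"
      using quad[of "C / A"] \<open>A > 0\<close> by simp
    also have "\<dots> = A * B - C\<^sup>2" using \<open>A > 0\<close> by (simp add: field_simps power2_eq_square)
    finally show ?thesis by simp
  qed
  then have "C \<le> sqrt (A * B)" by (rule real_le_rsqrt)
  then show ?thesis by (simp add: A_def B_def C_def real_sqrt_mult)
qed

definition L2norm :: "'a measure \<Rightarrow> ('a \<Rightarrow> 'b::real_normed_vector) \<Rightarrow> real" where
  "L2norm M f = sqrt (\<integral>x. (norm (f x))\<^sup>2 \<partial>M)"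

lemma L2norm_nonneg: "0 \<le> L2norm M f"
  by (simp add: L2norm_def)

lemma L2norm_triangle:
  fixes f g :: "'a \<Rightarrow> 'b::{second_countable_topology, real_normed_vector}"
  assumes [measurable]: "f \<in> borel_measurable M" "g \<in> borel_measurable M"
    and f: "integrable M (\<lambda>x. (norm (f x))\<^sup>2)" and g: "integrable M (\<lambda>x. (norm (g x))\<^sup>2)"
  shows "integrable M (\<lambda>x. (norm (f x + g x))\<^sup>2)"
    and "L2norm M (\<lambda>x. f x + g x) \<le> L2norm M f + L2norm M g"
proof -
  have sf: "square_integrable M (\<lambda>x. norm (f x))" and sg: "square_integrable M (\<lambda>x. norm (g x))"
    using f g by (auto simp: square_integrable_def)
  have fg: "integrable M (\<lambda>x. norm (f x) * norm (g x))" by (rule square_integrable_mult[OF sf sg])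
  have isum: "integrable M (\<lambda>x. (norm (f x) + norm (g x))\<^sup>2)"
    using square_integrable_add[OF sf sg] by (simp add: square_integrable_def)
  have le: "(norm (f x + g x))\<^sup>2 \<le> (norm (f x) + norm (g x))\<^sup>2" for x
    by (intro power_mono norm_triangle_ineq) simp
  show i: "integrable M (\<lambda>x. (norm (f x + g x))\<^sup>2)"
    by (rule Bochner_Integration.integrable_bound[OF isum]) (use le in auto)
  have "(\<integral>x. (norm (f x + g x))\<^sup>2 \<partial>M) \<le> (\<integral>x. (norm (f x) + norm (g x))\<^sup>2 \<partial>M)"
    by (rule integral_mono[OF i isum le])
  also have "\<dots> = (\<integral>x. (norm (f x))\<^sup>2 \<partial>M) + (\<integral>x. (norm (g x))\<^sup>2 \<partial>M) + 2 * (\<integral>x. norm (f x) * norm (g x) \<partial>M)"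
    unfolding power2_sum mult.assoc using f g fg by simp
  also have "\<dots> \<le> (L2norm M f)\<^sup>2 + (L2norm M g)\<^sup>2 + 2 * (L2norm M f * L2norm M g)"
    using cauchy_schwarz_integral[OF sf sg] by (simp add: L2norm_def)
  also have "\<dots> = (L2norm M f + L2norm M g)\<^sup>2" by (simp add: power2_sum)
  finally show "L2norm M (\<lambda>x. f x + g x) \<le> L2norm M f + L2norm M g"
    unfolding L2norm_def[of M "\<lambda>x. f x + g x"]
    by (intro real_le_lsqrt) (simp_all add: L2norm_nonneg)
qed

text \<open>The reverse triangle inequality for \<open>L2norm\<close>. Values in a normed space are
  allowed because it is used for gradients as well as for scalar functions.\<close>

lemma tendsto_integral_norm_sq:
  fixes f :: "'a \<Rightarrow> 'b::{second_countable_topology, real_normed_vector}"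
  assumes [measurable]: "f \<in> borel_measurable M" "\<And>k. F k \<in> borel_measurable M"
    and F: "\<And>k. integrable M (\<lambda>x. (norm (F k x))\<^sup>2)"
    and D: "\<And>k. integrable M (\<lambda>x. (norm (F k x - f x))\<^sup>2)"
    and lim: "(\<lambda>k. \<integral>x. (norm (F k x - f x))\<^sup>2 \<partial>M) \<longlonglongrightarrow> 0"
  shows "(\<lambda>k. \<integral>x. (norm (F k x))\<^sup>2 \<partial>M) \<longlonglongrightarrow> (\<integral>x. (norm (f x))\<^sup>2 \<partial>M)"
proof -
  have D': "integrable M (\<lambda>x. (norm (f x - F k x))\<^sup>2)" for k
    using D[of k] by (simp add: norm_minus_commute)
  have f: "integrable M (\<lambda>x. (norm (f x))\<^sup>2)"
    using L2norm_triangle(1)[of "F 0" M "\<lambda>x. f x - F 0 x", OF _ _ F D'] by simp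
  have "L2norm M (\<lambda>x. F k x + (f x - F k x)) \<le> L2norm M (F k) + L2norm M (\<lambda>x. f x - F k x)" for k
    by (rule L2norm_triangle(2)[OF _ _ F D']) measurable
  moreover have "L2norm M (\<lambda>x. f x + (F k x - f x)) \<le> L2norm M f + L2norm M (\<lambda>x. F k x - f x)" for k
    by (rule L2norm_triangle(2)[OF _ _ f D]) measurable
  moreover have "L2norm M (\<lambda>x. f x - F k x) = L2norm M (\<lambda>x. F k x - f x)" for k
    by (simp add: L2norm_def norm_minus_commute)
  ultimately have "\<bar>L2norm M (F k) - L2norm M f\<bar> \<le> L2norm M (\<lambda>x. F k x - f x)" for k
    by (simp add: abs_le_iff algebra_simps)
  moreover have "(\<lambda>k. L2norm M (\<lambda>x. F k x - f x)) \<longlonglongrightarrow> 0"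
    using tendsto_real_sqrt[OF lim] by (simp add: L2norm_def)
  ultimately have "(\<lambda>k. L2norm M (F k) - L2norm M f) \<longlonglongrightarrow> 0"
    by (intro Lim_null_comparison[of "\<lambda>k. L2norm M (F k) - L2norm M f" "\<lambda>k. L2norm M (\<lambda>x. F k x - f x)"]) auto
  then have "(\<lambda>k. L2norm M (F k)) \<longlonglongrightarrow> L2norm M f" by (simp add: LIM_zero_iff)
  from tendsto_power[OF this, of 2] show ?thesis by (simp add: L2norm_def)
qed

section \<open>Weighted integrals and approximation by test functions\<close>

lemma wint_eq:
  assumes "f \<in> borel_measurable borel"
  shows "wint \<alpha> f = (\<integral>x. f x \<partial>wmeas \<alpha>)"
  unfolding wint_def wmeas_def set_lebesgue_integral_def using assms
  by (subst integral_density) (auto simp: xA_nonneg mult_ac)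

lemma wnn_eq:
  assumes "f \<in> borel_measurable borel" "\<And>x. 0 \<le> f x"
  shows "wnn \<alpha> f = (\<integral>\<^sup>+x. ennreal (f x) \<partial>wmeas \<alpha>)"
  unfolding wnn_def wmeas_def using assms
  by (subst nn_integral_density)
    (auto intro!: nn_integral_cong simp: xA_nonneg ennreal_mult indicator_def mult_ac)

lemma wnn_finite:
  assumes "f \<in> borel_measurable borel" "\<And>x. 0 \<le> f x" "wnn \<alpha> f < \<infinity>"
  shows "integrable (wmeas \<alpha>) f" "wnn \<alpha> f = ennreal (\<integral>x. f x \<partial>wmeas \<alpha>)"
proof -
  show *: "integrable (wmeas \<alpha>) f"
    using assms wnn_eq[OF assms(1,2), of \<alpha>] by (intro integrableI_nonneg) auto
  show "wnn \<alpha> f = ennreal (\<integral>x. f x \<partial>wmeas \<alpha>)"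
    unfolding wnn_eq[OF assms(1,2)] by (rule nn_integral_eq_integral[OF *]) (use assms in auto)
qed

lemma Nstar_C1_compact:
  assumes "\<phi> \<in> Nstar \<alpha>"
  shows "C1_compact \<phi>"
proof -
  have s: "smooth \<phi>" and c: "compact (closure {x. \<phi> x \<noteq> 0})" using assms by (auto simp: Nstar_def)
  have Ck: "Ck (Suc 0) \<phi>" using s unfolding smooth_def by blast
  have "bounded (closure {x. \<phi> x \<noteq> 0})" using c by (rule compact_imp_bounded)
  then obtain R where R: "\<And>x. x \<in> closure {x. \<phi> x \<noteq> 0} \<Longrightarrow> norm x \<le> R" by (auto simp: bounded_iff)
  have "\<phi> x = 0" if "norm x > R" for x
    using R[of x] closure_subset[of "{x. \<phi> x \<noteq> 0}"] that by fastforce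
  then show ?thesis using Ck by (auto simp: C1_compact_def)
qed

lemma C1_compact_diff:
  assumes \<phi>: "C1_compact \<phi>" and \<psi>: "C1_compact \<psi>"
  shows "C1_compact (\<lambda>x. \<phi> x - \<psi> x)" and "grad (\<lambda>x. \<phi> x - \<psi> x) x = grad \<phi> x - grad \<psi> x"
proof -
  have p: "partial i (\<lambda>x. \<phi> x - \<psi> x) x = partial i \<phi> x - partial i \<psi> x" for i x
  proof -
    have "((\<lambda>x. \<phi> x - \<psi> x) has_derivative (\<lambda>h. frechet_derivative \<phi> (at x) h - frechet_derivative \<psi> (at x) h)) (at x)"
      using \<phi> \<psi> frechet_derivative_works by (auto simp: C1_compact_def intro!: has_derivative_diff)
    from frechet_derivative_at[OF this] show ?thesis by (simp add: partial_def fun_eq_iff)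
  qed
  obtain R1 R2 where R: "\<And>x. norm x > R1 \<Longrightarrow> \<phi> x = 0" "\<And>x. norm x > R2 \<Longrightarrow> \<psi> x = 0"
    using \<phi> \<psi> by (auto simp: C1_compact_def)
  have "\<forall>x. norm x > max R1 R2 \<longrightarrow> \<phi> x - \<psi> x = 0" using R by simp
  then have "\<exists>R. \<forall>x. norm x > R \<longrightarrow> \<phi> x - \<psi> x = 0" by blast
  moreover have "continuous_on UNIV (partial i (\<lambda>x. \<phi> x - \<psi> x))" for i
    unfolding p[abs_def] using \<phi> \<psi> by (intro continuous_intros) (auto simp: C1_compact_def)
  ultimately show "C1_compact (\<lambda>x. \<phi> x - \<psi> x)"
    using \<phi> \<psi> by (auto simp: C1_compact_def)
  show "grad (\<lambda>x. \<phi> x - \<psi> x) x = grad \<phi> x - grad \<psi> x"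
    by (simp add: grad_def p vec_eq_iff)
qed

lemma C1_compact_integrable:
  fixes \<phi> :: "real^'n::finite \<Rightarrow> real"
  assumes \<alpha>: "\<And>i. \<alpha> $ i \<ge> 0" and \<phi>: "C1_compact \<phi>"
  shows "integrable (wmeas \<alpha>) (\<lambda>x. (norm (grad \<phi> x))\<^sup>2)" "integrable (wmeas \<alpha>) (\<lambda>x. (\<phi> x)\<^sup>2 * (norm x)\<^sup>2)"
    "integrable (wmeas \<alpha>) (\<lambda>x. (\<phi> x)\<^sup>2)" "grad \<phi> \<in> borel_measurable borel" "\<phi> \<in> borel_measurable borel"
proof -
  obtain R where R: "\<And>x. norm x > R \<Longrightarrow> \<phi> x = 0" using \<phi> by (auto simp: C1_compact_def)
  have c\<phi>: "continuous_on UNIV \<phi>" by (rule C1_compact_continuous[OF \<phi>])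
  have cp: "continuous_on UNIV (partial i \<phi>)" for i using \<phi> by (simp add: C1_compact_def)
  have cg: "continuous_on UNIV (grad \<phi>)"
    unfolding grad_def[abs_def] by (intro continuous_on_vec_lambda cp)
  have Rg: "grad \<phi> x = 0" if "norm x > R" for x
    using partial_zero_outside[OF \<phi> R that] by (simp add: grad_def vec_eq_iff)
  show "integrable (wmeas \<alpha>) (\<lambda>x. (norm (grad \<phi> x))\<^sup>2)" "integrable (wmeas \<alpha>) (\<lambda>x. (\<phi> x)\<^sup>2 * (norm x)\<^sup>2)"
    "integrable (wmeas \<alpha>) (\<lambda>x. (\<phi> x)\<^sup>2)"
    by (rule integrable_wmeas_compact_support[OF \<alpha>, of _ R];
        (intro continuous_intros c\<phi> cg)?; simp add: R Rg)+
  show "grad \<phi> \<in> borel_measurable borel" "\<phi> \<in> borel_measurable borel"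
    using cg c\<phi> by (auto intro: borel_measurable_continuous_onI)
qed

text \<open>The scale \<open>a = 1\<close> of \<open>gaussian_deficit\<close> with the two squared
  distances dropped. The additive form is enough to make sequences that are Cauchy in the norm of
  the completion Cauchy in the plain square norm.\<close>

lemma hup_C1_compact:
  fixes \<phi> :: "real^'n::finite \<Rightarrow> real"
  assumes \<alpha>: "\<And>i. \<alpha> $ i \<ge> 0" and \<phi>: "C1_compact \<phi>"
  shows "homdim \<alpha> * (\<integral>x. (\<phi> x)\<^sup>2 \<partial>wmeas \<alpha>)
    \<le> (\<integral>x. (norm (grad \<phi> x))\<^sup>2 \<partial>wmeas \<alpha>) + (\<integral>x. (\<phi> x)\<^sup>2 * (norm x)\<^sup>2 \<partial>wmeas \<alpha>)"
proof (rule gaussian_deficit[OF zero_less_one \<alpha> \<phi>])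
  fix c c' d
  assume "2 * (\<integral>x. (\<phi> x - c * exp (- 1 * (norm x)\<^sup>2 / 2))\<^sup>2 \<partial>wmeas \<alpha>)
      + 2 * (\<integral>x. (\<phi> x - (c' + d \<bullet> x) * exp (- 1 * (norm x)\<^sup>2 / 2))\<^sup>2 \<partial>wmeas \<alpha>)
     \<le> (\<integral>x. (norm (grad \<phi> x))\<^sup>2 \<partial>wmeas \<alpha>) / 1 + 1 * (\<integral>x. (\<phi> x)\<^sup>2 * (norm x)\<^sup>2 \<partial>wmeas \<alpha>)
       - homdim \<alpha> * (\<integral>x. (\<phi> x)\<^sup>2 \<partial>wmeas \<alpha>)"
  moreover have "0 \<le> (\<integral>x. (\<phi> x - c * exp (- 1 * (norm x)\<^sup>2 / 2))\<^sup>2 \<partial>wmeas \<alpha>)"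
    "0 \<le> (\<integral>x. (\<phi> x - (c' + d \<bullet> x) * exp (- 1 * (norm x)\<^sup>2 / 2))\<^sup>2 \<partial>wmeas \<alpha>)" by simp_all
  ultimately have "0 \<le> (\<integral>x. (norm (grad \<phi> x))\<^sup>2 \<partial>wmeas \<alpha>) / 1 + 1 * (\<integral>x. (\<phi> x)\<^sup>2 * (norm x)\<^sup>2 \<partial>wmeas \<alpha>)
       - homdim \<alpha> * (\<integral>x. (\<phi> x)\<^sup>2 \<partial>wmeas \<alpha>)" by linarith
  then show ?thesis by simp
qed

lemma AE_wmeas_nonzero: "AE x in wmeas \<alpha>. x \<noteq> 0"
  unfolding wmeas_def by (subst AE_density) (auto intro: AE_mp[OF AE_lborel_singleton[of 0]])

lemma homdim_pos:
  assumes "\<And>i. \<alpha> $ i \<ge> 0"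
  shows "0 < homdim (\<alpha> :: real^'n::finite)"
  unfolding homdim_def using assms by (intro add_pos_nonneg sum_nonneg) simp_all

text \<open>The norm of \<open>S\<^sub>A\<close> controls the plain \<open>L\<^sup>2\<close> norm by the uncertainty principle applied to
  differences; the limit is identified on \<open>|x| > r\<close>, where the weight \<open>|x|\<^sup>2\<close> is bounded below.\<close>

lemma L2_limit:
  fixes \<psi> :: "nat \<Rightarrow> real^'n::finite \<Rightarrow> real" and u :: "real^'n \<Rightarrow> real" and g :: "real^'n \<Rightarrow> real^'n"
  assumes \<alpha>: "\<And>i. \<alpha> $ i \<ge> 0" and \<psi>: "\<And>k. C1_compact (\<psi> k)"
    and [measurable]: "u \<in> borel_measurable borel" "g \<in> borel_measurable borel"
    and iA: "\<And>k. integrable (wmeas \<alpha>) (\<lambda>x. (norm (grad (\<psi> k) x - g x))\<^sup>2)"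
    and iB: "\<And>k. integrable (wmeas \<alpha>) (\<lambda>x. (\<psi> k x - u x)\<^sup>2 * (norm x)\<^sup>2)"
    and A: "(\<lambda>k. \<integral>x. (norm (grad (\<psi> k) x - g x))\<^sup>2 \<partial>wmeas \<alpha>) \<longlonglongrightarrow> 0"
    and B: "(\<lambda>k. \<integral>x. (\<psi> k x - u x)\<^sup>2 * (norm x)\<^sup>2 \<partial>wmeas \<alpha>) \<longlonglongrightarrow> 0"
  shows "integrable (wmeas \<alpha>) (\<lambda>x. (\<psi> k x - u x)\<^sup>2)"
    and "(\<lambda>k. \<integral>x. (\<psi> k x - u x)\<^sup>2 \<partial>wmeas \<alpha>) \<longlonglongrightarrow> 0"
proof -
  define a b where "a k = (\<integral>x. (norm (grad (\<psi> k) x - g x))\<^sup>2 \<partial>wmeas \<alpha>)"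
    and "b k = (\<integral>x. (\<psi> k x - u x)\<^sup>2 * (norm x)\<^sup>2 \<partial>wmeas \<alpha>)" for k
  note [measurable] = C1_compact_integrable(4,5)[OF \<alpha> \<psi>]
  have D: "homdim \<alpha> > 0" by (rule homdim_pos[OF \<alpha>])
  \<comment> \<open>The uncertainty principle for the difference of two approximants; each factor 2
    comes from inserting the common limit and estimating the square of a difference by twice the sum
    of the squares.\<close>
  have cauchy: "homdim \<alpha> * (\<integral>x. (\<psi> k x - \<psi> l x)\<^sup>2 \<partial>wmeas \<alpha>) \<le> 2 * (a k + a l) + 2 * (b k + b l)" for k l
  proof -
    note C = C1_compact_diff[OF \<psi>[of k] \<psi>[of l]]
    have par: "(norm (p - q))\<^sup>2 \<le> 2 * ((norm p)\<^sup>2 + (norm q)\<^sup>2)" for p q :: "'b::real_normed_vector"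
    proof -
      have "(norm (p - q))\<^sup>2 \<le> (norm p + norm q)\<^sup>2" by (intro power_mono norm_triangle_ineq4) simp
      also have "\<dots> \<le> 2 * ((norm p)\<^sup>2 + (norm q)\<^sup>2)"
        using sum_squares_bound[of "norm p" "norm q"] by (simp add: power2_sum)
      finally show ?thesis .
    qed
    have "(\<integral>x. (norm (grad (\<lambda>x. \<psi> k x - \<psi> l x) x))\<^sup>2 \<partial>wmeas \<alpha>)
      \<le> (\<integral>x. 2 * ((norm (grad (\<psi> k) x - g x))\<^sup>2 + (norm (grad (\<psi> l) x - g x))\<^sup>2) \<partial>wmeas \<alpha>)"
    proof (rule integral_mono)
      show "(norm (grad (\<lambda>x. \<psi> k x - \<psi> l x) x))\<^sup>2
        \<le> 2 * ((norm (grad (\<psi> k) x - g x))\<^sup>2 + (norm (grad (\<psi> l) x - g x))\<^sup>2)" for x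
        using par[of "grad (\<psi> k) x - g x" "grad (\<psi> l) x - g x"] by (simp add: C(2))
    qed (use C1_compact_integrable(1)[OF \<alpha> C(1)] iA in auto)
    also have "\<dots> = 2 * (a k + a l)" using iA by (simp add: a_def)
    finally have 1: "(\<integral>x. (norm (grad (\<lambda>x. \<psi> k x - \<psi> l x) x))\<^sup>2 \<partial>wmeas \<alpha>) \<le> 2 * (a k + a l)" .
    have "(\<integral>x. (\<psi> k x - \<psi> l x)\<^sup>2 * (norm x)\<^sup>2 \<partial>wmeas \<alpha>)
      \<le> (\<integral>x. 2 * ((\<psi> k x - u x)\<^sup>2 * (norm x)\<^sup>2 + (\<psi> l x - u x)\<^sup>2 * (norm x)\<^sup>2) \<partial>wmeas \<alpha>)"
    proof (rule integral_mono)
      show "(\<psi> k x - \<psi> l x)\<^sup>2 * (norm x)\<^sup>2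
        \<le> 2 * ((\<psi> k x - u x)\<^sup>2 * (norm x)\<^sup>2 + (\<psi> l x - u x)\<^sup>2 * (norm x)\<^sup>2)" for x
        using mult_right_mono[OF par[of "\<psi> k x - u x" "\<psi> l x - u x"], of "(norm x)\<^sup>2"]
        by (simp add: algebra_simps)
    qed (use C1_compact_integrable(2)[OF \<alpha> C(1)] iB in auto)
    also have "\<dots> = 2 * (b k + b l)" using iB by (simp add: b_def)
    finally show ?thesis using 1 hup_C1_compact[OF \<alpha> C(1)] by linarith
  qed
  have key: "(\<integral>\<^sup>+x. ennreal ((\<psi> k x - u x)\<^sup>2) \<partial>wmeas \<alpha>) \<le> ennreal (4 * (a k + b k + e) / homdim \<alpha>)"
    if e: "e > 0" for k e
  proof -
    \<comment> \<open>Here \<open>\<psi> l\<close> replaces \<open>u\<close>. The Cauchy estimate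
      controls \<open>\<psi> k - \<psi> l\<close>, and for \<open>norm x > r\<close> the error
      \<open>\<psi> l - u\<close> costs at most \<open>2 * b l / r^2\<close>, which vanishes as
      \<open>l\<close> grows while \<open>r\<close> stays fixed. The resulting bound does not depend
      on \<open>r\<close>.\<close>
    have trunc: "(\<integral>\<^sup>+x. ennreal ((\<psi> k x - u x)\<^sup>2) * indicator {x. norm x > r} x \<partial>wmeas \<alpha>)
      \<le> ennreal (4 * (a k + b k + e) / homdim \<alpha>)" if r: "r > 0" for r
    proof -
      have "(\<integral>\<^sup>+x. ennreal ((\<psi> k x - u x)\<^sup>2) * indicator {x. norm x > r} x \<partial>wmeas \<alpha>)
        \<le> ennreal (4 * (a k + b k + (a l + b l)) / homdim \<alpha> + 2 * b l / r\<^sup>2)" for l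
      proof -
        have pt: "ennreal ((\<psi> k x - u x)\<^sup>2) * indicator {x. norm x > r} x
          \<le> ennreal (2 * (\<psi> k x - \<psi> l x)\<^sup>2 + 2 / r\<^sup>2 * ((\<psi> l x - u x)\<^sup>2 * (norm x)\<^sup>2))" for x
        proof (cases "norm x > r")
          case True
          have "(\<psi> k x - u x)\<^sup>2 \<le> 2 * (\<psi> k x - \<psi> l x)\<^sup>2 + 2 * (\<psi> l x - u x)\<^sup>2"
            using sum_squares_bound[of "\<psi> k x - \<psi> l x" "\<psi> l x - u x"]
              power2_sum[of "\<psi> k x - \<psi> l x" "\<psi> l x - u x"] by simp
          moreover have "(\<psi> l x - u x)\<^sup>2 * r\<^sup>2 \<le> (\<psi> l x - u x)\<^sup>2 * (norm x)\<^sup>2"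
            using True r by (intro mult_left_mono power_mono) auto
          then have "2 * (\<psi> l x - u x)\<^sup>2 \<le> 2 / r\<^sup>2 * ((\<psi> l x - u x)\<^sup>2 * (norm x)\<^sup>2)"
            using r by (simp add: field_simps)
          ultimately have "(\<psi> k x - u x)\<^sup>2 \<le> 2 * (\<psi> k x - \<psi> l x)\<^sup>2 + 2 / r\<^sup>2 * ((\<psi> l x - u x)\<^sup>2 * (norm x)\<^sup>2)"
            by linarith
          from ennreal_leI[OF this] show ?thesis using True by (simp del: ennreal_plus)
        qed simp
        have id: "integrable (wmeas \<alpha>) (\<lambda>x. (\<psi> k x - \<psi> l x)\<^sup>2)"
          using C1_compact_integrable(3)[OF \<alpha> C1_compact_diff(1)[OF \<psi>[of k] \<psi>[of l]]] .
        have "(\<integral>\<^sup>+x. ennreal ((\<psi> k x - u x)\<^sup>2) * indicator {x. norm x > r} x \<partial>wmeas \<alpha>)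
          \<le> (\<integral>\<^sup>+x. ennreal (2 * (\<psi> k x - \<psi> l x)\<^sup>2 + 2 / r\<^sup>2 * ((\<psi> l x - u x)\<^sup>2 * (norm x)\<^sup>2)) \<partial>wmeas \<alpha>)"
          by (rule nn_integral_mono) (rule pt)
        also have "\<dots> = ennreal (\<integral>x. 2 * (\<psi> k x - \<psi> l x)\<^sup>2 + 2 / r\<^sup>2 * ((\<psi> l x - u x)\<^sup>2 * (norm x)\<^sup>2) \<partial>wmeas \<alpha>)"
          using id iB by (intro nn_integral_eq_integral Bochner_Integration.integrable_add integrable_mult_right) auto
        also have "(\<integral>x. 2 * (\<psi> k x - \<psi> l x)\<^sup>2 + 2 / r\<^sup>2 * ((\<psi> l x - u x)\<^sup>2 * (norm x)\<^sup>2) \<partial>wmeas \<alpha>)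
          = 2 * (\<integral>x. (\<psi> k x - \<psi> l x)\<^sup>2 \<partial>wmeas \<alpha>) + 2 / r\<^sup>2 * b l"
          unfolding b_def using id iB by (subst Bochner_Integration.integral_add) (simp_all del: times_divide_eq_left)
        also have "\<dots> \<le> 4 * (a k + b k + (a l + b l)) / homdim \<alpha> + 2 * b l / r\<^sup>2"
          using cauchy[of k l] D by (simp add: field_simps)
        finally show ?thesis by (simp add: ennreal_leI)
      qed
      moreover have "(\<lambda>l. ennreal (4 * (a k + b k + (a l + b l)) / homdim \<alpha> + 2 * b l / r\<^sup>2))
        \<longlonglongrightarrow> ennreal (4 * (a k + b k + (0 + 0)) / homdim \<alpha> + 2 * 0 / r\<^sup>2)"
        using A B r D unfolding a_def[symmetric] b_def[symmetric]
        by (intro tendsto_ennrealI tendsto_intros) auto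
      ultimately have "(\<integral>\<^sup>+x. ennreal ((\<psi> k x - u x)\<^sup>2) * indicator {x. norm x > r} x \<partial>wmeas \<alpha>)
        \<le> ennreal (4 * (a k + b k + (0 + 0)) / homdim \<alpha> + 2 * 0 / r\<^sup>2)"
        by (intro LIMSEQ_le_const) auto
      also have "\<dots> \<le> ennreal (4 * (a k + b k + e) / homdim \<alpha>)"
        using D e by (intro ennreal_leI) (simp add: divide_right_mono)
      finally show ?thesis .
    qed
    \<comment> \<open>Monotone convergence with radii \<open>1 / (n + 1)\<close> removes the
      truncation; only the origin is left out, a null set of \<open>wmeas\<close>.\<close>
    have "(\<lambda>n. \<integral>\<^sup>+x. ennreal ((\<psi> k x - u x)\<^sup>2) * indicator {x. norm x > 1 / real (Suc n)} x \<partial>wmeas \<alpha>)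
      \<longlonglongrightarrow> (\<integral>\<^sup>+x. ennreal ((\<psi> k x - u x)\<^sup>2) * indicator {x. x \<noteq> 0} x \<partial>wmeas \<alpha>)"
    proof (rule nn_integral_LIMSEQ)
      show "incseq (\<lambda>n x. ennreal ((\<psi> k x - u x)\<^sup>2) * indicator {x. norm x > 1 / real (Suc n)} x)"
      proof (intro incseq_SucI le_funI mult_left_mono)
        fix n and x :: "real^'n"
        have "1 / real (Suc (Suc n)) \<le> 1 / real (Suc n)" by (simp add: field_simps)
        then show "(indicator {x. norm x > 1 / real (Suc n)} x :: ennreal)
          \<le> indicator {x. norm x > 1 / real (Suc (Suc n))} x"
          by (auto simp: indicator_def)
      qed simp
      show "(\<lambda>n. ennreal ((\<psi> k x - u x)\<^sup>2) * indicator {x. norm x > 1 / real (Suc n)} x)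
        \<longlonglongrightarrow> ennreal ((\<psi> k x - u x)\<^sup>2) * indicator {x. x \<noteq> 0} x" for x
      proof (cases "x = 0")
        case False
        then have "(\<lambda>n. 1 / real (Suc n)) \<longlonglongrightarrow> 0" "norm x > 0" using LIMSEQ_Suc[OF lim_1_over_n] by auto
        then have "\<forall>\<^sub>F n in sequentially. norm x > 1 / real (Suc n)" by (rule order_tendstoD(2))
        then have "\<forall>\<^sub>F n in sequentially. ennreal ((\<psi> k x - u x)\<^sup>2) * indicator {x. norm x > 1 / real (Suc n)} x
          = ennreal ((\<psi> k x - u x)\<^sup>2) * indicator {x. x \<noteq> 0} x"
          by eventually_elim (use False in simp)
        then show ?thesis by (rule tendsto_eventually)
      qed simp
    qed measurable
    then have "(\<integral>\<^sup>+x. ennreal ((\<psi> k x - u x)\<^sup>2) * indicator {x. x \<noteq> 0} x \<partial>wmeas \<alpha>) \<le> ennreal (4 * (a k + b k + e) / homdim \<alpha>)"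
      by (rule LIMSEQ_le_const2) (use trunc in auto)
    also have "(\<integral>\<^sup>+x. ennreal ((\<psi> k x - u x)\<^sup>2) * indicator {x. x \<noteq> 0} x \<partial>wmeas \<alpha>) = (\<integral>\<^sup>+x. ennreal ((\<psi> k x - u x)\<^sup>2) \<partial>wmeas \<alpha>)"
      by (intro nn_integral_cong_AE) (use AE_wmeas_nonzero[of \<alpha>] in \<open>auto elim!: eventually_mono\<close>)
    finally show ?thesis .
  qed
  show int: "integrable (wmeas \<alpha>) (\<lambda>x. (\<psi> k x - u x)\<^sup>2)" for k
    using key[of 1 k] by (intro integrableI_nonneg) (auto simp: order.strict_trans1[OF _ ennreal_less_top])
  have le: "(\<integral>x. (\<psi> k x - u x)\<^sup>2 \<partial>wmeas \<alpha>) \<le> 4 * (a k + b k + 1 / real (Suc k)) / homdim \<alpha>" for k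
  proof -
    have "0 \<le> a k" "0 \<le> b k" unfolding a_def b_def by simp_all
    then have "0 \<le> 4 * (a k + b k + 1 / real (Suc k)) / homdim \<alpha>" using D by simp
    moreover have "ennreal (\<integral>x. (\<psi> k x - u x)\<^sup>2 \<partial>wmeas \<alpha>) \<le> ennreal (4 * (a k + b k + 1 / real (Suc k)) / homdim \<alpha>)"
      using key[of "1 / real (Suc k)" k] nn_integral_eq_integral[OF int[of k]] by simp
    ultimately show ?thesis by simp
  qed
  have "(\<lambda>k. 4 * (a k + b k + 1 / real (Suc k)) / homdim \<alpha>) \<longlonglongrightarrow> 4 * (0 + 0 + 0) / homdim \<alpha>"
    using A B D LIMSEQ_Suc[OF lim_1_over_n] unfolding a_def[symmetric] b_def[symmetric] by (intro tendsto_intros) auto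
  then have "(\<lambda>k. 4 * (a k + b k + 1 / real (Suc k)) / homdim \<alpha>) \<longlonglongrightarrow> 0" by simp
  then show "(\<lambda>k. \<integral>x. (\<psi> k x - u x)\<^sup>2 \<partial>wmeas \<alpha>) \<longlonglongrightarrow> 0"
    by (rule tendsto_sandwich[OF _ _ tendsto_const, rotated 2]) (use le in auto)
qed

text \<open>The competitor \<open>v\<close> is chosen for the approximant \<open>\<psi>\<close>,
  whereas the infimum concerns \<open>u\<close>; the triangle inequality makes up the difference.
  The truncation at 0 keeps the inequality valid when it is squared.\<close>

lemma le_of_approx_minimizer:
  fixes v :: "real^'n::finite \<Rightarrow> real"
  assumes [measurable]: "u \<in> borel_measurable borel" "v \<in> borel_measurable borel" "\<psi> \<in> borel_measurable borel"
    and i1: "integrable (wmeas \<alpha>) (\<lambda>x. (\<psi> x - v x)\<^sup>2)" and i2: "integrable (wmeas \<alpha>) (\<lambda>x. (\<psi> x - u x)\<^sup>2)"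
    and S: "sqrt (wint \<alpha> (\<lambda>x. (u x - v x)\<^sup>2)) \<in> S" "\<And>s. s \<in> S \<Longrightarrow> 0 \<le> s"
  shows "(max 0 (Inf S - sqrt (\<integral>x. (\<psi> x - u x)\<^sup>2 \<partial>wmeas \<alpha>)))\<^sup>2 \<le> (\<integral>x. (\<psi> x - v x)\<^sup>2 \<partial>wmeas \<alpha>)"
proof -
  have i2': "integrable (wmeas \<alpha>) (\<lambda>x. (u x - \<psi> x)\<^sup>2)" using i2 by (simp add: power2_commute)
  have "Inf S \<le> sqrt (wint \<alpha> (\<lambda>x. (u x - v x)\<^sup>2))"
    using S by (intro cInf_lower bdd_belowI[of _ 0]) auto
  also have "\<dots> = L2norm (wmeas \<alpha>) (\<lambda>x. (\<psi> x - v x) + (u x - \<psi> x))"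
    by (subst wint_eq) (simp_all add: L2norm_def)
  also have "\<dots> \<le> L2norm (wmeas \<alpha>) (\<lambda>x. \<psi> x - v x) + L2norm (wmeas \<alpha>) (\<lambda>x. u x - \<psi> x)"
    using i1 i2' by (intro L2norm_triangle(2)) auto
  also have "L2norm (wmeas \<alpha>) (\<lambda>x. u x - \<psi> x) = sqrt (\<integral>x. (\<psi> x - u x)\<^sup>2 \<partial>wmeas \<alpha>)"
    by (simp add: L2norm_def power2_commute)
  finally have "max 0 (Inf S - sqrt (\<integral>x. (\<psi> x - u x)\<^sup>2 \<partial>wmeas \<alpha>)) \<le> L2norm (wmeas \<alpha>) (\<lambda>x. \<psi> x - v x)"
    by (simp add: L2norm_nonneg)
  then have "(max 0 (Inf S - sqrt (\<integral>x. (\<psi> x - u x)\<^sup>2 \<partial>wmeas \<alpha>)))\<^sup>2 \<le> (L2norm (wmeas \<alpha>) (\<lambda>x. \<psi> x - v x))\<^sup>2"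
    by (intro power_mono) auto
  then show ?thesis by (simp add: L2norm_def)
qed

text \<open>Limit of \<open>gaussian_deficit\<close> along an approximating sequence. The
  coefficients of the approximants change with \<open>k\<close> and need not converge: they are
  bounded below by the infima for \<open>u\<close> up to an error \<open>\<epsilon> k\<close> before
  the limit is taken.\<close>

lemma deficit_at_scale:
  fixes \<alpha> :: "real^'n::finite" and u :: "real^'n \<Rightarrow> real" and g :: "real^'n \<Rightarrow> real^'n"
  assumes \<alpha>: "\<And>i. \<alpha> $ i \<ge> 0" and SA: "(u, g) \<in> SA \<alpha>" and s: "s > 0"
  shows "2 * (dA \<alpha> u)\<^sup>2 + 2 * (dtA \<alpha> u)\<^sup>2 \<le> wint \<alpha> (\<lambda>x. (norm (g x))\<^sup>2) / s
    + s * wint \<alpha> (\<lambda>x. (u x)\<^sup>2 * (norm x)\<^sup>2) - homdim \<alpha> * wint \<alpha> (\<lambda>x. (u x)\<^sup>2)"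
proof -
  have mu[measurable]: "u \<in> borel_measurable borel" and mg[measurable]: "g \<in> borel_measurable borel"
    using SA by (auto simp: SA_def)
  obtain \<phi> where \<phi>: "\<And>k. \<phi> k \<in> Nstar \<alpha>"
    and lA: "(\<lambda>k. wnn \<alpha> (\<lambda>x. (norm (grad (\<phi> k) x - g x))\<^sup>2)) \<longlonglongrightarrow> 0"
    and lB: "(\<lambda>k. wnn \<alpha> (\<lambda>x. (\<phi> k x - u x)\<^sup>2 * (norm x)\<^sup>2)) \<longlonglongrightarrow> 0"
    using SA by (auto simp: SA_def)
  have C: "C1_compact (\<phi> k)" for k by (rule Nstar_C1_compact[OF \<phi>])
  note [measurable] = C1_compact_integrable(4,5)[OF \<alpha> C]
  have "\<forall>\<^sub>F k in sequentially. wnn \<alpha> (\<lambda>x. (norm (grad (\<phi> k) x - g x))\<^sup>2) < \<infinity>"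
    "\<forall>\<^sub>F k in sequentially. wnn \<alpha> (\<lambda>x. (\<phi> k x - u x)\<^sup>2 * (norm x)\<^sup>2) < \<infinity>"
    using order_tendstoD(2)[OF lA, of \<infinity>] order_tendstoD(2)[OF lB, of \<infinity>] by auto
  then have "\<forall>\<^sub>F k in sequentially. wnn \<alpha> (\<lambda>x. (norm (grad (\<phi> k) x - g x))\<^sup>2) < \<infinity>
    \<and> wnn \<alpha> (\<lambda>x. (\<phi> k x - u x)\<^sup>2 * (norm x)\<^sup>2) < \<infinity>"
    by (rule eventually_conj)
  then obtain K where K: "\<And>k. k \<ge> K \<Longrightarrow> wnn \<alpha> (\<lambda>x. (norm (grad (\<phi> k) x - g x))\<^sup>2) < \<infinity>"
    "\<And>k. k \<ge> K \<Longrightarrow> wnn \<alpha> (\<lambda>x. (\<phi> k x - u x)\<^sup>2 * (norm x)\<^sup>2) < \<infinity>"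
    by (auto simp: eventually_sequentially)
  \<comment> \<open>Convergence to 0 in the extended reals allows finitely many infinite terms;
    after the shift all of them are finite and can be read as real integrals.\<close>
  define \<psi> where "\<psi> k = \<phi> (k + K)" for k
  have C\<psi>: "C1_compact (\<psi> k)" for k by (simp add: \<psi>_def C)
  note I = C1_compact_integrable[OF \<alpha> C\<psi>]
  note [measurable] = I(4,5)
  have fA: "integrable (wmeas \<alpha>) (\<lambda>x. (norm (grad (\<psi> k) x - g x))\<^sup>2)"
      "wnn \<alpha> (\<lambda>x. (norm (grad (\<psi> k) x - g x))\<^sup>2) = ennreal (\<integral>x. (norm (grad (\<psi> k) x - g x))\<^sup>2 \<partial>wmeas \<alpha>)"
    and fB: "integrable (wmeas \<alpha>) (\<lambda>x. (\<psi> k x - u x)\<^sup>2 * (norm x)\<^sup>2)"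
      "wnn \<alpha> (\<lambda>x. (\<psi> k x - u x)\<^sup>2 * (norm x)\<^sup>2) = ennreal (\<integral>x. (\<psi> k x - u x)\<^sup>2 * (norm x)\<^sup>2 \<partial>wmeas \<alpha>)" for k
    using K[of "k + K"] by (intro wnn_finite; simp add: \<psi>_def[symmetric])+
  have A: "(\<lambda>k. \<integral>x. (norm (grad (\<psi> k) x - g x))\<^sup>2 \<partial>wmeas \<alpha>) \<longlonglongrightarrow> 0"
    using LIMSEQ_ignore_initial_segment[OF lA, of K] fA(2)
    by (simp add: \<psi>_def[symmetric] ennreal_0[symmetric] del: ennreal_0)
  have B: "(\<lambda>k. \<integral>x. (\<psi> k x - u x)\<^sup>2 * (norm x)\<^sup>2 \<partial>wmeas \<alpha>) \<longlonglongrightarrow> 0"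
    using LIMSEQ_ignore_initial_segment[OF lB, of K] fB(2)
    by (simp add: \<psi>_def[symmetric] ennreal_0[symmetric] del: ennreal_0)
  note L2 = L2_limit[OF \<alpha> C\<psi> mu mg fA(1) fB(1) A B]
  have X: "(\<lambda>k. \<integral>x. (norm (grad (\<psi> k) x))\<^sup>2 \<partial>wmeas \<alpha>) \<longlonglongrightarrow> wint \<alpha> (\<lambda>x. (norm (g x))\<^sup>2)"
    using tendsto_integral_norm_sq[of g "wmeas \<alpha>" "\<lambda>k. grad (\<psi> k)", OF _ _ I(1) fA(1) A] by (simp add: wint_eq)
  have Y: "(\<lambda>k. \<integral>x. (\<psi> k x)\<^sup>2 * (norm x)\<^sup>2 \<partial>wmeas \<alpha>) \<longlonglongrightarrow> wint \<alpha> (\<lambda>x. (u x)\<^sup>2 * (norm x)\<^sup>2)"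
  proof -
    have eq: "(norm (\<psi> k x * norm x - u x * norm x))\<^sup>2 = (\<psi> k x - u x)\<^sup>2 * (norm x)\<^sup>2" for k x
      by (simp add: left_diff_distrib[symmetric] power_mult_distrib)
    have "(\<lambda>k. \<integral>x. (norm (\<psi> k x * norm x))\<^sup>2 \<partial>wmeas \<alpha>) \<longlonglongrightarrow> (\<integral>x. (norm (u x * norm x))\<^sup>2 \<partial>wmeas \<alpha>)"
      by (rule tendsto_integral_norm_sq) (use I(2) fB(1) B in \<open>simp_all add: eq[simplified] power_mult_distrib\<close>)
    then show ?thesis by (simp add: wint_eq power_mult_distrib)
  qed
  have W: "(\<lambda>k. \<integral>x. (\<psi> k x)\<^sup>2 \<partial>wmeas \<alpha>) \<longlonglongrightarrow> wint \<alpha> (\<lambda>x. (u x)\<^sup>2)"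
    using tendsto_integral_norm_sq[of u "wmeas \<alpha>" \<psi>] I(3) L2 by (simp add: wint_eq)
  define \<epsilon> where "\<epsilon> k = sqrt (\<integral>x. (\<psi> k x - u x)\<^sup>2 \<partial>wmeas \<alpha>)" for k
  have \<epsilon>: "\<epsilon> \<longlonglongrightarrow> 0" using tendsto_real_sqrt[OF L2(2)] by (simp add: \<epsilon>_def[abs_def])
  \<comment> \<open>This value makes the exponent in the definitions of \<open>dA\<close> and
    \<open>dtA\<close> the one produced by \<open>gaussian_deficit\<close> at scale
    \<open>s\<close>.\<close>
  define lam where "lam = 1 / sqrt s"
  have lam: "lam \<noteq> 0" "- (norm x)\<^sup>2 / (2 * lam\<^sup>2) = - s * (norm x)\<^sup>2 / 2" for x :: "real^'n"
    using s by (auto simp: lam_def power_divide)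
  have wn: "0 \<le> sqrt (wint \<alpha> (\<lambda>x. (f x)\<^sup>2))" for f
    by (auto simp: wint_def set_lebesgue_integral_def xA_nonneg intro!: Bochner_Integration.integral_nonneg)
  have bound: "2 * (max 0 (dA \<alpha> u - \<epsilon> k))\<^sup>2 + 2 * (max 0 (dtA \<alpha> u - \<epsilon> k))\<^sup>2
    \<le> (\<integral>x. (norm (grad (\<psi> k) x))\<^sup>2 \<partial>wmeas \<alpha>) / s + s * (\<integral>x. (\<psi> k x)\<^sup>2 * (norm x)\<^sup>2 \<partial>wmeas \<alpha>)
       - homdim \<alpha> * (\<integral>x. (\<psi> k x)\<^sup>2 \<partial>wmeas \<alpha>)" for k
  proof (rule gaussian_deficit[OF s \<alpha> C\<psi>[of k]])
    fix c c' d
    assume i1: "square_integrable (wmeas \<alpha>) (\<lambda>x. \<psi> k x - c * exp (- s * (norm x)\<^sup>2 / 2))"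
      and i2: "square_integrable (wmeas \<alpha>) (\<lambda>x. \<psi> k x - (c' + d \<bullet> x) * exp (- s * (norm x)\<^sup>2 / 2))"
      and le: "2 * (\<integral>x. (\<psi> k x - c * exp (- s * (norm x)\<^sup>2 / 2))\<^sup>2 \<partial>wmeas \<alpha>)
      + 2 * (\<integral>x. (\<psi> k x - (c' + d \<bullet> x) * exp (- s * (norm x)\<^sup>2 / 2))\<^sup>2 \<partial>wmeas \<alpha>)
     \<le> (\<integral>x. (norm (grad (\<psi> k) x))\<^sup>2 \<partial>wmeas \<alpha>) / s + s * (\<integral>x. (\<psi> k x)\<^sup>2 * (norm x)\<^sup>2 \<partial>wmeas \<alpha>)
       - homdim \<alpha> * (\<integral>x. (\<psi> k x)\<^sup>2 \<partial>wmeas \<alpha>)"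
    have "(max 0 (dA \<alpha> u - \<epsilon> k))\<^sup>2 \<le> (\<integral>x. (\<psi> k x - c * exp (- s * (norm x)\<^sup>2 / 2))\<^sup>2 \<partial>wmeas \<alpha>)"
      unfolding dA_def \<epsilon>_def
    proof (rule le_of_approx_minimizer)
      show "sqrt (wint \<alpha> (\<lambda>x. (u x - c * exp (- s * (norm x)\<^sup>2 / 2))\<^sup>2))
        \<in> {sqrt (wint \<alpha> (\<lambda>x. (u x - c * exp (- (norm x)\<^sup>2 / (2 * lam\<^sup>2)))\<^sup>2)) |c lam. lam \<noteq> 0}"
        unfolding lam(2)[symmetric] using lam(1) by blast
    qed (use i1 L2(1) wn in \<open>auto simp: square_integrable_def\<close>)
    moreover have "(max 0 (dtA \<alpha> u - \<epsilon> k))\<^sup>2 \<le> (\<integral>x. (\<psi> k x - (c' + d \<bullet> x) * exp (- s * (norm x)\<^sup>2 / 2))\<^sup>2 \<partial>wmeas \<alpha>)"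
      unfolding dtA_def \<epsilon>_def
    proof (rule le_of_approx_minimizer)
      show "sqrt (wint \<alpha> (\<lambda>x. (u x - (c' + d \<bullet> x) * exp (- s * (norm x)\<^sup>2 / 2))\<^sup>2))
        \<in> {sqrt (wint \<alpha> (\<lambda>x. (u x - (c + d \<bullet> x) * exp (- (norm x)\<^sup>2 / (2 * lam\<^sup>2)))\<^sup>2)) |c d lam. lam \<noteq> 0}"
        unfolding lam(2)[symmetric] using lam(1) by blast
    qed (use i2 L2(1) wn in \<open>auto simp: square_integrable_def\<close>)
    ultimately show ?thesis using le by linarith
  qed
  have nn: "0 \<le> dA \<alpha> u" "0 \<le> dtA \<alpha> u"
    unfolding dA_def dtA_def by (rule cInf_greatest; use wn in \<open>auto intro: exI[of _ 1]\<close>)+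
  have "(\<lambda>k. 2 * (max 0 (dA \<alpha> u - \<epsilon> k))\<^sup>2 + 2 * (max 0 (dtA \<alpha> u - \<epsilon> k))\<^sup>2)
    \<longlonglongrightarrow> 2 * (max 0 (dA \<alpha> u - 0))\<^sup>2 + 2 * (max 0 (dtA \<alpha> u - 0))\<^sup>2"
    by (intro tendsto_intros \<epsilon>)
  moreover have "(\<lambda>k. (\<integral>x. (norm (grad (\<psi> k) x))\<^sup>2 \<partial>wmeas \<alpha>) / s + s * (\<integral>x. (\<psi> k x)\<^sup>2 * (norm x)\<^sup>2 \<partial>wmeas \<alpha>)
       - homdim \<alpha> * (\<integral>x. (\<psi> k x)\<^sup>2 \<partial>wmeas \<alpha>)) \<longlonglongrightarrow> wint \<alpha> (\<lambda>x. (norm (g x))\<^sup>2) / s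
    + s * wint \<alpha> (\<lambda>x. (u x)\<^sup>2 * (norm x)\<^sup>2) - homdim \<alpha> * wint \<alpha> (\<lambda>x. (u x)\<^sup>2)"
    using s by (intro tendsto_intros X Y W) auto
  ultimately have "2 * (max 0 (dA \<alpha> u - 0))\<^sup>2 + 2 * (max 0 (dtA \<alpha> u - 0))\<^sup>2 \<le> wint \<alpha> (\<lambda>x. (norm (g x))\<^sup>2) / s
    + s * wint \<alpha> (\<lambda>x. (u x)\<^sup>2 * (norm x)\<^sup>2) - homdim \<alpha> * wint \<alpha> (\<lambda>x. (u x)\<^sup>2)"
    by (rule LIMSEQ_le) (use bound in blast)
  then show ?thesis using nn by simp
qed

text \<open>The best scale is \<open>sqrt X / sqrt Y\<close>, which is not a positive number when
  \<open>X\<close> or \<open>Y\<close> is 0. Adding \<open>e\<close> to both roots makes it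
  admissible, and \<open>e\<close> then tends to 0.\<close>

lemma le_sqrt_mult_of_scaled:
  fixes L X Y :: real
  assumes XY: "X \<ge> 0" "Y \<ge> 0" and L: "\<And>s. s > 0 \<Longrightarrow> L \<le> X / s + s * Y"
  shows "L \<le> 2 * (sqrt X * sqrt Y)"
proof -
  have "L \<le> 2 * ((sqrt X + e) * (sqrt Y + e))" if e: "e > 0" for e
  proof -
    define x y where "x = sqrt X + e" and "y = sqrt Y + e"
    have xy: "x > 0" "y > 0" using XY e by (auto simp: x_def y_def add_nonneg_pos)
    have "X \<le> x\<^sup>2" "Y \<le> y\<^sup>2"
      using XY e by (auto simp: x_def y_def power2_sum)
    then have "X / (x / y) + x / y * Y \<le> x\<^sup>2 / (x / y) + x / y * y\<^sup>2"
      using xy by (intro add_mono divide_right_mono mult_left_mono) auto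
    also have "\<dots> = 2 * (x * y)" using xy by (simp add: field_simps power2_eq_square)
    finally show ?thesis using L[of "x / y"] xy by (simp add: x_def y_def)
  qed
  then have "\<forall>\<^sub>F e in at_right 0. L \<le> 2 * ((sqrt X + e) * (sqrt Y + e))"
    by (auto simp: eventually_at_right_field intro: exI[of _ 1])
  moreover have "((\<lambda>e. 2 * ((sqrt X + e) * (sqrt Y + e))) \<longlongrightarrow> 2 * ((sqrt X + 0) * (sqrt Y + 0))) (at_right 0)"
    by (intro tendsto_intros)
  ultimately have "L \<le> 2 * ((sqrt X + 0) * (sqrt Y + 0))"
    by (intro tendsto_lowerbound[of _ _ "at_right 0"]) auto
  then show ?thesis by simp
qed

theorem theorem1p11:
  fixes \<alpha> :: "real^'n::finite" and u :: "real^'n \<Rightarrow> real" and g :: "real^'n \<Rightarrow> real^'n"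
  assumes "\<forall>i. \<alpha> $ i \<ge> 0"
    and "(u, g) \<in> SA \<alpha>"
  shows "deltaA \<alpha> u g - (dA \<alpha> u)\<^sup>2 \<ge> 1/2 * (dtA \<alpha> u)\<^sup>2"
proof -
  define X Y W where "X = wint \<alpha> (\<lambda>x. (norm (g x))\<^sup>2)" and "Y = wint \<alpha> (\<lambda>x. (u x)\<^sup>2 * (norm x)\<^sup>2)"
    and "W = wint \<alpha> (\<lambda>x. (u x)\<^sup>2)"
  have "X \<ge> 0" "Y \<ge> 0"
    by (auto simp: X_def Y_def wint_def set_lebesgue_integral_def xA_nonneg intro!: Bochner_Integration.integral_nonneg)
  moreover have "2 * (dA \<alpha> u)\<^sup>2 + 2 * (dtA \<alpha> u)\<^sup>2 + homdim \<alpha> * W \<le> X / s + s * Y" if "s > 0" for s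
    using deficit_at_scale[of \<alpha> u g s] assms that by (simp add: X_def Y_def W_def)
  ultimately have "2 * (dA \<alpha> u)\<^sup>2 + 2 * (dtA \<alpha> u)\<^sup>2 + homdim \<alpha> * W \<le> 2 * (sqrt X * sqrt Y)"
    by (rule le_sqrt_mult_of_scaled)
  \<comment> \<open>Half of the optimised inequality. The coefficient obtained for
    \<open>(dtA \<alpha> u)^2\<close> is 1, so the claim with coefficient 1/2 follows from
    nonnegativity.\<close>
  then have "(dA \<alpha> u)\<^sup>2 + (dtA \<alpha> u)\<^sup>2 \<le> deltaA \<alpha> u g"
    by (simp add: deltaA_def X_def Y_def W_def)
  moreover have "0 \<le> (dtA \<alpha> u)\<^sup>2" by simp
  ultimately show ?thesis by linarith
qed

end
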